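(* Assume the Riemann Hypothesis. Let $\alpha\ge0.49123$, $t\ge10$, and $2\le x\le t^2$, and suppose $t$ is not the ordinate of a zero of $\zeta$. Then \[ \log\left|\zeta\left(\tfrac12+\mathrm{i}t\right)\right|\le\sum_{n\le x}\frac{\Lambda(n)\log(x/n)\cos(t\log n)}{n^{\sigma_{x,\alpha}}\log n\,\log x}+\frac{1+\alpha}{2}\frac{\log t}{\log x}+\frac{3(1+\alpha)}{\log x}+\frac{e^{-\alpha}}{\sqrt x\log^2x}\left(1+\frac{1}{x(x^2-1)}\right), \] where $\sigma_{x,\alpha}=\frac12+\frac{\alpha}{\log x}$.
   Context: $\zeta$ is the Riemann zeta-function and $\Lambda$ the von Mangoldt function. The Riemann Hypothesis asserts that all nontrivial zeros of $\zeta$ have real part $1/2$. *)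

theory Defs
  imports
    "HOL-Complex_Analysis.Complex_Analysis"
    "HOL-Number_Theory.Number_Theory"
begin

(* The Riemann zeta-function, as the unique analytic continuation to the punctured plane of
   the Dirichlet series on Re s > 1.  The value at the pole s = 1 is a dummy value. *)
definition zeta :: "complex \<Rightarrow> complex" where
  "zeta = (THE f. f holomorphic_on (- {1}) \<and>
                  (\<forall>s. Re s > 1 \<longrightarrow> (\<lambda>n. 1 / of_nat (Suc n) powr s) sums f s) \<and>
                  f 1 = 0)"

(* The point 1 is excluded because zeta has a pole there. *)
definition zeta_zeros :: "complex set" where
  "zeta_zeros = {s. s \<noteq> 1 \<and> zeta s = 0}"

(* The trivial zeros are the negative even integers -2, -4, -6, ... *)
definition nontrivial_zeta_zeros :: "complex set" where
  "nontrivial_zeta_zeros = zeta_zeros - {- 2 * of_nat k | k. k \<ge> 1}"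

definition Riemann_Hypothesis :: bool where
  "Riemann_Hypothesis \<longleftrightarrow> (\<forall>s \<in> nontrivial_zeta_zeros. Re s = 1 / 2)"

definition sigma_line :: "real \<Rightarrow> real \<Rightarrow> real" where
  "sigma_line x \<alpha> = 1 / 2 + \<alpha> / ln x"

end

(* The completed function xi is entire, satisfies log|xi(s)| << |s|^(3/2), and under RH all its zeros
   lie on Re s = 1/2.  Hadamard's theorem (via Borel-Caratheodory) expresses xi'/xi as a
   constant plus a sum over the zeros, and the functional equation, which comes from the theta
   function, gives Re (xi'/xi)(s) = sum_rho Re (1 / (s - rho)).  Write S for the sum over the
   zeros of 1 / |s - rho|^2 at s = sigma + it, sigma = 1/2 + u.  Then -Re (zeta'/zeta)(s) is at
   most log t / 2 + 3 - u S, and integrating this over [1/2, sigma], where S decreases, bounds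
   log|zeta(1/2 + it)| by log|zeta(s)| + u (log t / 2 + 3) - u^2 S / 2.

   An explicit formula (proved by Liouville's theorem: the difference of the two sides is an
   entire function of small growth) integrated from sigma to infinity bounds log|zeta(s)| by the
   sum over primes, plus the term Re (zeta'/zeta)(s) / log x, plus e^(-alpha) S / log^2 x and a small
   remainder.  For u = alpha / log x the total coefficient of S is
   (e^(-alpha) - alpha - alpha^2 / 2) / log^2 x, which is nonpositive as alpha >= 0.49123.
   When sigma > 3 the claim follows from a crude bound at Re s = 2. *)
theory Submission
  imports Defs "HOL-Probability.Probability" "HOL-Real_Asymp.Real_Asymp"
begin

section \<open>Partial fractions of entire functions of order less than two\<close>

text \<open>The exponent 3/2 is a convenient value between 1 and 2. Above 1, it swallows the X ln X
  that the Gamma function and the Mellin integral bring; below 2, it makes the error of the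
  truncated partial fractions, of size R^(3/2) / R^2 after one differentiation, vanish. One constant
  of the expansion stays unknown: it cancels in differences, and its real part is settled by the
  symmetry of |xi| about Re s = 1/2. The zero count obtained from this growth does not make the sum
  of 1 / (s - p) absolutely convergent, only that of 1 / (s - p)^2. Hence the explicit formula is
  stated for the derivative of x^s f'(s) / f(s), which has pure double poles that the zeros cancel
  one by one. It is applied to (s - 1) zeta(s), whose zeros include the trivial ones, because for Re
  s >= 2 the Dirichlet series has to take over. Since \<open>zeta\<close> is given by a definite
  description, a continuation must be built before anything can be said about it; Riemann's integral
  over the theta function provides it. Integrals over \<sigma> are replaced by monotonicity of
  auxiliary functions.\<close>

lemma entire_factor_at:
  assumes f: "f holomorphic_on UNIV" and ne: "f z0 \<noteq> 0"
  obtains g where "g holomorphic_on UNIV" "g p \<noteq> 0"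
    "\<And>z. f z = g z * (z - p) ^ nat (zorder f p)"
proof -
  define n where "n = nat (zorder f p)"
  have "\<exists>w\<in>UNIV. f w \<noteq> 0" using ne by auto
  note zorder_exist_zero[OF f open_UNIV connected_UNIV UNIV_I this, of p]
  then obtain r where r: "r > 0"
    "zor_poly f p holomorphic_on cball p r"
    "\<And>w. w \<in> cball p r \<Longrightarrow> f w = zor_poly f p w * (w - p) ^ n \<and> zor_poly f p w \<noteq> 0"
    unfolding n_def by blast
  define g where "g = (\<lambda>z. if z = p then zor_poly f p p else f z / (z - p) ^ n)"
  have eq: "g w = zor_poly f p w" if "w \<in> ball p r" for w
    using r(3)[of w] that by (auto simp: g_def)
  have 1: "g holomorphic_on ball p r"
    using r(2) eq by (metis ball_subset_cball holomorphic_on_subset holomorphic_transform)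
  have "(\<lambda>z. f z / (z - p) ^ n) holomorphic_on - {p}"
    by (intro holomorphic_intros holomorphic_on_subset[OF f]) auto
  hence 2: "g holomorphic_on - {p}"
    by (rule holomorphic_transform) (auto simp: g_def)
  have "g holomorphic_on (ball p r \<union> - {p})"
    by (rule holomorphic_on_Un[OF 1 2]) auto
  also have "ball p r \<union> - {p} = UNIV" using r(1) by auto
  finally have "g holomorphic_on UNIV" .
  moreover have "g p \<noteq> 0" using r(3)[of p] r(1) by (auto simp: g_def)
  moreover have "f z = g z * (z - p) ^ n" for z
    using r(3)[of p] r(1) by (cases "z = p") (auto simp: g_def)
  ultimately show ?thesis using that unfolding n_def by blast
qed

lemma zorder_nonneg_entire:
  assumes "f holomorphic_on UNIV" "f z0 \<noteq> 0"
  shows "zorder f p \<ge> 0" "f p = 0 \<longleftrightarrow> zorder f p > 0"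
proof -
  have "\<exists>w\<in>UNIV. f w \<noteq> 0" using assms(2) by auto
  note conjunct1[OF zorder_exist_zero[OF assms(1) open_UNIV connected_UNIV UNIV_I this, of p]]
  thus "zorder f p \<ge> 0" "f p = 0 \<longleftrightarrow> zorder f p > 0"
    by (metis less_imp_le order_refl, metis less_irrefl)
qed

text \<open>Zeros are split off one at a time. The product over the points already treated does not
  vanish at a new point p, so the current quotient has the same order at p as \<open>f\<close>; this
  is why all exponents can be written with \<open>zorder f\<close>.\<close>

lemma entire_factor_finite:
  assumes f: "f holomorphic_on UNIV" and f0: "f 0 \<noteq> 0" and "finite S"
  shows "\<exists>g. g holomorphic_on UNIV \<and> (\<forall>p\<in>S. g p \<noteq> 0) \<and>
    (\<forall>z. f z = g z * (\<Prod>p\<in>S. (z - p) ^ nat (zorder f p)))"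
  using \<open>finite S\<close>
proof induction
  case empty
  show ?case using f by auto
next
  case (insert p S)
  then obtain g where g: "g holomorphic_on UNIV" "\<forall>p\<in>S. g p \<noteq> 0"
    "\<And>z. f z = g z * (\<Prod>p\<in>S. (z - p) ^ nat (zorder f p))" by blast
  have g0: "g 0 \<noteq> 0" using f0 g(3)[of 0] by auto
  obtain h where h: "h holomorphic_on UNIV" "h p \<noteq> 0"
    "\<And>z. g z = h z * (z - p) ^ nat (zorder g p)"
    using entire_factor_at[OF g(1) g0] by blast
  have "zorder f p = zorder g p"
  proof (rule zorder_eqI[of UNIV])
    show "(\<lambda>w. h w * (\<Prod>p\<in>S. (w - p) ^ nat (zorder f p))) holomorphic_on UNIV"
      by (intro holomorphic_intros h)
    show "h p * (\<Prod>q\<in>S. (p - q) ^ nat (zorder f q)) \<noteq> 0"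
      using h(2) insert.hyps by auto
    show "f w = h w * (\<Prod>p\<in>S. (w - p) ^ nat (zorder f p)) * (w - p) powi zorder g p" for w
      using g(3)[of w] h(3)[of w] zorder_nonneg_entire(1)[OF g(1) g0, of p]
      by (simp add: power_int_def)
  qed auto
  hence "f z = h z * (\<Prod>p\<in>insert p S. (z - p) ^ nat (zorder f p))" for z
    using g(3)[of z] h(3)[of z] insert.hyps by simp
  moreover have "\<forall>q\<in>insert p S. h q \<noteq> 0"
    using h(2) h(3) g(2) by (metis insert_iff mult_eq_0_iff)
  ultimately show ?case using h(1) by blast
qed

text \<open>The map a -> a / (2B - a) sends the half plane Re a < B into the unit disc and fixes 0,
  so the Schwarz lemma applies to its composition with the rescaled \<open>l\<close>. The conclusion
  is the resulting inequality solved for \<open>norm (l z)\<close>.\<close>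

lemma Borel_Caratheodory_0:
  assumes hol: "l holomorphic_on ball 0 r" and r: "r > 0" and l0: "l 0 = 0"
    and B: "\<And>z. z \<in> ball 0 r \<Longrightarrow> Re (l z) < B" and z: "norm z < r"
  shows "norm (l z) * (r - norm z) \<le> 2 * B * norm z"
proof -
  have Bpos: "B > 0" using B[of 0] r l0 by simp
  define \<phi> where "\<phi> = (\<lambda>w. l (of_real r * w) / (of_real (2 * B) - l (of_real r * w)))"
  have inb: "of_real r * w \<in> ball 0 r" if "norm w < 1" for w :: complex
    using that r by (simp add: norm_mult)
  have ne: "of_real (2 * B) - l (of_real r * w) \<noteq> 0" if "norm w < 1" for w
  proof
    assume "of_real (2 * B) - l (of_real r * w) = 0"
    hence "Re (l (of_real r * w)) = 2 * B" by (metis Re_complex_of_real right_minus_eq)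
    with B[OF inb[OF that]] Bpos show False by simp
  qed
  have hol': "\<phi> holomorphic_on ball 0 1"
    unfolding \<phi>_def
  proof (intro holomorphic_intros)
    have "(l \<circ> (\<lambda>w. of_real r * w)) holomorphic_on ball 0 1"
      by (rule holomorphic_on_compose_gen[OF _ hol]) (use inb in \<open>auto intro!: holomorphic_intros\<close>)
    thus "(\<lambda>w. l (of_real r * w)) holomorphic_on ball 0 1"
      "(\<lambda>w. l (of_real r * w)) holomorphic_on ball 0 1" by (simp_all add: o_def)
  qed (use ne in auto)
  have lt: "norm (\<phi> w) < 1" if "norm w < 1" for w
  proof -
    define a where "a = l (of_real r * w)"
    have a: "Re a < B" using B[OF inb[OF that]] by (simp add: a_def)
    have "(norm a)\<^sup>2 < (norm (of_real (2 * B) - a))\<^sup>2"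
      using mult_strict_left_mono[OF a Bpos] unfolding cmod_power2
      by (simp add: power2_eq_square algebra_simps)
    hence "norm a < norm (of_real (2 * B) - a)"
      by (meson norm_ge_zero power2_less_imp_less)
    thus ?thesis unfolding \<phi>_def a_def[symmetric] by (simp add: norm_divide divide_less_eq)
  qed
  define w where "w = z / of_real r"
  have w: "norm w < 1" "of_real r * w = z" "norm w = norm z / r"
    using z r by (auto simp: w_def norm_divide)
  have "norm (\<phi> w) \<le> norm w"
    by (rule Schwarz_Lemma(1)[OF hol' _ lt w(1)]) (simp_all add: \<phi>_def l0)
  hence "norm (l z) \<le> norm z / r * norm (of_real (2 * B) - l z)"
    using ne[OF w(1)] unfolding \<phi>_def w by (simp add: norm_divide divide_le_eq)
  also have "\<dots> \<le> norm z / r * (2 * B + norm (l z))"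
    using norm_triangle_ineq4[of "of_real (2 * B)" "l z"] r Bpos
    by (intro mult_left_mono) auto
  finally have "norm (l z) * r \<le> norm z * (2 * B + norm (l z))"
    using r by (simp add: field_simps)
  thus ?thesis by (simp add: algebra_simps)
qed

lemma norm_prod_power_diff: "norm (\<Prod>p\<in>S. (z - p) ^ k p) = (\<Prod>p\<in>S. norm (z - p :: complex) ^ k p)"
  by (simp add: prod_norm[symmetric] norm_power)

lemma logderiv_mult_prod:
  fixes z :: complex
  assumes g: "g holomorphic_on UNIV" and fg: "\<And>z. f z = g z * (\<Prod>p\<in>S. (z - p) ^ k p)"
    and fz: "f z \<noteq> 0" and "finite S"
  shows "deriv f z / f z = deriv g z / g z + (\<Sum>p\<in>S. of_nat (k p) / (z - p))"
proof -
  have gz: "g z \<noteq> 0" using fz fg[of z] by auto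
  have dg: "(g has_field_derivative deriv g z) (at z)"
    using holomorphic_derivI[OF g] by auto
  have ne: "(z - p) ^ k p \<noteq> 0" if "p \<in> S" for p
    using fz fg[of z] that \<open>finite S\<close> by auto
  have dP: "((\<lambda>z. \<Prod>p\<in>S. (z - p) ^ k p) has_field_derivative
      (\<Prod>p\<in>S. (z - p) ^ k p) * (\<Sum>p\<in>S. of_nat (k p) / (z - p))) (at z)"
  proof -
    have "((\<lambda>z. \<Prod>p\<in>S. (z - p) ^ k p) has_field_derivative
        (\<Prod>p\<in>S. (z - p) ^ k p) * (\<Sum>p\<in>S. (of_nat (k p) * (z - p) ^ (k p - 1)) / ((z - p) ^ k p))) (at z)"
      by (rule has_field_derivative_prod') (use ne in \<open>auto intro!: derivative_eq_intros\<close>)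
    \<comment> \<open>The case \<open>k p = 0\<close> needs separate treatment because
      \<open>k p - 1\<close> truncates; both sides are then 0.\<close>
    also have "(\<Sum>p\<in>S. (of_nat (k p) * (z - p) ^ (k p - 1)) / ((z - p) ^ k p))
      = (\<Sum>p\<in>S. of_nat (k p) / (z - p))"
      by (intro sum.cong refl, rename_tac p, case_tac "k p") (use ne in auto)
    finally show ?thesis .
  qed
  have P: "(\<Prod>p\<in>S. (z - p) ^ k p) \<noteq> 0" using fz fg[of z] by auto
  have "(f has_field_derivative deriv g z * (\<Prod>p\<in>S. (z - p) ^ k p) +
     (\<Prod>p\<in>S. (z - p) ^ k p) * (\<Sum>p\<in>S. of_nat (k p) / (z - p)) * g z) (at z)"
    unfolding fg[abs_def] by (rule DERIV_mult[OF dg dP, THEN DERIV_cong]) simp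
  hence "deriv f z = deriv g z * (\<Prod>p\<in>S. (z - p) ^ k p) +
     (\<Prod>p\<in>S. (z - p) ^ k p) * (\<Sum>p\<in>S. of_nat (k p) / (z - p)) * g z"
    by (rule DERIV_imp_deriv)
  thus ?thesis using gz P by (simp add: fg[of z] field_simps)
qed

section \<open>Zero counting and local factorisation for growth exponent 3/2\<close>

locale entire_three_halves =
  fixes f :: "complex \<Rightarrow> complex" and C :: real
  assumes holo: "f holomorphic_on UNIV" and f0: "f 0 \<noteq> 0"
    and growth: "\<And>z. norm (f z) \<le> exp (C * (1 + norm z) powr (3/2))"
begin

definition Z :: "complex set" where "Z = {p. f p = 0}"

definition mult :: "complex \<Rightarrow> nat" where "mult p = nat (zorder f p)"

definition zeros_upto :: "real \<Rightarrow> complex set" where "zeros_upto R = {p \<in> Z. norm p \<le> R}"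

text \<open>The growth constant after normalising by \<open>f 0\<close>. For R >= 1 and norm z <= 4R
  one has 1 + norm z <= 5R, whence the 5; the logarithm absorbs the size of
  \<open>f 0\<close>.\<close>

definition K :: real where "K = \<bar>C\<bar> * 5 powr (3/2) + \<bar>ln (norm (f 0))\<bar>"

lemma mult_pos_iff: "mult p > 0 \<longleftrightarrow> p \<in> Z"
  using zorder_nonneg_entire[OF holo f0] by (auto simp: mult_def Z_def)

lemma nz: "0 \<notin> Z" using f0 by (auto simp: Z_def)


lemma finite_zeros_upto [simp]: "finite (zeros_upto R)"
proof (cases "Z = {}")
  case False
  then obtain p where p: "f p = 0" by (auto simp: Z_def)
  have "finite {z\<in>cball 0 R. f z = 0}"
  proof (rule holomorphic_compact_finite_zeros[OF holo])
    show "\<not> f constant_on UNIV" using p f0 unfolding constant_on_def by (metis UNIV_I)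
  qed (auto simp: connected_UNIV)
  also have "{z\<in>cball 0 R. f z = 0} = zeros_upto R" by (auto simp: zeros_upto_def Z_def)
  finally show ?thesis .
qed (auto simp: zeros_upto_def)

lemma zeros_upto_subset: "zeros_upto R \<subseteq> Z" by (auto simp: zeros_upto_def)

lemma K_nonneg: "K \<ge> 0" by (simp add: K_def)

lemma growth_ratio:
  assumes "R \<ge> 1" "norm z \<le> 4 * R"
  shows "norm (f z) \<le> norm (f 0) * exp (K * R powr (3/2))"
proof -
  have "1 + norm z \<le> 5 * R" using assms by linarith
  hence "(1 + norm z) powr (3/2) \<le> (5 * R) powr (3/2)" by (intro powr_mono2) auto
  also have "\<dots> = 5 powr (3/2) * R powr (3/2)" by (rule powr_mult)
  finally have 1: "(1 + norm z) powr (3/2) \<le> 5 powr (3/2) * R powr (3/2)" .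
  have R1: "R powr (3/2) \<ge> 1" using assms by (simp add: ge_one_powr_ge_zero)
  have "C * (1 + norm z) powr (3/2) \<le> \<bar>C\<bar> * (5 powr (3/2) * R powr (3/2))"
    using 1 by (intro mult_mono) auto
  also have "\<dots> - ln (norm (f 0)) \<le> K * R powr (3/2)"
  proof -
    have "- ln (norm (f 0)) \<le> \<bar>ln (norm (f 0))\<bar> * R powr (3/2)"
      using mult_left_mono[OF R1, of "\<bar>ln (norm (f 0))\<bar>"] by linarith
    thus ?thesis by (simp add: K_def algebra_simps)
  qed
  finally have "C * (1 + norm z) powr (3/2) \<le> ln (norm (f 0)) + K * R powr (3/2)" by simp
  hence "norm (f z) \<le> exp (ln (norm (f 0)) + K * R powr (3/2))"
    using growth[of z] by (meson exp_le_cancel_iff order_trans)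
  thus ?thesis using f0 by (simp add: exp_add)
qed

text \<open>On the circle of radius 4R each removed factor has modulus at least 4R - r, while at 0
  it is at most r; by the maximum principle every zero gains the factor (4R - r) / r. With r = R the
  gain is 3 and the zeros get counted; with r = 2R the gain is 1 and a quotient without zeros in
  norm z < 2R gets bounded.\<close>

lemma quotient_bound:
  assumes R: "R \<ge> 1" and r: "0 < r" "r \<le> 2 * R"
    and g: "g holomorphic_on UNIV" "\<And>z. f z = g z * (\<Prod>p\<in>zeros_upto r. (z - p) ^ mult p)"
    and z: "norm z \<le> 4 * R"
  shows "norm (g z) * (\<Prod>p\<in>zeros_upto r. ((4 * R - r) / r) ^ mult p) \<le> norm (g 0) * exp (K * R powr (3/2))"
proof -
  define M where "M = exp (K * R powr (3/2))"
  define A where "A = (\<Prod>p\<in>zeros_upto r. (4 * R - r) ^ mult p)"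
  define D where "D = (\<Prod>p\<in>zeros_upto r. r ^ mult p)"
  have Apos: "A > 0" using R r by (auto simp: A_def intro!: prod_pos)
  have Dpos: "D > 0" using r by (auto simp: D_def intro!: prod_pos)
  have g0: "norm (f 0) \<le> norm (g 0) * D"
  proof -
    have "norm (f 0) = norm (g 0) * (\<Prod>p\<in>zeros_upto r. norm p ^ mult p)"
      unfolding g(2)[of 0] norm_mult norm_prod_power_diff by simp
    also have "\<dots> \<le> norm (g 0) * D" unfolding D_def
      by (intro mult_left_mono prod_mono) (auto simp: zeros_upto_def intro: power_mono)
    finally show ?thesis .
  qed
  have sphere: "norm (g w) \<le> norm (g 0) * D * M / A" if w: "norm w = 4 * R" for w
  proof -
    have "norm (g w) * A \<le> norm (g w) * (\<Prod>p\<in>zeros_upto r. norm (w - p) ^ mult p)" unfolding A_def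
    proof (intro mult_left_mono prod_mono conjI power_mono)
      fix p assume "p \<in> zeros_upto r"
      thus "4 * R - r \<le> norm (w - p)" using w norm_triangle_ineq2[of w p] by (auto simp: zeros_upto_def)
    qed (use R r in auto)
    also have "\<dots> = norm (f w)" unfolding g(2)[of w] norm_mult norm_prod_power_diff ..
    also have "\<dots> \<le> norm (f 0) * M" using growth_ratio[OF R, of w] w by (simp add: M_def)
    also have "\<dots> \<le> norm (g 0) * D * M" using g0 by (intro mult_right_mono) (auto simp: M_def)
    finally show ?thesis using Apos by (simp add: field_simps)
  qed
  have "norm (g z) \<le> norm (g 0) * D * M / A"
  proof (rule maximum_modulus_frontier[of g "cball 0 (4 * R)"])
    show "g holomorphic_on interior (cball 0 (4 * R))" "continuous_on (closure (cball 0 (4 * R))) g"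
      using g(1) holomorphic_on_subset holomorphic_on_imp_continuous_on by blast+
  qed (use z R sphere in \<open>auto simp: frontier_cball\<close>)
  hence "norm (g z) * (A / D) \<le> norm (g 0) * M" using Apos Dpos by (simp add: field_simps)
  also have "A / D = (\<Prod>p\<in>zeros_upto r. ((4 * R - r) / r) ^ mult p)"
    by (simp add: A_def D_def prod_dividef[symmetric] power_divide)
  finally show ?thesis by (simp add: M_def)
qed

definition N :: "real \<Rightarrow> nat" where "N R = (\<Sum>p\<in>zeros_upto R. mult p)"

lemma zero_count:
  assumes R: "R \<ge> 1"
  shows "real (N R) \<le> K * R powr (3/2)"
proof -
  obtain g where g: "g holomorphic_on UNIV"
    "\<And>z. f z = g z * (\<Prod>p\<in>zeros_upto R. (z - p) ^ mult p)"
    using entire_factor_finite[OF holo f0 finite_zeros_upto[of R]] unfolding mult_def by blast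
  have g0: "norm (g 0) > 0" using f0 g(2)[of 0] by auto
  have "norm (g 0) * (\<Prod>p\<in>zeros_upto R. ((4 * R - R) / R) ^ mult p) \<le> norm (g 0) * exp (K * R powr (3/2))"
    using quotient_bound[OF R _ _ g, of 0] R by auto
  also have "(\<Prod>p\<in>zeros_upto R. ((4 * R - R) / R) ^ mult p) = 3 ^ N R"
    using R by (simp add: N_def power_sum)
  finally have le: "3 ^ N R \<le> exp (K * R powr (3/2))" using g0 by simp
  \<comment> \<open>Since e <= 3, the gain 3 per zero may be weakened to e, which makes the
    logarithm exact.\<close>
  have "exp (real (N R)) = exp 1 ^ N R" by (simp add: exp_of_nat_mult[symmetric])
  also have "\<dots> \<le> 3 ^ N R" using exp_le by (intro power_mono) auto
  finally show ?thesis using le by (meson exp_le_cancel_iff order_trans)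
qed

text \<open>Once the zeros up to 2R are divided out, the quotient has a holomorphic logarithm on the
  disc of radius 2R with real part below K R^(3/2) + 1. Borel-Caratheodory bounds the logarithm
  itself, and Cauchy's estimate its second derivative. As \<open>q\<close> is the first derivative,
  the bound on \<open>deriv q\<close> determines f'/f only up to an additive constant.\<close>

lemma logderiv_local:
  assumes R: "R \<ge> 1"
  obtains q where "q holomorphic_on ball 0 (2 * R)"
    "\<And>z. norm z < 2 * R \<Longrightarrow> z \<notin> Z \<Longrightarrow>
       deriv f z / f z = q z + (\<Sum>p\<in>zeros_upto (2 * R). of_nat (mult p) / (z - p))"
    "\<And>z. norm z \<le> R / 2 \<Longrightarrow> norm (deriv q z) \<le> 16 * (K * R powr (3/2) + 1) / R\<^sup>2"
proof -
  define B where "B = K * R powr (3/2) + 1"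
  obtain g where g: "g holomorphic_on UNIV" "\<And>p. p \<in> zeros_upto (2 * R) \<Longrightarrow> g p \<noteq> 0"
    "\<And>z. f z = g z * (\<Prod>p\<in>zeros_upto (2 * R). (z - p) ^ mult p)"
    using entire_factor_finite[OF holo f0 finite_zeros_upto[of "2*R"]] unfolding mult_def by blast
  have g0: "g 0 \<noteq> 0" using f0 g(3)[of 0] by auto
  have gnz: "g z \<noteq> 0" if "norm z < 2 * R" for z
  proof
    assume "g z = 0"
    hence "z \<in> zeros_upto (2 * R)" using that g(3)[of z] by (auto simp: zeros_upto_def Z_def)
    with g(2) \<open>g z = 0\<close> show False by auto
  qed
  define h where "h = (\<lambda>z. g z / g 0)"
  have hb: "norm (h z) \<le> exp (K * R powr (3/2))" if "norm z < 2 * R" for z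
  proof -
    have "norm (g z) * (\<Prod>p\<in>zeros_upto (2*R). ((4 * R - 2*R) / (2*R)) ^ mult p)
       \<le> norm (g 0) * exp (K * R powr (3/2))"
      using quotient_bound[OF R _ _ g(1) g(3), of z] R that by auto
    also have "(\<Prod>p\<in>zeros_upto (2*R). ((4 * R - 2*R) / (2*R)) ^ mult p) = 1"
      using R by (intro prod.neutral) auto
    finally show ?thesis using g0 by (simp add: h_def norm_divide divide_le_eq mult.commute)
  qed
  have hh: "h holomorphic_on ball 0 (2 * R)" unfolding h_def
    by (intro holomorphic_intros holomorphic_on_subset[OF g(1)]) (use g0 in auto)
  obtain l0 where l0: "l0 holomorphic_on ball 0 (2 * R)" "\<And>x. x \<in> ball 0 (2 * R) \<Longrightarrow> exp (l0 x) = h x"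
    by (rule holomorphic_logarithm_exists[OF convex_ball open_ball hh, of 0])
      (use gnz g0 R in \<open>auto simp: h_def\<close>)
  define l where "l = (\<lambda>z. l0 z - l0 0)"
  have lh: "l holomorphic_on ball 0 (2 * R)" unfolding l_def by (intro holomorphic_intros l0)
  have el: "exp (l z) = h z" if "norm z < 2 * R" for z
    using l0(2)[of z] l0(2)[of 0] that R g0 by (simp add: l_def exp_diff h_def)
  have Rel: "Re (l z) < B" if "z \<in> ball 0 (2 * R)" for z
  proof -
    have "exp (Re (l z)) \<le> exp (K * R powr (3/2))"
      using hb[of z] el[of z, symmetric] that by simp
    thus ?thesis by (simp add: B_def)
  qed
  have lb: "norm (l z) \<le> 2 * B" if "norm z \<le> R" for z
  proof -
    have Bpos: "B > 0" using K_nonneg by (simp add: B_def add_nonneg_pos)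
    have "norm (l z) * R \<le> norm (l z) * (2 * R - norm z)" using that by (intro mult_left_mono) auto
    also have "\<dots> \<le> 2 * B * norm z"
      using Borel_Caratheodory_0[OF lh _ _ Rel, of z] that R by (auto simp: l_def)
    also have "\<dots> \<le> 2 * B * R" using that Bpos by (intro mult_left_mono) auto
    finally show ?thesis using R by simp
  qed
  have dl: "deriv l z = deriv g z / g z" if "norm z < 2 * R" for z
  proof -
    have "(l has_field_derivative deriv l z) (at z)"
      using holomorphic_derivI[OF lh open_ball] that by auto
    hence "((\<lambda>z. exp (l z)) has_field_derivative exp (l z) * deriv l z) (at z)"
      by (auto intro!: derivative_eq_intros)
    moreover have "eventually (\<lambda>w. exp (l w) = h w) (nhds z)"
      using eventually_nhds_in_open[of "ball 0 (2*R)" z] that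
      by (auto elim!: eventually_mono simp: el)
    ultimately have "(h has_field_derivative exp (l z) * deriv l z) (at z)"
      by (subst DERIV_cong_ev[OF refl _ refl, symmetric])
    moreover have "(h has_field_derivative deriv g z / g 0) (at z)"
      unfolding h_def using holomorphic_derivI[OF g(1) open_UNIV, of z] g0
      by (auto intro!: derivative_eq_intros)
    ultimately have "exp (l z) * deriv l z = deriv g z / g 0" by (rule DERIV_unique)
    thus ?thesis using el[OF that] gnz[OF that] g0 by (simp add: h_def field_simps)
  qed
  show ?thesis
  proof (rule that[of "deriv l"])
    show "deriv l holomorphic_on ball 0 (2 * R)" by (intro holomorphic_deriv lh) auto
    show "deriv f z / f z = deriv l z + (\<Sum>p\<in>zeros_upto (2 * R). of_nat (mult p) / (z - p))"
      if "norm z < 2 * R" "z \<notin> Z" for z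
      using logderiv_mult_prod[OF g(1) g(3) _ finite_zeros_upto] dl[OF that(1)] that(2) by (simp add: Z_def)
    show "norm (deriv (deriv l) z) \<le> 16 * (K * R powr (3/2) + 1) / R\<^sup>2" if z: "norm z \<le> R / 2" for z
    proof -
      have sub: "norm w \<le> R" if "norm (z - w) \<le> R / 2" for w
        using that z norm_triangle_ineq2[of w z] by (simp add: norm_minus_commute)
      \<comment> \<open>A disc of radius R/2 about z stays inside norm w <= R, where
        \<open>lb\<close> holds; 2 * 2B / (R/2)^2 is 16 B / R^2.\<close>
      have "norm ((deriv ^^ 2) l z) \<le> fact 2 * (2 * B) / (R / 2) ^ 2"
      proof (rule Cauchy_inequality)
        have "cball z (R / 2) \<subseteq> ball 0 (2 * R)"
        proof
          fix w assume "w \<in> cball z (R / 2)"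
          thus "w \<in> ball 0 (2 * R)" using sub[of w] R by (simp add: dist_norm)
        qed
        hence *: "l holomorphic_on cball z (R / 2)" by (rule holomorphic_on_subset[OF lh])
        thus "continuous_on (cball z (R / 2)) l" by (rule holomorphic_on_imp_continuous_on)
        show "l holomorphic_on ball z (R / 2)" by (rule holomorphic_on_subset[OF * ball_subset_cball])
      qed (use R sub lb in auto)
      thus ?thesis by (simp add: numeral_2_eq_2 B_def power_divide)
    qed
  qed
qed

text \<open>Dyadic blocks: the zeros with 2^J < norm p <= 2^(J+1) contribute at most N (2^(J+1)) /
  4^J, which the zero count bounds by a constant times the J-th power of 2 powr (-1/2).\<close>

lemma summable_mult: "(\<lambda>p. real (mult p) / (norm p)\<^sup>2) summable_on Z"
proof (rule nonneg_bdd_above_summable_on)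
  define F where "F = (\<lambda>p. real (mult p) / (norm p)\<^sup>2)"
  define A where "A = sum F (zeros_upto 1)"
  define c where "c = K * 2 powr (3/2)"
  define x where "x = (2::real) powr (-1/2)"
  have x: "0 < x" "x < 1" by (simp_all add: x_def powr_less_one)
  have Fnn: "F p \<ge> 0" for p by (simp add: F_def)
  have step: "sum F (zeros_upto (2 ^ J)) \<le> A + (\<Sum>j<J. c * x ^ j)" for J
  proof (induction J)
    case 0 show ?case by (simp add: A_def)
  next
    case (Suc J)
    have "(2::real) ^ J \<le> 2 ^ Suc J" by simp
    hence sub: "zeros_upto (2 ^ J) \<subseteq> zeros_upto (2 ^ Suc J)"
      unfolding zeros_upto_def by (blast intro: order_trans)
    have "sum F (zeros_upto (2 ^ Suc J)) = sum F (zeros_upto (2 ^ J)) + sum F (zeros_upto (2 ^ Suc J) - zeros_upto (2 ^ J))"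
      by (subst sum.subset_diff[OF sub finite_zeros_upto]) simp
    also have "sum F (zeros_upto (2 ^ Suc J) - zeros_upto (2 ^ J)) \<le> (\<Sum>p\<in>zeros_upto (2 ^ Suc J) - zeros_upto (2 ^ J). real (mult p) / 4 ^ J)"
    proof (rule sum_mono)
      fix p assume "p \<in> zeros_upto (2 ^ Suc J) - zeros_upto (2 ^ J)"
      hence "norm p \<ge> 2 ^ J" by (auto simp: zeros_upto_def)
      hence "(norm p)\<^sup>2 \<ge> (2 ^ J)\<^sup>2" by (intro power_mono) auto
      also have "((2::real) ^ J)\<^sup>2 = 4 ^ J"
          by (subst power_mult[symmetric], subst mult.commute, simp add: power_mult)
      finally have "(norm p)\<^sup>2 \<ge> 4 ^ J" .
      moreover have J: "(4::real) ^ J > 0" by simp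
      ultimately have "(norm p)\<^sup>2 > 0" by linarith
      with J \<open>(norm p)\<^sup>2 \<ge> 4 ^ J\<close> show "F p \<le> real (mult p) / 4 ^ J" unfolding F_def by (intro divide_left_mono mult_pos_pos) auto
    qed
    also have "\<dots> \<le> (\<Sum>p\<in>zeros_upto (2 ^ Suc J). real (mult p) / 4 ^ J)"
      by (intro sum_mono2) auto
    also have "\<dots> = real (N (2 ^ Suc J)) / 4 ^ J" by (simp add: N_def sum_divide_distrib)
    also have "\<dots> \<le> K * (2 ^ Suc J) powr (3/2) / 4 ^ J"
      by (intro divide_right_mono zero_count) (auto simp: one_le_power simp del: power_Suc)
    also have "\<dots> = c * x ^ J"
    proof -
      have "((2::real) ^ Suc J) powr (3/2) = 2 powr (3/2) * (2 powr (3/2)) ^ J"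
        by (simp add: powr_mult powr_realpow[symmetric] powr_powr mult.commute)
      moreover have "(2::real) powr (3/2) / 4 = x"
      proof -
        have "(2::real) powr (3/2) = 2 powr (-1/2 + 2)" by simp
        also have "\<dots> = x * 4" unfolding powr_add x_def by simp
        finally show ?thesis by simp
      qed
      hence "(2 powr (3/2)) ^ J / (4::real) ^ J = x ^ J" by (metis power_divide)
      ultimately show ?thesis by (simp add: c_def field_simps)
    qed
    finally show ?case using Suc by simp
  qed
  have "sum F S \<le> A + c / (1 - x)" if S: "S \<subseteq> Z" "finite S" for S
  proof -
    obtain J where J: "Max (insert 0 (norm ` S)) < 2 ^ J" using real_arch_pow[of 2] by auto
    have "S \<subseteq> zeros_upto (2 ^ J)"
    proof
      fix p assume p: "p \<in> S"
      have "norm p \<le> Max (insert 0 (norm ` S))" using S(2) p by (intro Max_ge) auto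
      thus "p \<in> zeros_upto (2 ^ J)" using J p S by (auto simp: zeros_upto_def)
    qed
    hence "sum F S \<le> sum F (zeros_upto (2 ^ J))" by (intro sum_mono2 Fnn finite_zeros_upto) auto
    also note step[of J]
    also have "(\<Sum>j<J. c * x ^ j) \<le> c / (1 - x)"
    proof -
      have "(\<Sum>j<J. x ^ j) \<le> (\<Sum>j. x ^ j)"
        using x by (intro sum_le_suminf summable_geometric) auto
      also have "\<dots> = 1 / (1 - x)" using x by (intro suminf_geometric) auto
      finally have "c * (\<Sum>j<J. x ^ j) \<le> c * (1 / (1 - x))"
        using K_nonneg by (intro mult_left_mono) (auto simp: c_def)
      thus ?thesis by (simp add: sum_distrib_left)
    qed
    finally show ?thesis by simp
  qed
  thus "bdd_above (sum (\<lambda>p. real (mult p) / (norm p)\<^sup>2) ` {F. F \<subseteq> Z \<and> finite F})"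
    unfolding F_def by (intro bdd_aboveI2) auto
qed auto

end

section \<open>Absolutely convergent sums over zeros and the partial fractions of f'/f\<close>

lemma norm_has_sum_le:
  fixes h :: "'a \<Rightarrow> complex"
  assumes "(h has_sum a) A" "g summable_on A" "\<And>p. p \<in> A \<Longrightarrow> norm (h p) \<le> g p"
  shows "norm a \<le> infsum g A"
proof -
  have n: "(\<lambda>p. norm (h p)) summable_on A"
    by (rule summable_on_comparison_test[OF assms(2,3)]) auto
  have "norm (infsum h A) \<le> (\<Sum>\<^sub>\<infinity>p\<in>A. norm (h p))" by (rule norm_infsum_bound[OF n])
  also have "\<dots> \<le> infsum g A" by (rule infsum_mono[OF n assms(2,3)])
  finally show ?thesis using infsumI[OF assms(1)] by simp
qed


text \<open>This makes 1 / |s - p| comparable with 1 / |p| at the cost of a factor that depends on s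
  and \<delta> alone, so that later sums over zeros are dominated by the one series of
  \<open>summable_mult\<close>.\<close>

lemma norm_le_dist_mult:
  fixes s p :: complex
  assumes "\<delta> > 0" "\<delta> \<le> norm (s - p)"
  shows "norm p \<le> norm (s - p) * (1 + norm s / \<delta>)"
proof -
  have "norm p \<le> norm (s - p) + norm s" using norm_triangle_ineq2[of p s] by (simp add: norm_minus_commute)
  also have "norm s \<le> norm (s - p) * (norm s / \<delta>)"
    using mult_right_mono[OF assms(2), of "norm s / \<delta>"] assms(1) by simp
  finally show ?thesis by (simp add: algebra_simps)
qed

lemma inverse_square_bound:
  fixes s p :: complex
  assumes "\<delta> > 0" "\<delta> \<le> norm (s - p)" "p \<noteq> 0" "c \<ge> 0"
  shows "c / (norm (s - p))\<^sup>2 \<le> (1 + norm s / \<delta>)\<^sup>2 * (c / (norm p)\<^sup>2)"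
proof -
  have "(norm p)\<^sup>2 \<le> (norm (s - p) * (1 + norm s / \<delta>))\<^sup>2"
    using norm_le_dist_mult[OF assms(1,2)] by (intro power_mono) auto
  hence "(norm p)\<^sup>2 * c \<le> (norm (s - p))\<^sup>2 * (1 + norm s / \<delta>)\<^sup>2 * c"
    using assms(4) by (intro mult_right_mono) (simp_all add: power_mult_distrib)
  moreover have "norm (s - p) > 0" "norm p > 0" using assms by auto
  ultimately show ?thesis by (simp add: field_simps)
qed

text \<open>The distance \<delta> is uniform over the closed disc, so a single majorant serves the
  Weierstrass test; holomorphy is concluded on the open disc.\<close>

lemma holomorphic_infsum_inverse_square:
  fixes c :: "complex \<Rightarrow> complex"
  assumes sum: "(\<lambda>p. norm (c p) / (norm p)\<^sup>2) summable_on P" and "0 \<notin> P" and \<delta>: "\<delta> > 0"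
    and d: "\<And>p s. p \<in> P \<Longrightarrow> s \<in> cball s0 r \<Longrightarrow> \<delta> \<le> norm (s - p)"
  shows "(\<lambda>s. \<Sum>\<^sub>\<infinity>p\<in>P. c p / (s - p)\<^sup>2) holomorphic_on ball s0 r"
proof -
  define M where "M = (\<lambda>p. (1 + (norm s0 + r) / \<delta>)\<^sup>2 * (norm (c p) / (norm p)\<^sup>2))"
  have ul: "uniform_limit (cball s0 r) (\<lambda>X s. \<Sum>p\<in>X. c p / (s - p)\<^sup>2)
      (\<lambda>s. \<Sum>\<^sub>\<infinity>p\<in>P. c p / (s - p)\<^sup>2) (finite_subsets_at_top P)"
  proof (rule Weierstrass_m_test_general[where M = M])
    show "M summable_on P" unfolding M_def by (intro summable_on_cmult_right sum)
    fix p s assume ps: "p \<in> P" "s \<in> cball s0 r"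
    have "norm s \<le> norm s0 + r" using ps(2) norm_triangle_ineq2[of s s0] by (simp add: dist_norm norm_minus_commute)
    hence *: "1 + norm s / \<delta> \<le> 1 + (norm s0 + r) / \<delta>" using \<delta> by (simp add: divide_right_mono)
    have "norm (c p / (s - p)\<^sup>2) = norm (c p) / (norm (s - p))\<^sup>2" by (simp add: norm_divide norm_power)
    also have "\<dots> \<le> (1 + norm s / \<delta>)\<^sup>2 * (norm (c p) / (norm p)\<^sup>2)"
      using ps assms(2) by (intro inverse_square_bound \<delta> d) auto
    also have "\<dots> \<le> M p" unfolding M_def using * \<delta>
      by (intro mult_right_mono power_mono) auto
    finally show "norm (c p / (s - p)\<^sup>2) \<le> M p" .
  qed
  show ?thesis
  proof (rule holomorphic_uniform_limit[OF _ ul])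
    have "continuous_on (cball s0 r) (\<lambda>s. \<Sum>p\<in>X. c p / (s - p)\<^sup>2) \<and>
          (\<lambda>s. \<Sum>p\<in>X. c p / (s - p)\<^sup>2) holomorphic_on ball s0 r" if "X \<subseteq> P" for X
    proof -
      have "(\<lambda>s. \<Sum>p\<in>X. c p / (s - p)\<^sup>2) holomorphic_on cball s0 r"
        using that d \<delta> by (intro holomorphic_intros) fastforce
      thus ?thesis using holomorphic_on_imp_continuous_on holomorphic_on_subset ball_subset_cball by blast
    qed
    thus "\<forall>\<^sub>F X in finite_subsets_at_top P. continuous_on (cball s0 r) (\<lambda>s. \<Sum>p\<in>X. c p / (s - p)\<^sup>2) \<and>
          (\<lambda>s. \<Sum>p\<in>X. c p / (s - p)\<^sup>2) holomorphic_on ball s0 r"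
      by (intro eventually_finite_subsets_at_top_weakI) blast
  qed auto
qed

context entire_three_halves
begin

lemma closed_Z: "closed Z"
proof -
  have "continuous_on UNIV f" using holo by (rule holomorphic_on_imp_continuous_on)
  hence "closed (f -` {0})" by (intro continuous_closed_vimage) (auto simp: continuous_on_eq_continuous_at)
  also have "f -` {0} = Z" by (auto simp: Z_def)
  finally show ?thesis .
qed

lemma dist_Z:
  assumes "s \<notin> Z"
  obtains \<delta> where "\<delta> > 0" "\<delta> \<le> 1" "\<And>p. p \<in> Z \<Longrightarrow> \<delta> \<le> norm (s - p)"
proof -
  have "open (- Z)" using closed_Z by auto
  then obtain e where e: "e > 0" "ball s e \<subseteq> - Z" using assms by (auto simp: open_contains_ball)
  show ?thesis
    by (rule that[of "min e 1"]) (use e in \<open>auto simp: subset_iff dist_norm not_less\<close>, force)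
qed

text \<open>Here \<open>s\<close> may itself be a zero. Zeros of modulus above norm s + 1 are at
  distance at least 1, which leaves finitely many others to avoid.\<close>

lemma isolated_Z:
  obtains r where "r > 0" "\<And>p. p \<in> Z - {s} \<Longrightarrow> r \<le> norm (s - p)"
proof -
  have "finite (zeros_upto (norm s + 1) - {s})" by simp
  from finite_set_avoid[OF this, of s] obtain d where
    d: "d > 0" "\<And>p. p \<in> zeros_upto (norm s + 1) - {s} \<Longrightarrow> p \<noteq> s \<Longrightarrow> d \<le> dist s p" by blast
  show ?thesis
  proof (rule that[of "min d 1"])
    fix p assume p: "p \<in> Z - {s}"
    show "min d 1 \<le> norm (s - p)"
    proof (cases "norm p \<le> norm s + 1")
      case True thus ?thesis using d(2)[of p] p by (auto simp: zeros_upto_def dist_norm)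
    next
      case False thus ?thesis using norm_triangle_ineq2[of p s] by (simp add: norm_minus_commute)
    qed
  qed (use d in auto)
qed

definition S2 :: real where "S2 = (\<Sum>\<^sub>\<infinity>p\<in>Z. real (mult p) / (norm p)\<^sup>2)"

lemma S2_nonneg: "S2 \<ge> 0" unfolding S2_def by (intro infsum_nonneg) auto

lemma summable_inverse_square:
  assumes "\<delta> > 0" "\<And>p. p \<in> Z \<Longrightarrow> \<delta> \<le> norm (s - p)"
  shows "(\<lambda>p. real (mult p) / (norm (s - p))\<^sup>2) summable_on Z"
    "(\<Sum>\<^sub>\<infinity>p\<in>Z. real (mult p) / (norm (s - p))\<^sup>2) \<le> S2 * (1 + norm s / \<delta>)\<^sup>2"
proof -
  have le: "real (mult p) / (norm (s - p))\<^sup>2 \<le> (1 + norm s / \<delta>)\<^sup>2 * (real (mult p) / (norm p)\<^sup>2)"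
    if "p \<in> Z" for p
    using that nz assms by (intro inverse_square_bound) auto
  have sm: "(\<lambda>p. (1 + norm s / \<delta>)\<^sup>2 * (real (mult p) / (norm p)\<^sup>2)) summable_on Z"
    by (intro summable_on_cmult_right summable_mult)
  show 1: "(\<lambda>p. real (mult p) / (norm (s - p))\<^sup>2) summable_on Z"
    by (rule summable_on_comparison_test[OF sm le]) auto
  have "(\<Sum>\<^sub>\<infinity>p\<in>Z. real (mult p) / (norm (s - p))\<^sup>2) \<le>
     (\<Sum>\<^sub>\<infinity>p\<in>Z. (1 + norm s / \<delta>)\<^sup>2 * (real (mult p) / (norm p)\<^sup>2))"
    by (rule infsum_mono[OF 1 sm le])
  also have "\<dots> = S2 * (1 + norm s / \<delta>)\<^sup>2" unfolding S2_def infsum_cmult_right' by (simp add: mult.commute)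
  finally show "(\<Sum>\<^sub>\<infinity>p\<in>Z. real (mult p) / (norm (s - p))\<^sup>2) \<le> S2 * (1 + norm s / \<delta>)\<^sup>2" .
qed

lemma filterlim_zeros_upto: "filterlim (\<lambda>R. zeros_upto (2 * R)) (finite_subsets_at_top Z) at_top"
  unfolding filterlim_finite_subsets_at_top
proof safe
  fix X assume X: "finite X" "X \<subseteq> Z"
  show "\<forall>\<^sub>F R in at_top. finite (zeros_upto (2 * R)) \<and> X \<subseteq> zeros_upto (2 * R) \<and> zeros_upto (2 * R) \<subseteq> Z"
    using eventually_ge_at_top[of "Max (insert 0 (norm ` X))"]
  proof eventually_elim
    case (elim R)
    have "norm p \<le> 2 * R" if "p \<in> X" for p
    proof -
      have "norm p \<le> Max (insert 0 (norm ` X))" "0 \<le> Max (insert 0 (norm ` X))"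
        using X that by (auto intro!: Max_ge)
      thus ?thesis using elim by linarith
    qed
    hence "X \<subseteq> zeros_upto (2 * R)" using X by (auto simp: zeros_upto_def)
    thus ?case using finite_zeros_upto zeros_upto_subset by blast
  qed
qed

text \<open>Unconditional summability allows the value to be computed along the exhaustion by discs
  of radius 2R, and the assumed error decays like R^(-1/2).\<close>

lemma has_sum_zeros_upto_limit:
  fixes h :: "complex \<Rightarrow> complex"
  assumes sum: "h summable_on Z"
    and bd: "\<And>R. R \<ge> T \<Longrightarrow> norm (L - (\<Sum>p\<in>zeros_upto (2 * R). h p)) \<le> c * (16 * (K * R powr (3/2) + 1) / R\<^sup>2)"
  shows "(h has_sum L) Z"
proof -
  from sum obtain S where S: "(h has_sum S) Z" by (auto simp: summable_on_def)
  hence "((\<lambda>R. \<Sum>p\<in>zeros_upto (2 * R). h p) \<longlongrightarrow> S) at_top"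
    unfolding has_sum_def by (rule filterlim_compose) (rule filterlim_zeros_upto)
  hence 1: "((\<lambda>R. L - (\<Sum>p\<in>zeros_upto (2 * R). h p)) \<longlongrightarrow> L - S) at_top" by (intro tendsto_intros)
  have "((\<lambda>R::real. R powr (3/2) / R\<^sup>2) \<longlongrightarrow> 0) at_top" "((\<lambda>R::real. 1 / R\<^sup>2) \<longlongrightarrow> 0) at_top"
    by real_asymp+
  from tendsto_add[OF tendsto_mult_left[OF this(1), of "c * 16 * K"] tendsto_mult_left[OF this(2), of "c * 16"]]
  have "((\<lambda>R. c * (16 * (K * R powr (3/2) + 1) / R\<^sup>2)) \<longlongrightarrow> 0) at_top"
    by (simp add: add_divide_distrib ring_distribs mult_ac)
  hence "((\<lambda>R. L - (\<Sum>p\<in>zeros_upto (2 * R). h p)) \<longlongrightarrow> 0) at_top"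
    by (rule Lim_null_comparison[rotated]) (rule eventually_mono[OF eventually_ge_at_top[of T]], rule bd)
  with 1 have "L - S = 0" using tendsto_unique trivial_limit_at_top_linorder by blast
  with S show ?thesis by simp
qed

lemma abs_summable_imp_Z: "(\<lambda>p. norm (h p)) summable_on Z \<Longrightarrow> (h :: complex \<Rightarrow> complex) summable_on Z"
  by (rule abs_summable_summable)

text \<open>Differentiation removes the unknown constant of the expansion: the remainder
  \<open>q\<close> of \<open>logderiv_local\<close>, which changes with R, enters only through its
  derivative, and at a fixed point this tends to 0 as R grows.\<close>

theorem has_sum_deriv_logderiv:
  assumes z: "z \<notin> Z"
  shows "((\<lambda>p. - of_nat (mult p) / (z - p)\<^sup>2) has_sum deriv (\<lambda>z. deriv f z / f z) z) Z"
proof (rule has_sum_zeros_upto_limit[where c = 1 and T = "2 * norm z + 1"])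
  obtain \<delta> where d: "\<delta> > 0" "\<And>p. p \<in> Z \<Longrightarrow> \<delta> \<le> norm (z - p)" using dist_Z[OF z] by metis
  have "(\<lambda>p. norm (- of_nat (mult p) / (z - p)\<^sup>2)) summable_on Z"
    using summable_inverse_square(1)[OF d] by (simp add: norm_divide norm_power)
  thus "(\<lambda>p. - of_nat (mult p) / (z - p)\<^sup>2) summable_on Z" by (rule abs_summable_imp_Z)
  fix R assume R: "R \<ge> 2 * norm z + 1"
  hence R1: "R \<ge> 1" using norm_ge_zero[of z] by linarith
  from logderiv_local[OF R1] obtain q where q: "q holomorphic_on ball 0 (2 * R)"
    "\<And>z. norm z < 2 * R \<Longrightarrow> z \<notin> Z \<Longrightarrow>
       deriv f z / f z = q z + (\<Sum>p\<in>zeros_upto (2 * R). of_nat (mult p) / (z - p))"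
    "\<And>z. norm z \<le> R / 2 \<Longrightarrow> norm (deriv q z) \<le> 16 * (K * R powr (3/2) + 1) / R\<^sup>2" by blast
  have zb: "z \<in> ball 0 (2 * R)" using R R1 by (simp add: dist_norm)
  have "((\<lambda>z. q z + (\<Sum>p\<in>zeros_upto (2 * R). of_nat (mult p) / (z - p))) has_field_derivative
     deriv q z + (\<Sum>p\<in>zeros_upto (2 * R). - of_nat (mult p) / (z - p)\<^sup>2)) (at z)"
  proof (intro derivative_intros)
    show "(q has_field_derivative deriv q z) (at z)" using holomorphic_derivI[OF q(1) _ zb] by auto
    fix p assume "p \<in> zeros_upto (2 * R)"
    hence "z \<noteq> p" using z by (auto simp: zeros_upto_def)
    thus "((\<lambda>z. of_nat (mult p) / (z - p)) has_field_derivative - of_nat (mult p) / (z - p)\<^sup>2) (at z)"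
      by (auto intro!: derivative_eq_intros simp: power2_eq_square divide_simps)
  qed
  moreover have "eventually (\<lambda>w. deriv f w / f w = q w + (\<Sum>p\<in>zeros_upto (2 * R). of_nat (mult p) / (w - p))) (nhds z)"
  proof -
    have "open (ball 0 (2 * R) - Z)" using closed_Z by (intro open_Diff) auto
    hence "eventually (\<lambda>w. w \<in> ball 0 (2 * R) - Z) (nhds z)" using zb z by (intro eventually_nhds_in_open) auto
    thus ?thesis by eventually_elim (rule q(2), auto)
  qed
  ultimately have "((\<lambda>w. deriv f w / f w) has_field_derivative
     deriv q z + (\<Sum>p\<in>zeros_upto (2 * R). - of_nat (mult p) / (z - p)\<^sup>2)) (at z)"
    by (subst DERIV_cong_ev[OF refl _ refl])
  hence "deriv (\<lambda>w. deriv f w / f w) z = deriv q z + (\<Sum>p\<in>zeros_upto (2 * R). - of_nat (mult p) / (z - p)\<^sup>2)"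
    by (rule DERIV_imp_deriv)
  thus "norm (deriv (\<lambda>z. deriv f z / f z) z - (\<Sum>p\<in>zeros_upto (2 * R). - of_nat (mult p) / (z - p)\<^sup>2))
     \<le> 1 * (16 * (K * R powr (3 / 2) + 1) / R\<^sup>2)"
    using q(3)[of z] R by simp
qed

text \<open>The unknown constant cancels between two points, and \<open>q z - q w\<close> is at most
  norm (z - w) times the bound on the derivative of \<open>q\<close>. The terms equal mult p * (w -
  z) / ((z - p) * (w - p)), hence are absolutely summable.\<close>

theorem has_sum_logderiv_diff:
  assumes z: "z \<notin> Z" and w: "w \<notin> Z"
  shows "((\<lambda>p. of_nat (mult p) / (z - p) - of_nat (mult p) / (w - p)) has_sum
    (deriv f z / f z - deriv f w / f w)) Z"
proof (rule has_sum_zeros_upto_limit[where c = "norm (z - w)" and T = "2 * norm z + 2 * norm w + 1"])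
  obtain \<delta> where d: "\<delta> > 0" "\<And>p. p \<in> Z \<Longrightarrow> \<delta> \<le> norm (z - p)" using dist_Z[OF z] by metis
  obtain \<epsilon> where e: "\<epsilon> > 0" "\<And>p. p \<in> Z \<Longrightarrow> \<epsilon> \<le> norm (w - p)" using dist_Z[OF w] by metis
  have "(\<lambda>p. norm (of_nat (mult p) / (z - p) - of_nat (mult p) / (w - p))) summable_on Z"
  proof (rule summable_on_comparison_test)
    show "(\<lambda>p. norm (w - z) * (real (mult p) / (norm (z - p))\<^sup>2 + real (mult p) / (norm (w - p))\<^sup>2)) summable_on Z"
      by (intro summable_on_cmult_right summable_on_add summable_inverse_square(1)[OF d]
            summable_inverse_square(1)[OF e])
    fix p assume p: "p \<in> Z"
    define a b where "a = norm (z - p)" and "b = norm (w - p)"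
    have ab: "a > 0" "b > 0" using d(1) d(2)[of p] e(1) e(2)[of p] p by (auto simp: a_def b_def)
    \<comment> \<open>The mixed product is separated into two inverse squares, each with a known
      summable series.\<close>
    have le: "1 / a * (1 / b) \<le> 1 / a\<^sup>2 + 1 / b\<^sup>2"
    proof -
      have "0 \<le> 1 / a * (1 / b)" using ab by simp
      moreover have "0 \<le> (1 / a - 1 / b)\<^sup>2" by simp
      hence "2 * (1 / a * (1 / b)) \<le> 1 / a\<^sup>2 + 1 / b\<^sup>2"
        unfolding power2_diff by (simp add: power_divide)
      ultimately show ?thesis by linarith
    qed
    have "of_nat (mult p) / (z - p) - of_nat (mult p) / (w - p) = of_nat (mult p) * (w - z) / ((z - p) * (w - p))"
      using p z w by (auto simp: divide_simps) (simp_all add: algebra_simps)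
    also have "norm \<dots> = norm (w - z) * real (mult p) * (1 / a * (1 / b))"
      by (simp add: norm_mult norm_divide a_def b_def mult_ac)
    also have "\<dots> \<le> norm (w - z) * real (mult p) * (1 / a\<^sup>2 + 1 / b\<^sup>2)"
      by (intro mult_left_mono le) auto
    finally show "norm (of_nat (mult p) / (z - p) - of_nat (mult p) / (w - p)) \<le>
      norm (w - z) * (real (mult p) / (norm (z - p))\<^sup>2 + real (mult p) / (norm (w - p))\<^sup>2)"
      by (simp add: a_def b_def distrib_left mult.assoc)
  qed auto
  thus "(\<lambda>p. of_nat (mult p) / (z - p) - of_nat (mult p) / (w - p)) summable_on Z" by (rule abs_summable_imp_Z)
  fix R assume R: "R \<ge> 2 * norm z + 2 * norm w + 1"
  hence R1: "R \<ge> 1" "norm z \<le> R / 2" "norm w \<le> R / 2" using norm_ge_zero[of z] norm_ge_zero[of w] by linarith+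
  from logderiv_local[OF R1(1)] obtain q where q: "q holomorphic_on ball 0 (2 * R)"
    "\<And>z. norm z < 2 * R \<Longrightarrow> z \<notin> Z \<Longrightarrow>
       deriv f z / f z = q z + (\<Sum>p\<in>zeros_upto (2 * R). of_nat (mult p) / (z - p))"
    "\<And>z. norm z \<le> R / 2 \<Longrightarrow> norm (deriv q z) \<le> 16 * (K * R powr (3/2) + 1) / R\<^sup>2" by blast
  have "norm (q z - q w) \<le> 16 * (K * R powr (3/2) + 1) / R\<^sup>2 * norm (z - w)"
  proof (rule field_differentiable_bound[of "cball 0 (R / 2)" q "deriv q"])
    fix x :: complex assume x: "x \<in> cball 0 (R / 2)"
    hence "x \<in> ball 0 (2 * R)" using R1 by (simp add: dist_norm)
    thus "(q has_field_derivative deriv q x) (at x within cball 0 (R / 2))"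
      using holomorphic_derivI[OF q(1)] by auto
    show "norm (deriv q x) \<le> 16 * (K * R powr (3/2) + 1) / R\<^sup>2" using x by (intro q(3)) auto
  qed (use R1 in auto)
  moreover have "deriv f z / f z - deriv f w / f w - (\<Sum>p\<in>zeros_upto (2 * R). of_nat (mult p) / (z - p) - of_nat (mult p) / (w - p))
     = q z - q w"
    using q(2)[of z] q(2)[of w] R1 z w by (simp add: sum_subtractf)
  ultimately show "norm (deriv f z / f z - deriv f w / f w - (\<Sum>p\<in>zeros_upto (2 * R). of_nat (mult p) / (z - p) - of_nat (mult p) / (w - p)))
     \<le> norm (z - w) * (16 * (K * R powr (3 / 2) + 1) / R\<^sup>2)"
    by (simp add: mult.commute)
qed

text \<open>Polynomial growth in norm s / \<delta> is what the Liouville argument needs on circles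
  that keep a distance \<delta> from all zeros. The restriction \<delta> <= 1 yields norm s <= 1 +
  norm s / \<delta>.\<close>

lemma logderiv_bound:
  assumes d: "\<delta> > 0" "\<delta> \<le> 1" "\<And>p. p \<in> Z \<Longrightarrow> \<delta> \<le> norm (s - p)"
  shows "norm (deriv f s / f s) \<le> norm (deriv f 0 / f 0) + S2 * (1 + norm s / \<delta>)\<^sup>2"
    "norm (deriv (\<lambda>s. deriv f s / f s) s) \<le> S2 * (1 + norm s / \<delta>)\<^sup>2"
proof -
  have s: "s \<notin> Z" using d by force
  define A where "A = 1 + norm s / \<delta>"
  have A: "A \<ge> 1" using d by (simp add: A_def)

  have "norm (deriv f s / f s - deriv f 0 / f 0) \<le> (\<Sum>\<^sub>\<infinity>p\<in>Z. A\<^sup>2 * (real (mult p) / (norm p)\<^sup>2))"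
  proof (rule norm_has_sum_le)
    show "((\<lambda>p. of_nat (mult p) / (s - p) - of_nat (mult p) / (0 - p)) has_sum
       (deriv f s / f s - deriv f 0 / f 0)) Z" by (rule has_sum_logderiv_diff[OF s nz])
    show "(\<lambda>p. A\<^sup>2 * (real (mult p) / (norm p)\<^sup>2)) summable_on Z"
      by (intro summable_on_cmult_right summable_mult)
    fix p assume p: "p \<in> Z"
    have pos: "norm (s - p) > 0" "norm p > 0" using p s nz by auto
    have le: "norm p \<le> norm (s - p) * A" using norm_le_dist_mult[OF d(1) d(3)[OF p]] by (simp add: A_def)
    have sA: "norm s \<le> A"
      using d mult_left_mono[of 1 "1/\<delta>" "norm s"] by (simp add: A_def)
    have "of_nat (mult p) / (s - p) - of_nat (mult p) / (0 - p) = of_nat (mult p) * s / ((s - p) * p)"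
      using pos by (simp add: divide_simps) (simp add: algebra_simps)
    also have "norm \<dots> = real (mult p) * norm s / (norm (s - p) * norm p)"
      by (simp add: norm_mult norm_divide)
    also have "\<dots> \<le> A\<^sup>2 * (real (mult p) / (norm p)\<^sup>2)"
    proof -
      have "norm s * norm p \<le> A * (norm (s - p) * A)" by (intro mult_mono sA le) (use A in auto)
      hence "real (mult p) * (norm s * norm p) \<le> real (mult p) * (A * (norm (s - p) * A))"
        by (intro mult_left_mono) auto
      thus ?thesis using pos by (simp add: divide_simps power2_eq_square mult_ac)
    qed
    finally show "norm (of_nat (mult p) / (s - p) - of_nat (mult p) / (0 - p)) \<le> A\<^sup>2 * (real (mult p) / (norm p)\<^sup>2)" .
  qed
  also have "\<dots> = S2 * A\<^sup>2" unfolding S2_def infsum_cmult_right' by (simp add: mult.commute)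
  finally show "norm (deriv f s / f s) \<le> norm (deriv f 0 / f 0) + S2 * (1 + norm s / \<delta>)\<^sup>2"
    using norm_triangle_ineq2[of "deriv f s / f s" "deriv f 0 / f 0"] by (simp add: A_def)
  have "norm (deriv (\<lambda>s. deriv f s / f s) s) \<le> (\<Sum>\<^sub>\<infinity>p\<in>Z. real (mult p) / (norm (s - p))\<^sup>2)"
    by (rule norm_has_sum_le[OF has_sum_deriv_logderiv[OF s] summable_inverse_square(1)[OF d(1) d(3)]])
      (auto simp: norm_divide norm_power)
  also have "\<dots> \<le> S2 * (1 + norm s / \<delta>)\<^sup>2" by (rule summable_inverse_square(2)[OF d(1) d(3)])
  finally show "norm (deriv (\<lambda>s. deriv f s / f s) s) \<le> S2 * (1 + norm s / \<delta>)\<^sup>2" .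
qed

end

section \<open>Entire functions that arise in the explicit formula\<close>

text \<open>The sum is the derivative of the difference quotient (exp (L s) - exp (L p)) / (s - p),
  whose singularity at p is removable.\<close>

lemma remove_exp_pole:
  fixes L p :: complex
  obtains h where "h holomorphic_on UNIV"
    "\<And>s. s \<noteq> p \<Longrightarrow> deriv (\<lambda>s. exp (L * s) / (s - p)) s + exp (L * p) / (s - p)\<^sup>2 = h s"
proof -
  define F where "F = (\<lambda>s. exp (L * s))"
  define Q where "Q = (\<lambda>s. if s = p then deriv F p else (F s - F p) / (s - p))"
  have Q: "Q holomorphic_on UNIV" unfolding Q_def
    by (rule pole_lemma) (auto simp: F_def intro!: holomorphic_intros)
  show ?thesis
  proof (rule that[of "deriv Q"])
    show "deriv Q holomorphic_on UNIV" using Q by (intro holomorphic_deriv) auto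
    fix s assume s: "s \<noteq> p"
    have "eventually (\<lambda>w. w \<in> - {p}) (nhds s)" using s by (intro eventually_nhds_in_open) auto
    hence ev: "eventually (\<lambda>w. Q w = F w / (w - p) - F p / (w - p)) (nhds s)"
      by eventually_elim (auto simp: Q_def diff_divide_distrib)
    have 1: "((\<lambda>w. F w / (w - p)) has_field_derivative deriv (\<lambda>w. F w / (w - p)) s) (at s)"
      by (rule DERIV_deriv_iff_field_differentiable[THEN iffD2], unfold F_def, intro field_differentiable_divide derivative_intros)
        (use s in \<open>auto intro!: field_differentiable_diff field_differentiable_within_exp holomorphic_on_imp_differentiable_at[of _ UNIV] holomorphic_intros\<close>)
    have 2: "((\<lambda>w. F p / (w - p)) has_field_derivative - F p / (s - p)\<^sup>2) (at s)"
      using s by (auto intro!: derivative_eq_intros simp: power2_eq_square)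
    have "(Q has_field_derivative deriv (\<lambda>w. F w / (w - p)) s - (- F p / (s - p)\<^sup>2)) (at s)"
      using DERIV_diff[OF 1 2] by (subst DERIV_cong_ev[OF refl ev refl])
    thus "deriv (\<lambda>s. exp (L * s) / (s - p)) s + exp (L * p) / (s - p)\<^sup>2 = deriv Q s"
      by (simp add: DERIV_imp_deriv F_def)
  qed
qed

context entire_three_halves
begin

lemma card_zeros_upto_le: "card (zeros_upto R) \<le> N R"
proof -
  have "(\<Sum>p\<in>zeros_upto R. 1) \<le> (\<Sum>p\<in>zeros_upto R. mult p)"
    using mult_pos_iff by (intro sum_mono) (auto simp: zeros_upto_def Suc_le_eq)
  thus ?thesis by (simp add: N_def)
qed

text \<open>Pigeonhole: at most n = N (R + 2) zeros have modulus up to R + 2, and n + 1 radii with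
  spacing 1 / (n + 1) are tried. If each circle had a zero nearer than half the spacing, distinct
  radii would produce distinct zeros.\<close>

lemma good_circle:
  assumes R: "R \<ge> 1"
  obtains r where "R \<le> r" "r \<le> R + 1"
    "\<And>s p. norm s = r \<Longrightarrow> p \<in> Z \<Longrightarrow> 1 / (2 * (real (N (R + 2)) + 1)) \<le> norm (s - p)"
proof (rule ccontr)
  assume neg: "\<not> thesis"
  note result = that
  define n where "n = N (R + 2)"
  define r where "r = (\<lambda>i::nat. R + real i / (real n + 1))"
  have "\<exists>p\<in>zeros_upto (R + 2). \<bar>norm p - r i\<bar> < 1 / (2 * (real n + 1))" if "i \<le> n" for i
  proof -
    have ri: "R \<le> r i" "r i \<le> R + 1" using that by (auto simp: r_def divide_le_eq)
    then obtain s p where sp: "norm s = r i" "p \<in> Z" "norm (s - p) < 1 / (2 * (real n + 1))"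
      using neg result[of "r i"] unfolding n_def by (metis not_le)
    have "\<bar>norm p - r i\<bar> \<le> norm (s - p)"
      using norm_triangle_ineq3[of s p] sp(1) by linarith
    moreover from this sp(3) have "\<bar>norm p - r i\<bar> < 1 / (2 * (real n + 1))" by linarith
    moreover have "1 / (2 * (real n + 1)) \<le> 1" by (simp add: divide_simps)
    moreover from calculation have "norm p \<le> R + 2" using ri by linarith
    ultimately show ?thesis using sp by (intro bexI[of _ p]) (auto simp: zeros_upto_def)
  qed
  then obtain P where P: "\<And>i. i \<le> n \<Longrightarrow> P i \<in> zeros_upto (R + 2)"
    "\<And>i. i \<le> n \<Longrightarrow> \<bar>norm (P i) - r i\<bar> < 1 / (2 * (real n + 1))" by metis
  have "inj_on P {..n}"
  proof (rule inj_onI)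
    fix i j assume ij: "i \<in> {..n}" "j \<in> {..n}" "P i = P j"
    have "\<bar>r i - r j\<bar> < 1 / (2 * (real n + 1)) + 1 / (2 * (real n + 1))"
      using P(2)[of i] P(2)[of j] ij by auto
    also have "\<dots> = 1 / (real n + 1)" by (simp add: divide_simps)
    finally have "\<bar>(real i - real j) / (real n + 1)\<bar> < 1 / (real n + 1)"
      by (simp add: r_def diff_divide_distrib)
    hence "\<bar>real i - real j\<bar> < 1" by (simp add: abs_divide divide_less_cancel)
    thus "i = j" by linarith
  qed
  hence "card {..n} \<le> card (zeros_upto (R + 2))"
    by (intro card_inj_on_le[of P]) (use P in auto)
  with card_zeros_upto_le[of "R + 2"] show False by (simp add: n_def)
qed

section \<open>Cancellation of the double poles of the weighted logarithmic derivative\<close>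

context
  fixes L :: real
  assumes L: "L > 0" and ZRe: "\<And>p. p \<in> Z \<Longrightarrow> Re p \<le> 1"
begin

definition zero_sum :: "complex \<Rightarrow> complex" where
  "zero_sum s = (\<Sum>\<^sub>\<infinity>p\<in>Z. of_nat (mult p) * exp (of_real L * p) / (s - p)\<^sup>2)"

text \<open>With L = ln x this is the derivative of x^s f'(s) / f(s). A derivative has no residues,
  so its singular part at a zero p is exactly - mult p * exp (L p) / (s - p)^2, the negative of the
  corresponding term of \<open>zero_sum\<close>.\<close>

definition weighted_logderiv_deriv :: "complex \<Rightarrow> complex" where
  "weighted_logderiv_deriv = deriv (\<lambda>s. exp (of_real L * s) * (deriv f s / f s))"

lemma norm_coeff: "p \<in> Z \<Longrightarrow> norm (of_nat (mult p) * exp (of_real L * p)) \<le> exp L * real (mult p)"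
  using mult_right_mono[of "exp (L * Re p)" "exp L" "real (mult p)"] ZRe[of p] L
  by (simp add: norm_mult mult.commute)

lemma summable_coeff: "(\<lambda>p. norm (of_nat (mult p) * exp (of_real L * p)) / (norm p)\<^sup>2) summable_on Z"
proof (rule summable_on_comparison_test)
  show "(\<lambda>p. exp L * (real (mult p) / (norm p)\<^sup>2)) summable_on Z"
    by (intro summable_on_cmult_right summable_mult)
  show "norm (of_nat (mult p) * exp (of_real L * p)) / (norm p)\<^sup>2 \<le> exp L * (real (mult p) / (norm p)\<^sup>2)"
    if "p \<in> Z" for p
    using divide_right_mono[OF norm_coeff[OF that], of "(norm p)\<^sup>2"] by simp
qed auto

lemma summable_zero_sum:
  assumes "\<delta> > 0" "\<And>p. p \<in> A \<Longrightarrow> \<delta> \<le> norm (s - p)" "A \<subseteq> Z"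
  shows "(\<lambda>p. of_nat (mult p) * exp (of_real L * p) / (s - p)\<^sup>2) summable_on A"
proof (rule abs_summable_summable, rule summable_on_comparison_test)
  show "(\<lambda>p. (1 + norm s / \<delta>)\<^sup>2 * (norm (of_nat (mult p) * exp (of_real L * p)) / (norm p)\<^sup>2)) summable_on A"
    by (intro summable_on_cmult_right summable_on_subset_banach[OF summable_coeff assms(3)])
  fix p assume p: "p \<in> A"
  have "norm (of_nat (mult p) * exp (of_real L * p) / (s - p)\<^sup>2)
    = norm (of_nat (mult p) * exp (of_real L * p)) / (norm (s - p))\<^sup>2" by (simp add: norm_divide norm_power)
  also have "\<dots> \<le> (1 + norm s / \<delta>)\<^sup>2 * (norm (of_nat (mult p) * exp (of_real L * p)) / (norm p)\<^sup>2)"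
    using p assms nz by (intro inverse_square_bound) auto
  finally show "norm (of_nat (mult p) * exp (of_real L * p) / (s - p)\<^sup>2) \<le>
    (1 + norm s / \<delta>)\<^sup>2 * (norm (of_nat (mult p) * exp (of_real L * p)) / (norm p)\<^sup>2)" .
qed auto

lemma zero_sum_bound:
  assumes d: "\<delta> > 0" "\<And>p. p \<in> Z \<Longrightarrow> \<delta> \<le> norm (s - p)"
  shows "norm (zero_sum s) \<le> exp L * S2 * (1 + norm s / \<delta>)\<^sup>2"
proof -
  have "norm (zero_sum s) \<le> (\<Sum>\<^sub>\<infinity>p\<in>Z. exp L * (real (mult p) / (norm (s - p))\<^sup>2))"
    unfolding zero_sum_def
  proof (rule norm_has_sum_le[OF has_sum_infsum])
    show "(\<lambda>p. of_nat (mult p) * exp (of_real L * p) / (s - p)\<^sup>2) summable_on Z"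
      by (rule summable_zero_sum[OF d]) auto
    show "(\<lambda>p. exp L * (real (mult p) / (norm (s - p))\<^sup>2)) summable_on Z"
      by (intro summable_on_cmult_right summable_inverse_square(1)[OF d])
    show "norm (of_nat (mult p) * exp (of_real L * p) / (s - p)\<^sup>2) \<le> exp L * (real (mult p) / (norm (s - p))\<^sup>2)"
      if "p \<in> Z" for p
      using divide_right_mono[OF norm_coeff[OF that], of "(norm (s - p))\<^sup>2"]
      by (simp add: norm_divide norm_power)
  qed
  also have "\<dots> = exp L * (\<Sum>\<^sub>\<infinity>p\<in>Z. real (mult p) / (norm (s - p))\<^sup>2)" by (rule infsum_cmult_right')
  also have "\<dots> \<le> exp L * (S2 * (1 + norm s / \<delta>)\<^sup>2)"
    by (intro mult_left_mono summable_inverse_square(2)[OF d]) auto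
  finally show ?thesis by (simp add: mult_ac)
qed

lemma logderiv_differentiable: "(\<lambda>s. deriv f s / f s) field_differentiable at s" if "s \<notin> Z"
proof -
  have "(\<lambda>s. deriv f s / f s) holomorphic_on - Z"
    by (intro holomorphic_intros holomorphic_deriv holomorphic_on_subset[OF holo])
      (use open_Compl[OF closed_Z] in \<open>auto simp: Z_def\<close>)
  thus ?thesis using that open_Compl[OF closed_Z] by (auto intro!: holomorphic_on_imp_differentiable_at)
qed

lemma weighted_logderiv_deriv_eq:
  assumes "s \<notin> Z"
  shows "weighted_logderiv_deriv s = exp (of_real L * s) * (of_real L * (deriv f s / f s) + deriv (\<lambda>s. deriv f s / f s) s)"
proof -
  have "((\<lambda>s. deriv f s / f s) has_field_derivative deriv (\<lambda>s. deriv f s / f s) s) (at s)"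
    using logderiv_differentiable[OF assms] by (simp add: DERIV_deriv_iff_field_differentiable)
  hence "((\<lambda>s. exp (of_real L * s) * (deriv f s / f s)) has_field_derivative
    exp (of_real L * s) * (of_real L * (deriv f s / f s) + deriv (\<lambda>s. deriv f s / f s) s)) (at s)"
  proof -
    assume *: "((\<lambda>s. deriv f s / f s) has_field_derivative deriv (\<lambda>s. deriv f s / f s) s) (at s)"
    have "((\<lambda>s. exp (of_real L * s)) has_field_derivative exp (of_real L * s) * of_real L) (at s)"
      by (auto intro!: derivative_eq_intros)
    from DERIV_mult[OF this *] show "((\<lambda>s. exp (of_real L * s) * (deriv f s / f s)) has_field_derivative
      exp (of_real L * s) * (of_real L * (deriv f s / f s) + deriv (\<lambda>s. deriv f s / f s) s)) (at s)" by (rule DERIV_cong) (simp add: algebra_simps)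
  qed
  thus ?thesis unfolding weighted_logderiv_deriv_def by (rule DERIV_imp_deriv)
qed

text \<open>Writing f = g * (s - s0)^m splits the weighted logarithmic derivative into a part
  holomorphic near s0 and m exp (L s) / (s - s0). By \<open>remove_exp_pole\<close> the double pole
  that the latter leaves is cancelled by the term of s0 in \<open>zero_sum\<close>; all other zeros
  keep a distance r. The case m = 0 covers points that are not zeros.\<close>

lemma explicit_formula_local:
  obtains r h where "r > 0" "h holomorphic_on ball s0 r"
    "\<And>s. s \<in> ball s0 r - {s0} \<Longrightarrow> weighted_logderiv_deriv s + zero_sum s = h s"
proof -
  obtain r0 where r0: "r0 > 0" "\<And>p. p \<in> Z - {s0} \<Longrightarrow> r0 \<le> norm (s0 - p)" using isolated_Z by blast
  define r where "r = r0 / 2"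
  have r: "r > 0" using r0 by (simp add: r_def)
  have far: "r \<le> norm (s - p)" if "p \<in> Z - {s0}" "s \<in> cball s0 r" for p s
  proof -
    have "r0 \<le> norm (s0 - p)" by (rule r0(2)[OF that(1)])
    also have "\<dots> \<le> norm (s0 - s) + norm (s - p)" using norm_triangle_ineq[of "s0 - s" "s - p"] by simp
    also have "norm (s0 - s) \<le> r" using that by (simp add: dist_norm)
    finally show ?thesis by (simp add: r_def)
  qed
  obtain g where g: "g holomorphic_on UNIV" "g s0 \<noteq> 0" "\<And>z. f z = g z * (z - s0) ^ mult s0"
    using entire_factor_at[OF holo f0, of s0] unfolding mult_def by metis
  have fnz: "s \<notin> Z" if "s \<in> ball s0 r - {s0}" for s
  proof
    assume "s \<in> Z"
    hence "r \<le> norm (s - s)" using that by (intro far) auto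
    thus False using r by simp
  qed
  have gnz: "g s \<noteq> 0" if "s \<in> ball s0 r" for s
  proof (cases "s = s0")
    case False
    thus ?thesis using fnz[of s] g(3)[of s] that by (auto simp: Z_def)
  qed (use g in auto)
  obtain hQ where hQ: "hQ holomorphic_on UNIV"
    "\<And>s. s \<noteq> s0 \<Longrightarrow> deriv (\<lambda>s. exp (of_real L * s) / (s - s0)) s + exp (of_real L * s0) / (s - s0)\<^sup>2 = hQ s"
    using remove_exp_pole[of s0 "of_real L"] by blast
  define u where "u = (\<lambda>s. exp (of_real L * s) * (deriv g s / g s))"
  define tl where "tl = (\<lambda>s. \<Sum>\<^sub>\<infinity>p\<in>Z - {s0}. of_nat (mult p) * exp (of_real L * p) / (s - p)\<^sup>2)"
  have u: "u holomorphic_on ball s0 r" unfolding u_def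
    by (intro holomorphic_intros holomorphic_deriv holomorphic_on_subset[OF g(1)]) (use gnz in auto)
  have tl: "tl holomorphic_on ball s0 r" unfolding tl_def
    by (rule holomorphic_infsum_inverse_square[OF summable_on_subset_banach[OF summable_coeff] _ r far])
      (use nz in auto)
  show ?thesis
  proof (rule that[OF r, of "\<lambda>s. deriv u s + of_nat (mult s0) * hQ s + tl s"])
    show "(\<lambda>s. deriv u s + of_nat (mult s0) * hQ s + tl s) holomorphic_on ball s0 r"
      by (intro holomorphic_intros holomorphic_deriv u tl holomorphic_on_subset[OF hQ(1)]) auto
    fix s assume s: "s \<in> ball s0 r - {s0}"
    define v where "v = (\<lambda>s. exp (of_real L * s) / (s - s0))"
    have "eventually (\<lambda>w. w \<in> ball s0 r - {s0}) (nhds s)" using s by (intro eventually_nhds_in_open) auto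
    hence ev: "eventually (\<lambda>w. exp (of_real L * w) * (deriv f w / f w) = u w + of_nat (mult s0) * v w) (nhds s)"
    proof eventually_elim
      case (elim w)
      have "deriv f w / f w = deriv g w / g w + (\<Sum>p\<in>{s0}. of_nat (mult p) / (w - p))"
        by (rule logderiv_mult_prod[OF g(1)]) (use g(3) fnz[OF elim] in \<open>auto simp: Z_def\<close>)
      thus ?case by (simp add: u_def v_def algebra_simps)
    qed
    have 1: "(u has_field_derivative deriv u s) (at s)" using holomorphic_derivI[OF u] s by auto
    have 2: "(v has_field_derivative deriv v s) (at s)"
    proof -
      have "v holomorphic_on - {s0}" unfolding v_def by (intro holomorphic_intros) auto
      from holomorphic_derivI[OF this] show ?thesis using s by auto
    qed
    have "((\<lambda>w. exp (of_real L * w) * (deriv f w / f w)) has_field_derivative deriv u s + of_nat (mult s0) * deriv v s) (at s)"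
      using DERIV_add[OF 1 DERIV_cmult[OF 2, of "of_nat (mult s0)"]]
      by (subst DERIV_cong_ev[OF refl ev refl])
    hence G: "weighted_logderiv_deriv s = deriv u s + of_nat (mult s0) * deriv v s" unfolding weighted_logderiv_deriv_def by (rule DERIV_imp_deriv)
    have T: "zero_sum s = of_nat (mult s0) * exp (of_real L * s0) / (s - s0)\<^sup>2 + tl s"
    proof (cases "s0 \<in> Z")
      case False
      hence "mult s0 = 0" using mult_pos_iff[of s0] by simp
      moreover have "Z - {s0} = Z" using False by auto
      ultimately show ?thesis by (simp add: zero_sum_def tl_def)
    next
      case True
      have "zero_sum s = (\<Sum>\<^sub>\<infinity>p\<in>{s0} \<union> (Z - {s0}). of_nat (mult p) * exp (of_real L * p) / (s - p)\<^sup>2)"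
        using True unfolding zero_sum_def by (simp add: insert_absorb)
      also have "\<dots> = (\<Sum>\<^sub>\<infinity>p\<in>{s0}. of_nat (mult p) * exp (of_real L * p) / (s - p)\<^sup>2) + tl s"
        unfolding tl_def
        by (rule infsum_Un_disjoint) (use summable_zero_sum[OF r far, of "Z - {s0}" s] s in auto)
      finally show ?thesis by simp
    qed
    show "weighted_logderiv_deriv s + zero_sum s = deriv u s + of_nat (mult s0) * hQ s + tl s"
      using s unfolding G T v_def by (simp add: hQ(2)[of s, symmetric] algebra_simps)
  qed
qed

text \<open>Limit and sum may be exchanged because |\<sigma> - p| >= |p| for \<sigma> >= 2: the
  difference of the squares is \<sigma> (\<sigma> - 2 Re p), and Re p <= 1.\<close>

lemma zero_sum_tendsto_0: "((\<lambda>\<sigma>::real. zero_sum (of_real \<sigma>)) \<longlongrightarrow> 0) at_top"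
proof -
  define c where "c = (\<lambda>p. of_nat (mult p) * exp (of_real L * p))"
  have ul: "uniform_limit {2..} (\<lambda>X (\<sigma>::real). \<Sum>p\<in>X. c p / (of_real \<sigma> - p)\<^sup>2)
      (\<lambda>\<sigma>. \<Sum>\<^sub>\<infinity>p\<in>Z. c p / (of_real \<sigma> - p)\<^sup>2) (finite_subsets_at_top Z)"
  proof (rule Weierstrass_m_test_general)
    show "(\<lambda>p. norm (c p) / (norm p)\<^sup>2) summable_on Z" unfolding c_def by (rule summable_coeff)
    fix p and \<sigma> :: real assume p: "p \<in> Z" "\<sigma> \<in> {2..}"
    have "(norm p)\<^sup>2 \<le> (norm (of_real \<sigma> - p))\<^sup>2"
    proof -
      have "0 \<le> \<sigma> * (\<sigma> - 2 * Re p)" using p ZRe[of p] by (intro mult_nonneg_nonneg) auto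
      thus ?thesis unfolding cmod_power2 by (simp add: power2_eq_square algebra_simps)
    qed
    moreover have "norm p > 0" using p nz by auto
    ultimately show "norm (c p / (of_real \<sigma> - p)\<^sup>2) \<le> norm (c p) / (norm p)\<^sup>2"
      unfolding norm_divide norm_power
      by (intro divide_left_mono mult_pos_pos) (auto simp: zero_less_power2)
  qed
  have "((\<lambda>\<sigma>. \<Sum>\<^sub>\<infinity>p\<in>Z. c p / (of_real \<sigma> - p)\<^sup>2) \<longlongrightarrow> 0) at_top"
  proof (rule swap_uniform_limit'[OF _ tendsto_const ul])
    show "\<forall>\<^sub>F X in finite_subsets_at_top Z. ((\<lambda>\<sigma>. \<Sum>p\<in>X. c p / (of_real \<sigma> - p)\<^sup>2) \<longlongrightarrow> 0) at_top"
    proof (intro always_eventually allI tendsto_null_sum)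
      fix p :: complex
      have "filterlim (\<lambda>\<sigma>. of_real \<sigma> - p) at_infinity at_top"
        using tendsto_add_filterlim_at_infinity'[OF filterlim_of_real_at_infinity tendsto_const, of "- p :: complex"] by simp
      hence t: "((\<lambda>\<sigma>. d / (of_real \<sigma> - p)) \<longlongrightarrow> 0) at_top" for d
        by (intro tendsto_divide_0[OF tendsto_const])
      from tendsto_mult[OF t[of "c p"] t[of 1]]
      show "((\<lambda>\<sigma>. c p / (of_real \<sigma> - p)\<^sup>2) \<longlongrightarrow> 0) at_top"
        by (simp add: power2_eq_square)
    qed
  qed (auto intro: eventually_ge_at_top)
  thus ?thesis unfolding zero_sum_def c_def .
qed

text \<open>For Re s <= 2 the weight exp (L s) is bounded, so the three terms are controlled
  separately; for Re s >= 2 the first term and \<open>B\<close> are controlled only together. On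
  circles that avoid the zeros this bounds the sum polynomially, so its entire extension is a
  polynomial, and the limit 0 along the positive real axis makes it vanish.\<close>

theorem explicit_formula_abstract:
  assumes B: "B holomorphic_on UNIV"
    and left: "\<And>s. Re s \<le> 2 \<Longrightarrow> norm s \<ge> 2 \<Longrightarrow> norm (B s) \<le> CB"
    and right: "\<And>s. Re s \<ge> 2 \<Longrightarrow> norm (weighted_logderiv_deriv s + B s) \<le> CB"
    and lim: "((\<lambda>\<sigma>::real. weighted_logderiv_deriv (of_real \<sigma>) + B (of_real \<sigma>)) \<longlongrightarrow> 0) at_top"
    and s: "s \<notin> Z"
  shows "weighted_logderiv_deriv s + zero_sum s + B s = 0"
proof -
  define E where "E = (\<lambda>s. weighted_logderiv_deriv s + zero_sum s)"
  \<comment> \<open>The values of \<open>E\<close> at the zeros themselves carry no meaning; they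
    are replaced by limits before holomorphy is claimed.\<close>
  define H where "H = (\<lambda>s. remove_sings E s + B s)"
  have lim_iso: "isolated_singularity_at E s \<and> (\<exists>c. E \<midarrow>s\<rightarrow> c)" for s
  proof -
    obtain r h where h: "r > 0" "h holomorphic_on ball s r"
      "\<And>w. w \<in> ball s r - {s} \<Longrightarrow> E w = h w" unfolding E_def using explicit_formula_local by blast
    have "E holomorphic_on ball s r - {s}"
      by (rule holomorphic_transform[OF holomorphic_on_subset[OF h(2)]]) (use h(3) in auto)
    hence "E analytic_on ball s r - {s}" by (subst analytic_on_open) (auto simp: open_delete)
    hence "isolated_singularity_at E s" using h(1) unfolding isolated_singularity_at_def by blast
    moreover have "E \<midarrow>s\<rightarrow> h s"
    proof -
      have "isCont h s" using h(1,2) by (auto dest!: holomorphic_on_imp_continuous_on simp: continuous_on_eq_continuous_at)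
      hence "h \<midarrow>s\<rightarrow> h s" by (simp add: isCont_def)
      moreover have "eventually (\<lambda>w. h w = E w) (at s)"
        using eventually_at_in_open[of "ball s r" s] h(1,3) by (auto elim!: eventually_mono)
      ultimately show ?thesis using tendsto_cong by force
    qed
    ultimately show ?thesis by blast
  qed
  have "remove_sings E analytic_on {s}" for s
    using lim_iso[of s] remove_sings_analytic_at by blast
  hence "remove_sings E holomorphic_on UNIV"
    by (meson analytic_imp_holomorphic analytic_on_analytic_at)
  hence H: "H holomorphic_on UNIV" unfolding H_def using B by (intro holomorphic_intros)
  have HE: "H s = weighted_logderiv_deriv s + zero_sum s + B s" if sZ: "s \<notin> Z" for s
  proof -
    obtain \<delta> where d: "\<delta> > 0" "\<And>p. p \<in> Z \<Longrightarrow> \<delta> \<le> norm (s - p)" using dist_Z[OF sZ] by metis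
    have bs: "\<delta>/2 \<le> norm (w - p)" if "p \<in> Z" "w \<in> cball s (\<delta>/2)" for p w
      using d(2)[OF that(1)] norm_triangle_ineq[of "s - w" "w - p"] that(2) by (simp add: dist_norm)
    have "zero_sum holomorphic_on ball s (\<delta>/2)"
      unfolding zero_sum_def[abs_def]
      by (rule holomorphic_infsum_inverse_square[OF summable_coeff nz _ bs]) (use d in auto)
    moreover have "weighted_logderiv_deriv holomorphic_on ball s (\<delta>/2)"
      unfolding weighted_logderiv_deriv_def
    proof (intro holomorphic_deriv holomorphic_intros holomorphic_on_subset[OF holo])
      show "f w \<noteq> 0" if "w \<in> ball s (\<delta> / 2)" for w
        using bs[of w w] that d by (auto simp: Z_def)
    qed auto
    ultimately have "E holomorphic_on ball s (\<delta>/2)" unfolding E_def by (intro holomorphic_intros)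
    hence "E analytic_on {s}" using d(1) by (auto simp: analytic_at intro!: exI[of _ "ball s (\<delta>/2)"])
    thus ?thesis by (simp add: H_def E_def)
  qed
  define c0 where "c0 = norm (deriv f 0 / f 0)"
  define C1 where "C1 = exp (2 * L) * (L * (c0 + S2) + S2) + exp L * S2 + CB"
  have CB0: "CB \<ge> 0" using left[of "-2"] norm_ge_zero[of "B (-2)"] by (simp del: norm_ge_zero)
  have c00: "c0 \<ge> 0" by (simp add: c0_def)
  have C10: "C1 \<ge> 0" unfolding C1_def using CB0 c00 S2_nonneg L by (intro add_nonneg_nonneg mult_nonneg_nonneg) auto
  have circ: "norm (H s) \<le> C1 * (1 + norm s / \<delta>)\<^sup>2"
    if d: "\<delta> > 0" "\<delta> \<le> 1" "\<And>p. p \<in> Z \<Longrightarrow> \<delta> \<le> norm (s - p)" and s2: "norm s \<ge> 2" for s \<delta>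
  proof -
    define A where "A = (1 + norm s / \<delta>)\<^sup>2"
    have A1: "A \<ge> 1" using d(1) by (simp add: A_def one_le_power)
    have sZ: "s \<notin> Z" using d by force
    note T = zero_sum_bound[OF d(1) d(3), folded A_def]
    have CBA: "CB \<le> CB * A" using mult_left_mono[OF A1 CB0] by simp
    show ?thesis unfolding A_def[symmetric]
    proof (cases "Re s \<le> 2")
      case True
      have "norm (weighted_logderiv_deriv s) \<le> exp (2 * L) * ((L * (c0 + S2) + S2) * A)"
      proof -
        have "norm (of_real L * (deriv f s / f s) + deriv (\<lambda>s. deriv f s / f s) s) \<le>
           L * norm (deriv f s / f s) + norm (deriv (\<lambda>s. deriv f s / f s) s)"
          using L by (rule_tac norm_triangle_ineq[THEN order_trans]) (simp add: norm_mult norm_divide)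
        also have "\<dots> \<le> L * (c0 + S2 * A) + S2 * A"
          using logderiv_bound[OF d] L unfolding A_def c0_def by (intro add_mono mult_left_mono) auto
        also have "\<dots> \<le> L * (c0 * A + S2 * A) + S2 * A"
          using mult_left_mono[OF A1 c00] L by simp
        also have "\<dots> = (L * (c0 + S2) + S2) * A" by (simp add: algebra_simps)
        finally have "norm (of_real L * (deriv f s / f s) + deriv (\<lambda>s. deriv f s / f s) s) \<le> (L * (c0 + S2) + S2) * A" .
        moreover have "norm (exp (of_real L * s)) \<le> exp (2 * L)" using True L by simp
        ultimately show ?thesis unfolding weighted_logderiv_deriv_eq[OF sZ] norm_mult
          by (intro mult_mono) auto
      qed
      moreover have "norm (B s) \<le> CB * A" using left[OF True s2] CBA by linarith
      ultimately have "norm (H s) \<le> exp (2 * L) * ((L * (c0 + S2) + S2) * A) + exp L * S2 * A + CB * A"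
        unfolding HE[OF sZ] using T norm_triangle_ineq[of "weighted_logderiv_deriv s + zero_sum s" "B s"] norm_triangle_ineq[of "weighted_logderiv_deriv s" "zero_sum s"]
        by linarith
      thus "norm (H s) \<le> C1 * A" by (simp add: C1_def algebra_simps)
    next
      case False
      have "norm (H s) \<le> norm (weighted_logderiv_deriv s + B s) + norm (zero_sum s)"
        unfolding HE[OF sZ] using norm_triangle_ineq[of "weighted_logderiv_deriv s + B s" "zero_sum s"] by (simp add: algebra_simps)
      also have "\<dots> \<le> CB * A + exp L * S2 * A" using right[of s] False CBA T by linarith
      also have "\<dots> \<le> C1 * A"
      proof -
        have "0 \<le> exp (2 * L) * (L * (c0 + S2) + S2) * A"
          using L c00 S2_nonneg A1 by (intro mult_nonneg_nonneg add_nonneg_nonneg) auto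
        thus ?thesis by (simp add: C1_def algebra_simps)
      qed
      finally show "norm (H s) \<le> C1 * A" .
    qed
  qed
  \<comment> \<open>Degree 6: on a good circle norm s / \<delta> is of order R * N (R + 2), and N (R
    + 2) <= K (R + 2)^2, which gives a cube; \<open>circ\<close> squares it, and the maximum
    principle carries the bound from the circle to z.\<close>
  have poly: "norm (H z) \<le> (C1 * (2 * K + 3)\<^sup>2 * 64) * norm z ^ 6" if z: "2 \<le> norm z" for z
  proof -
    define R where "R = norm z"
    have R: "R \<ge> 2" using z by (simp add: R_def)
    have "1 \<le> R" using R by simp
    from good_circle[OF this] obtain r where r: "R \<le> r" "r \<le> R + 1"
      "\<And>s p. norm s = r \<Longrightarrow> p \<in> Z \<Longrightarrow> 1 / (2 * (real (N (R + 2)) + 1)) \<le> norm (s - p)"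
      by blast
    define \<delta> where "\<delta> = 1 / (2 * (real (N (R + 2)) + 1))"
    have d: "\<delta> > 0" "\<delta> \<le> 1" by (auto simp: \<delta>_def divide_simps)
    have A: "1 + r / \<delta> \<le> (2 * K + 3) * (R + 2) ^ 3"
    proof -
      have "real (N (R + 2)) \<le> K * (R + 2) powr (3/2)" using R by (intro zero_count) auto
      also have "\<dots> \<le> K * (R + 2) powr 2" using R K_nonneg by (intro mult_left_mono powr_mono) auto
      also have "(R + 2) powr 2 = (R + 2)\<^sup>2" using R by (subst powr_numeral) auto
      finally have Nb: "real (N (R + 2)) \<le> K * (R + 2)\<^sup>2" .
      have "1 + r / \<delta> = 1 + r * (2 * (real (N (R + 2)) + 1))" by (simp add: \<delta>_def)
      also have "\<dots> \<le> (R + 2) ^ 3 + (R + 2) * (2 * (K * (R + 2)\<^sup>2 + (R + 2)\<^sup>2))"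
        using r(2) R Nb by (intro add_mono mult_mono) (auto simp: one_le_power)
      also have "\<dots> = (2 * K + 3) * (R + 2) ^ 3" by (simp add: algebra_simps power3_eq_cube power2_eq_square)
      finally show ?thesis .
    qed
    have sph: "norm (H w) \<le> C1 * ((2 * K + 3) * (R + 2) ^ 3)\<^sup>2" if w: "norm w = r" for w
    proof -
      have "norm (H w) \<le> C1 * (1 + norm w / \<delta>)\<^sup>2"
        using w R r(1) r(3)[OF w] d by (intro circ) (simp_all add: \<delta>_def)
      also have "\<dots> \<le> C1 * ((2 * K + 3) * (R + 2) ^ 3)\<^sup>2"
        using A d r(1) R unfolding w by (intro mult_left_mono power_mono C10) auto
      finally show ?thesis .
    qed
    have "norm (H z) \<le> C1 * ((2 * K + 3) * (R + 2) ^ 3)\<^sup>2"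
    proof (rule maximum_modulus_frontier[of H "cball 0 r"])
      show "H holomorphic_on interior (cball 0 r)" by (rule holomorphic_on_subset[OF H]) auto
      show "continuous_on (closure (cball 0 r)) H"
        by (rule holomorphic_on_imp_continuous_on[OF holomorphic_on_subset[OF H]]) auto
      show "norm (H w) \<le> C1 * ((2 * K + 3) * (R + 2) ^ 3)\<^sup>2" if "w \<in> frontier (cball 0 r)" for w
        using that by (intro sph) (simp add: frontier_cball)
      show "z \<in> cball 0 r" using r(1) by (simp add: R_def)
    qed simp
    also have "\<dots> \<le> C1 * ((2 * K + 3) * (2 * R) ^ 3)\<^sup>2"
    proof -
      have "(R + 2) ^ 3 \<le> (2 * R) ^ 3" using R by (intro power_mono) auto
      hence "(2 * K + 3) * (R + 2) ^ 3 \<le> (2 * K + 3) * (2 * R) ^ 3"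
        using K_nonneg by (intro mult_left_mono) auto
      moreover have "0 \<le> (2 * K + 3) * (R + 2) ^ 3" using K_nonneg R by simp
      ultimately have "((2 * K + 3) * (R + 2) ^ 3)\<^sup>2 \<le> ((2 * K + 3) * (2 * R) ^ 3)\<^sup>2"
        by (rule power_mono)
      thus ?thesis by (rule mult_left_mono[OF _ C10])
    qed
    also have "((2 * K + 3) * (2 * R) ^ 3)\<^sup>2 = (2 * K + 3)\<^sup>2 * 64 * R ^ 6"
    proof -
      have "(2 * R) ^ 3 = 8 * R ^ 3" by (simp add: power_mult_distrib)
      moreover have "(R ^ 3)\<^sup>2 = R ^ 6" using power_mult[of R 3 2] by simp
      ultimately show ?thesis by (simp only: power_mult_distrib) simp
    qed
    finally show ?thesis by (simp add: R_def mult.assoc)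
  qed
  define a where "a = (\<lambda>k. (deriv ^^ k) H 0 / fact k)"
  have Hp: "H \<xi> = (\<Sum>k\<le>6. a k * \<xi> ^ k)" for \<xi>
    unfolding a_def by (rule Liouville_polynomial[OF H poly])
  have H0: "((\<lambda>\<sigma>::real. H (of_real \<sigma>)) \<longlongrightarrow> 0) at_top"
  proof -
    have "((\<lambda>\<sigma>::real. (weighted_logderiv_deriv (of_real \<sigma>) + B (of_real \<sigma>)) + zero_sum (of_real \<sigma>)) \<longlongrightarrow> 0 + 0) at_top"
      by (intro tendsto_add lim zero_sum_tendsto_0)
    moreover have "eventually (\<lambda>\<sigma>::real. (weighted_logderiv_deriv (of_real \<sigma>) + B (of_real \<sigma>)) + zero_sum (of_real \<sigma>) = H (of_real \<sigma>)) at_top"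
      using eventually_gt_at_top[of 1]
    proof eventually_elim
      case (elim \<sigma>)
      hence "of_real \<sigma> \<notin> Z" using ZRe[of "of_real \<sigma>"] by auto
      thus ?case using HE by simp
    qed
    ultimately show ?thesis using tendsto_cong by force
  qed
  \<comment> \<open>A nonconstant polynomial is unbounded near infinity, which contradicts the limit
    \<open>H0\<close>.\<close>
  have "a k = 0" if "k \<le> 6" "k \<noteq> 0" for k
  proof (rule ccontr)
    assume "a k \<noteq> 0"
    hence "eventually (\<lambda>z. norm (\<Sum>i\<le>6. a i * z ^ i) \<ge> 1) at_infinity"
      using that by (intro polyfun_extremal) auto
    hence "eventually (\<lambda>\<sigma>::real. norm (H (of_real \<sigma>)) \<ge> 1) at_top"
      unfolding Hp[symmetric] using filterlim_of_real_at_infinity by (rule eventually_compose_filterlim)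
    moreover have "eventually (\<lambda>\<sigma>::real. norm (H (of_real \<sigma>)) < 1) at_top"
      using tendstoD[OF H0, of 1] by simp
    ultimately have "eventually (\<lambda>\<sigma>::real. False) at_top" by eventually_elim simp
    thus False by simp
  qed
  hence Hc: "H \<xi> = a 0" for \<xi>
    unfolding Hp[of \<xi>] by (subst sum.remove[of _ 0]) auto
  have "a 0 = 0" using H0 tendsto_unique[OF _ tendsto_const] unfolding Hc by force
  thus ?thesis using HE[OF s] Hc by simp
qed

end

end

section \<open>Jacobi's theta function\<close>

text \<open>The functions orthogonal to all these cosines are closed under multiplication by cos (2
  pi y), hence by polynomials in it. As c = cos (2 pi y) maps {0..1/2} bijectively onto {-1..1},
  \<open>D\<close> is a continuous function of c; approximating it by polynomials within e bounds
  the integral of D^2 by e times that of |D|.\<close>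

lemma cosine_orthogonality_unique:
  fixes D :: "real \<Rightarrow> real"
  assumes D: "continuous_on {0..1/2} D"
    and orth: "\<And>m::nat. integral {0..1/2} (\<lambda>y. D y * cos (2 * pi * real m * y)) = 0"
    and y: "y \<in> {0..1/2}"
  shows "D y = 0"
proof -
  define I where "I = {0..1/2::real}"
  define cls where "cls = {D :: real \<Rightarrow> real. continuous_on I D \<and>
    (\<forall>m::nat. integral I (\<lambda>y. D y * cos (2 * pi * real m * y)) = 0)}"
  have int: "f integrable_on I" if "continuous_on I f" for f :: "real \<Rightarrow> real"
    using that unfolding I_def by (rule integrable_continuous_interval)
  have scale: "(\<lambda>y. c * D y) \<in> cls" if "D \<in> cls" for c D
    using that by (auto simp: cls_def mult.assoc intro!: continuous_intros)
  have add: "(\<lambda>y. D y + E y) \<in> cls" if "D \<in> cls" "E \<in> cls" for D E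
  proof -
    have "integral I (\<lambda>y. (D y + E y) * cos (2 * pi * real m * y)) = 0" for m
    proof -
      have "integral I (\<lambda>y. (D y + E y) * cos (2 * pi * real m * y)) =
        integral I (\<lambda>y. D y * cos (2 * pi * real m * y)) + integral I (\<lambda>y. E y * cos (2 * pi * real m * y))"
        unfolding distrib_right
        by (rule Henstock_Kurzweil_Integration.integral_add) (use that in \<open>auto simp: cls_def intro!: int continuous_intros\<close>)
      thus ?thesis using that by (simp add: cls_def)
    qed
    thus ?thesis using that by (auto simp: cls_def intro!: continuous_intros)
  qed
  have cosm: "(\<lambda>y. cos (2 * pi * y) * D y) \<in> cls" if "D \<in> cls" for D
  proof -
    have "integral I (\<lambda>y. cos (2 * pi * y) * D y * cos (2 * pi * real m * y)) = 0" for m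
    proof (cases m)
      case 0
      have "integral I (\<lambda>y. D y * cos (2 * pi * real 1 * y)) = 0" using that unfolding cls_def by blast
      thus ?thesis using 0 by (simp add: mult.commute)
    next
      case (Suc k)
      have "cos (2 * pi * y) * D y * cos (2 * pi * real m * y) =
        1/2 * (D y * cos (2 * pi * real (m + 1) * y)) + 1/2 * (D y * cos (2 * pi * real k * y))" for y
      proof -
        have "cos (2 * pi * y) * cos (2 * pi * real m * y) =
          (cos (2 * pi * y - 2 * pi * real m * y) + cos (2 * pi * y + 2 * pi * real m * y)) / 2"
          by (rule cos_times_cos)
        also have "2 * pi * y - 2 * pi * real m * y = - (2 * pi * real k * y)"
          by (simp add: Suc algebra_simps)
        also have "2 * pi * y + 2 * pi * real m * y = 2 * pi * real (m + 1) * y"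
          by (simp add: algebra_simps)
        finally show ?thesis by (simp add: field_simps)
      qed
      hence "integral I (\<lambda>y. cos (2 * pi * y) * D y * cos (2 * pi * real m * y)) =
        integral I (\<lambda>y. 1/2 * (D y * cos (2 * pi * real (m + 1) * y)) + 1/2 * (D y * cos (2 * pi * real k * y)))"
        by presburger
      also have "\<dots> = integral I (\<lambda>y. 1/2 * (D y * cos (2 * pi * real (m + 1) * y))) +
          integral I (\<lambda>y. 1/2 * (D y * cos (2 * pi * real k * y)))"
        by (rule Henstock_Kurzweil_Integration.integral_add) (use that in \<open>auto simp: cls_def intro!: int continuous_intros\<close>)
      also have "\<dots> = 0"
      proof -
        have z: "integral I (\<lambda>y. D y * cos (2 * pi * real j * y)) = 0" for j using that by (simp add: cls_def)
        show ?thesis unfolding Henstock_Kurzweil_Integration.integral_mult_right z by simp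
      qed
      finally show ?thesis .
    qed
    thus ?thesis using that by (auto simp: cls_def intro!: continuous_intros)
  qed
  have poly: "(\<lambda>y. g (cos (2 * pi * y)) * D y) \<in> cls"
    if "real_polynomial_function g" "D \<in> cls" for g :: "real \<Rightarrow> real" and D
    using that
  proof (induction arbitrary: D)
    case (linear f)
    have "f c = c * f 1" for c using linear.hyps real_bounded_linear by auto
    hence "(\<lambda>y. f (cos (2 * pi * y)) * D y) = (\<lambda>y. f 1 * (cos (2 * pi * y) * D y))" by (metis mult.assoc mult.commute)
    thus ?case using scale[OF cosm[OF linear.prems]] by simp
  next
    case (const c) thus ?case by (rule scale)
  next
    case (add f g)
    thus ?case using \<open>\<And>E D. D \<in> cls \<Longrightarrow> E \<in> cls \<Longrightarrow> (\<lambda>y. D y + E y) \<in> cls\<close> by (simp add: distrib_right)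
  next
    case (mult f g)
    from mult.IH(1)[OF mult.IH(2)[OF mult.prems]] show ?case by (simp add: mult.assoc)
  qed
  have Dc: "D \<in> cls" using D orth by (simp add: cls_def I_def)
  define H where "H = (\<lambda>c. D (arccos c / (2 * pi)))"
  have Hc: "continuous_on {-1..1} H"
    unfolding H_def
  proof (rule continuous_on_compose2[OF D])
    show "continuous_on {-1..1} (\<lambda>x. arccos x / (2 * pi))" by (intro continuous_intros) auto
    show "(\<lambda>x. arccos x / (2 * pi)) ` {-1..1} \<subseteq> {0..1/2}"
      by (auto simp: arccos_lbound arccos_ubound divide_simps)
  qed
  have HD: "H (cos (2 * pi * y)) = D y" if "y \<in> I" for y
    using that by (simp add: H_def I_def arccos_cos)
  have cD2: "continuous_on I (\<lambda>y. (D y)\<^sup>2)" and cabs: "continuous_on I (\<lambda>y. \<bar>D y\<bar>)"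
    using D by (auto simp: I_def intro!: continuous_intros)
  define A where "A = integral I (\<lambda>y. \<bar>D y\<bar>)"
  have A0: "A \<ge> 0" unfolding A_def by (intro Henstock_Kurzweil_Integration.integral_nonneg int cabs) auto
  have small: "integral I (\<lambda>y. (D y)\<^sup>2) \<le> e * A" if e: "e > 0" for e
  proof -
    obtain g where g: "real_polynomial_function g" "\<And>c. c \<in> {-1..1} \<Longrightarrow> \<bar>H c - g c\<bar> < e"
      using Stone_Weierstrass_real_polynomial_function[OF compact_Icc Hc e] by blast
    have gD: "(\<lambda>y. g (cos (2 * pi * y)) * D y) \<in> cls" by (rule poly[OF g(1) Dc])
    hence g0: "integral I (\<lambda>y. g (cos (2 * pi * y)) * D y) = 0"
      unfolding cls_def by (auto dest: spec[of _ 0])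
    have gint: "(\<lambda>y. g (cos (2 * pi * y)) * D y) integrable_on I" using gD by (intro int) (auto simp: cls_def)
    have "integral I (\<lambda>y. (D y)\<^sup>2) = integral I (\<lambda>y. (D y)\<^sup>2 - g (cos (2 * pi * y)) * D y)"
      using g0 by (subst Henstock_Kurzweil_Integration.integral_diff[OF int[OF cD2] gint]) simp
    also have "\<dots> \<le> integral I (\<lambda>y. e * \<bar>D y\<bar>)"
    proof (rule integral_le)
      show "(\<lambda>y. (D y)\<^sup>2 - g (cos (2 * pi * y)) * D y) integrable_on I"
        by (intro Henstock_Kurzweil_Integration.integrable_diff int[OF cD2] gint)
      show "(\<lambda>y. e * \<bar>D y\<bar>) integrable_on I" by (intro int continuous_intros cabs)
      fix y assume y: "y \<in> I"
      have "(D y)\<^sup>2 - g (cos (2 * pi * y)) * D y = (H (cos (2 * pi * y)) - g (cos (2 * pi * y))) * D y"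
        unfolding HD[OF y] by (simp add: power2_eq_square algebra_simps)
      also have "\<dots> \<le> \<bar>H (cos (2 * pi * y)) - g (cos (2 * pi * y))\<bar> * \<bar>D y\<bar>"
        by (metis abs_ge_self abs_mult)
      also have "\<dots> \<le> e * \<bar>D y\<bar>" using g(2)[of "cos (2 * pi * y)"] by (intro mult_right_mono) auto
      finally show "(D y)\<^sup>2 - g (cos (2 * pi * y)) * D y \<le> e * \<bar>D y\<bar>" .
    qed
    also have "\<dots> = e * A" by (simp add: A_def)
    finally show ?thesis .
  qed
  have "integral I (\<lambda>y. (D y)\<^sup>2) \<le> 0"
  proof (rule field_le_epsilon)
    fix e :: real assume "e > 0"
    hence "integral I (\<lambda>y. (D y)\<^sup>2) \<le> e / (A + 1) * A" using A0 by (intro small) auto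
    also have "\<dots> \<le> e" using A0 \<open>e > 0\<close> by (simp add: divide_simps)
    finally show "integral I (\<lambda>y. (D y)\<^sup>2) \<le> 0 + e" by simp
  qed
  moreover have "integral I (\<lambda>y. (D y)\<^sup>2) \<ge> 0"
    by (intro Henstock_Kurzweil_Integration.integral_nonneg int cD2) auto
  ultimately have "integral {0..1/2} (\<lambda>y. (D y)\<^sup>2) = 0" by (simp add: I_def)
  hence "\<forall>y\<in>{0..1/2}. (D y)\<^sup>2 = 0"
    using cD2 by (subst (asm) integral_eq_0_iff) (auto simp: I_def)
  thus ?thesis using y by auto
qed

lemma sums_integral_M_test:
  fixes a :: "nat \<Rightarrow> real \<Rightarrow> real"
  assumes M: "summable M" "\<And>n y. y \<in> {0..1/2} \<Longrightarrow> \<bar>a n y\<bar> \<le> M n"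
    and cont: "\<And>n. continuous_on {0..1/2} (a n)" and phi: "continuous_on {0..1/2} \<phi>"
  shows "continuous_on {0..1/2} (\<lambda>y. \<Sum>n. a n y)"
    "(\<lambda>n. integral {0..1/2} (\<lambda>y. a n y * \<phi> y)) sums integral {0..1/2} (\<lambda>y. (\<Sum>n. a n y) * \<phi> y)"
proof -
  have ul: "uniform_limit {0..1/2} (\<lambda>N y. \<Sum>n<N. a n y) (\<lambda>y. \<Sum>n. a n y) sequentially"
    by (rule Weierstrass_m_test[OF _ M(1)]) (use M(2) in auto)
  show "continuous_on {0..1/2} (\<lambda>y. \<Sum>n. a n y)"
    by (rule uniform_limit_theorem[OF _ ul]) (auto intro!: always_eventually continuous_intros cont)
  have b: "bounded (\<phi> ` {0..1/2})" by (intro compact_imp_bounded compact_continuous_image phi) auto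
  have bs: "bounded ((\<lambda>y. \<Sum>n. a n y) ` {0..1/2})"
    by (intro compact_imp_bounded compact_continuous_image \<open>continuous_on {0..1/2} (\<lambda>y. \<Sum>n. a n y)\<close>) auto
  have "uniform_limit {0..1/2} (\<lambda>N y. (\<Sum>n<N. a n y) * \<phi> y) (\<lambda>y. (\<Sum>n. a n y) * \<phi> y) sequentially"
    by (rule uniform_lim_mult[OF ul uniform_limit_const bs b])
  then obtain I J where IJ: "\<And>N. ((\<lambda>y. (\<Sum>n<N. a n y) * \<phi> y) has_integral I N) {0..1/2}"
    "((\<lambda>y. (\<Sum>n. a n y) * \<phi> y) has_integral J) {0..1/2}" "I \<longlonglongrightarrow> J"
    by (rule uniform_limit_integral) (auto intro!: continuous_intros cont phi)
  have "I N = (\<Sum>n<N. integral {0..1/2} (\<lambda>y. a n y * \<phi> y))" for N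
  proof -
    have "I N = integral {0..1/2} (\<lambda>y. \<Sum>n<N. a n y * \<phi> y)"
      using IJ(1)[of N] by (simp add: sum_distrib_right has_integral_iff)
    also have "\<dots> = (\<Sum>n<N. integral {0..1/2} (\<lambda>y. a n y * \<phi> y))"
      by (rule Henstock_Kurzweil_Integration.integral_sum) (auto intro!: integrable_continuous_interval continuous_intros cont phi)
    finally show ?thesis .
  qed
  hence "I = (\<lambda>N. \<Sum>n<N. integral {0..1/2} (\<lambda>y. a n y * \<phi> y))" by auto
  thus "(\<lambda>n. integral {0..1/2} (\<lambda>y. a n y * \<phi> y)) sums integral {0..1/2} (\<lambda>y. (\<Sum>n. a n y) * \<phi> y)"
    using IJ(2,3) by (simp add: sums_def has_integral_iff)
qed

text \<open>This is the real part of the characteristic function of the standard normal law, after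
  scaling the variable by c = 1 / sqrt (2 pi u).\<close>

lemma gaussian_cos_integral:
  fixes u b :: real
  assumes u: "u > 0"
  shows "integrable lborel (\<lambda>y. exp (- pi * u * y\<^sup>2) * cos (b * y))"
    "(\<integral>y. exp (- pi * u * y\<^sup>2) * cos (b * y) \<partial>lborel) = exp (- b\<^sup>2 / (4 * pi * u)) / sqrt u"
proof -
  define c where "c = 1 / sqrt (2 * pi * u)"
  define t where "t = b * c"
  define q where "q = (\<lambda>y. exp (- pi * u * y\<^sup>2) * cos (b * y))"
  have c: "c > 0" using u by (simp add: c_def)
  have c2: "c\<^sup>2 = 1 / (2 * pi * u)" using u by (simp add: c_def power_divide)
  have char: "char std_normal_distribution t = exp (- (t\<^sup>2) / 2)"
    by (simp add: char_std_normal_distribution)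
  have int: "integrable lborel (\<lambda>x. std_normal_density x *\<^sub>R iexp (t * x))"
  proof (rule Bochner_Integration.integrable_bound[of _ std_normal_density])
    show "integrable lborel std_normal_density" by simp
  qed (auto simp: norm_mult)
  have "char std_normal_distribution t = (\<integral>x. std_normal_density x *\<^sub>R iexp (t * x) \<partial>lborel)"
    unfolding char_def by (subst integral_density) auto
  hence "Re (\<integral>x. std_normal_density x *\<^sub>R iexp (t * x) \<partial>lborel) = exp (- (t\<^sup>2) / 2)"
    using char by (metis Re_complex_of_real)
  hence ci: "(\<integral>x. std_normal_density x * cos (t * x) \<partial>lborel) = exp (- (t\<^sup>2) / 2)"
    by (subst (asm) integral_Re[OF int, symmetric]) (simp add: Re_exp)
  have int': "integrable lborel (\<lambda>x. std_normal_density x * cos (t * x))"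
    using integrable_Re[OF int] by (simp add: Re_exp)
  have eq: "q (0 + c * x) = sqrt (2 * pi) * (std_normal_density x * cos (t * x))" for x
  proof -
    have "pi * u * (c * x)\<^sup>2 = x\<^sup>2 / 2" using u by (simp add: power_mult_distrib c2 field_simps)
    thus ?thesis by (simp add: q_def std_normal_density_def t_def mult_ac)
  qed
  have "integrable lborel (\<lambda>x. q (0 + c * x))" unfolding eq using int' by simp
  thus "integrable lborel q" using c lborel_integrable_real_affine_iff[of c q 0] by simp
  have "(\<integral>x. q x \<partial>lborel) = \<bar>c\<bar> *\<^sub>R (\<integral>x. q (0 + c * x) \<partial>lborel)"
    using c by (intro lborel_integral_real_affine) simp
  also have "(\<integral>x. q (0 + c * x) \<partial>lborel) = sqrt (2 * pi) * exp (- (t\<^sup>2) / 2)"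
    unfolding eq by (simp add: ci)
  also have "\<bar>c\<bar> *\<^sub>R (sqrt (2 * pi) * exp (- (t\<^sup>2) / 2)) = exp (- b\<^sup>2 / (4 * pi * u)) / sqrt u"
  proof -
    have "t\<^sup>2 / 2 = b\<^sup>2 / (4 * pi * u)" by (simp add: t_def power_mult_distrib c2)
    moreover have "c * sqrt (2 * pi) = 1 / sqrt u" using u by (simp add: c_def real_sqrt_mult)
    ultimately show ?thesis using c by (simp add: mult.assoc[symmetric])
  qed
  finally show "(\<integral>y. q y \<partial>lborel) = exp (- b\<^sup>2 / (4 * pi * u)) / sqrt u" .
qed

text \<open>Half of the full integral, by evenness. The form with a limit of proper integrals fits
  the telescoping sum in the proof of the theta transformation.\<close>

lemma gaussian_cos_limit:
  fixes u b :: real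
  assumes u: "u > 0"
  shows "((\<lambda>N. integral {0..N} (\<lambda>y. exp (- pi * u * y\<^sup>2) * cos (b * y))) \<longlongrightarrow>
           exp (- b\<^sup>2 / (4 * pi * u)) / (2 * sqrt u)) at_top"
proof -
  define q where "q = (\<lambda>y. exp (- pi * u * y\<^sup>2) * cos (b * y))"
  note int = gaussian_cos_integral[OF u, of b, folded q_def]
  have int0: "integrable lborel (\<lambda>x. indicator {0..} x *\<^sub>R q x)"
    by (rule integrable_mult_indicator[OF _ int(1)]) auto
  have "has_bochner_integral lborel q (2 *\<^sub>R (\<integral>x. indicator {0..} x *\<^sub>R q x \<partial>lborel))"
    by (rule has_bochner_integral_even_function) (use int0 in \<open>auto simp: has_bochner_integral_integrable q_def\<close>)
  hence half: "(\<integral>x. indicator {0..} x *\<^sub>R q x \<partial>lborel) = exp (- b\<^sup>2 / (4 * pi * u)) / (2 * sqrt u)"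
    using int(2) by (auto dest!: has_bochner_integral_integral_eq)
  have "((\<lambda>N. \<integral>x. indicator {..N} x *\<^sub>R (indicator {0..} x *\<^sub>R q x) \<partial>lborel) \<longlongrightarrow>
     exp (- b\<^sup>2 / (4 * pi * u)) / (2 * sqrt u)) at_top"
    using tendsto_integral_at_top[OF _ int0] half by simp
  moreover have "(\<integral>x. indicator {..N} x *\<^sub>R (indicator {0..} x *\<^sub>R q x) \<partial>lborel) = integral {0..N} q" for N
  proof -
    have "(\<integral>x. indicator {..N} x *\<^sub>R (indicator {0..} x *\<^sub>R q x) \<partial>lborel) = (LINT x:{0..N}|lborel. q x)"
      unfolding set_lebesgue_integral_def
      by (intro Bochner_Integration.integral_cong) (auto split: split_indicator)
    also have "\<dots> = integral {0..N} q"
      by (intro set_borel_integral_eq_integral borel_integrable_atLeastAtMost') (auto simp: q_def intro!: continuous_intros)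
    finally show ?thesis .
  qed
  ultimately show ?thesis unfolding q_def by simp
qed

text \<open>Jacobi's theta series, over all integers, is 1 + 2 * omega u.\<close>

definition omega :: "real \<Rightarrow> real" where
  "omega u = (\<Sum>n. exp (- pi * real (Suc n) ^ 2 * u))"

lemma omega_term_le:
  assumes "u > 0"
  shows "exp (- pi * real n ^ 2 * u) \<le> exp (- pi * u) ^ n"
proof -
  have "real n \<le> real n ^ 2" by (simp add: power2_eq_square mult_le_cancel_left1)
  hence "pi * u * real n \<le> pi * u * real n ^ 2" using assms by (intro mult_left_mono) auto
  thus ?thesis by (simp add: exp_of_nat_mult[symmetric] mult_ac)
qed

lemma summable_gauss:
  assumes "u > 0"
  shows "summable (\<lambda>n. exp (- pi * real n ^ 2 * u))"
proof (rule summable_comparison_test'[of "\<lambda>n. exp (- pi * u) ^ n" 0])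
  show "summable (\<lambda>n. exp (- pi * u) ^ n)" using assms by (intro summable_geometric) auto
qed (use omega_term_le[OF assms] in auto)

text \<open>As the Gaussian \<open>g\<close> is even, the sum of \<open>a n y\<close> over n is the
  sum of g (y + k) over all integers k. This periodisation and the series 1 / sqrt u plus the sum of
  \<open>d n y\<close> have equal cosine coefficients, so they agree on {0..1/2} by completeness of
  the cosines; the value at y = 0 is the claim.\<close>

theorem theta_transformation:
  assumes u: "u > 0"
  shows "1 + 2 * omega u = (1 + 2 * omega (1 / u)) / sqrt u"
proof -
  define g where "g = (\<lambda>y. exp (- pi * u * y\<^sup>2))"
  define v where "v = 1 / u"
  have v: "v > 0" using u by (simp add: v_def)
  define a where "a = (\<lambda>n y. g (y + real n) + g (real n + 1 - y))"
  define d where "d = (\<lambda>n y. 2 * exp (- pi * real (Suc n) ^ 2 * v) * cos (2 * pi * real (Suc n) * y) / sqrt u)"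
  have gmono: "g y \<le> g x" if "0 \<le> x" "x \<le> y" for x y
    using that u by (auto simp: g_def intro!: mult_left_mono power_mono)
  have aM: "\<bar>a n y\<bar> \<le> 2 * exp (- pi * real n ^ 2 * u)" if "y \<in> {0..1/2}" for n y
  proof -
    have "g (y + real n) \<le> g (real n)" "g (real n + 1 - y) \<le> g (real n)"
      using that by (intro gmono; simp)+
    moreover have "g z \<ge> 0" for z by (simp add: g_def)
    moreover have "g (real n) = exp (- pi * real n ^ 2 * u)" by (simp add: g_def mult_ac)
    ultimately show ?thesis unfolding a_def by (smt (verit))
  qed
  have dM: "\<bar>d n y\<bar> \<le> 2 / sqrt u * exp (- pi * real (Suc n) ^ 2 * v)" for n y
    using u mult_left_mono[OF abs_cos_le_one, of "2 * exp (- pi * real (Suc n) ^ 2 * v) / sqrt u" "2 * pi * real (Suc n) * y"]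
    by (simp add: d_def abs_mult)
  have sM: "summable (\<lambda>n. 2 * exp (- pi * real n ^ 2 * u))" by (intro summable_mult summable_gauss u)
  have sd: "summable (\<lambda>n. exp (- pi * real (Suc n) ^ 2 * v))"
    using summable_Suc_iff[of "\<lambda>n. exp (- pi * real n ^ 2 * v)"] summable_gauss[OF v] by simp
  have sdM: "summable (\<lambda>n. 2 / sqrt u * exp (- pi * real (Suc n) ^ 2 * v))" by (intro summable_mult sd)
  have ca: "continuous_on {0..1/2} (a n)" for n by (auto simp: a_def g_def intro!: continuous_intros)
  have cd: "continuous_on {0..1/2} (d n)" for n using u by (auto simp: d_def intro!: continuous_intros)
  define D where "D = (\<lambda>y. (\<Sum>n. a n y) - (1 / sqrt u + (\<Sum>n. d n y)))"
  have "D 0 = 0"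
  proof (rule cosine_orthogonality_unique[of D])
    have c1: "continuous_on {0..1/2} (\<lambda>y. 1::real)" by simp
    have contK: "continuous_on {0..1/2} (\<lambda>y. \<Sum>n. a n y)"
      by (rule sums_integral_M_test(1)[OF sM aM ca c1])
    have contL: "continuous_on {0..1/2} (\<lambda>y. \<Sum>n. d n y)"
      by (rule sums_integral_M_test(1)[OF sdM dM cd c1])
    show "continuous_on {0..1/2} D" unfolding D_def by (intro continuous_intros contK contL)
    fix m :: nat
    define \<phi> where "\<phi> = (\<lambda>y. cos (2 * pi * real m * y))"
    have phi: "continuous_on {0..1/2} \<phi>" unfolding \<phi>_def by (intro continuous_intros)
    define w where "w = exp (- pi * real m ^ 2 * v) / (2 * sqrt u)"
    \<comment> \<open>The two halves of \<open>a n\<close> run over [n, n + 1/2] and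
      [n + 1/2, n + 1] through y + n and n + 1 - y, and \<phi> is unchanged under both
      substitutions; the integrals therefore telescope to that of \<open>q\<close> over the half
      line.\<close>
    have K: "integral {0..1/2} (\<lambda>y. (\<Sum>n. a n y) * \<phi> y) = w"
    proof -
      define q where "q = (\<lambda>y. exp (- pi * u * y\<^sup>2) * cos (2 * pi * real m * y))"
      \<comment> \<open>The base point -1 makes \<open>P\<close> differentiable from both sides at
        0.\<close>
      define P where "P = (\<lambda>z. integral {-1..z} q)"
      have qc: "continuous_on A q" for A unfolding q_def by (intro continuous_intros)
      have P: "(P has_real_derivative q z) (at z)" if "z > -1" for z
      proof -
        have "((\<lambda>x. integral {-1..x} q) has_real_derivative q z) (at z within {-1..z + 1})"
          by (rule integral_has_real_derivative[OF qc]) (use that in auto)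
        thus ?thesis unfolding P_def using that by (subst (asm) at_within_interior) auto
      qed
      have per: "\<phi> (y + real n) = \<phi> y" "\<phi> (real n + 1 - y) = \<phi> y" for y :: real and n :: nat
      proof -
        have 1: "cos (x + 2 * pi * real k) = cos x" for x k
        proof -
          have "2 * pi * real k = 2 * real k * pi" by simp
          thus ?thesis unfolding cos_add by (simp only: cos_2npi sin_2npi)
        qed
        show "\<phi> (y + real n) = \<phi> y" unfolding \<phi>_def using 1[of "2 * pi * real m * y" "m * n"]
          by (simp add: algebra_simps)
        have "\<phi> (real n + 1 - y) = cos (- (2 * pi * real m * y) + 2 * pi * real (m * (n + 1)))"
          unfolding \<phi>_def by (simp add: algebra_simps)
        also have "\<dots> = \<phi> y" unfolding 1 by (simp add: \<phi>_def)
        finally show "\<phi> (real n + 1 - y) = \<phi> y" .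
      qed
      have "integral {0..1/2} (\<lambda>y. a n y * \<phi> y) = P (real n + 1) - P (real n)" for n
      proof -
        have "((\<lambda>y. a n y * \<phi> y) has_integral (P (1/2 + real n) - P (real n + 1 - 1/2)) - (P (0 + real n) - P (real n + 1 - 0))) {0..1/2}"
        proof (rule fundamental_theorem_of_calculus)
          fix y :: real assume y: "y \<in> {0..1/2}"
          have "a n y * \<phi> y = q (y + real n) + q (real n + 1 - y)"
            using per(1)[of y n] per(2)[of n y] by (simp add: a_def g_def q_def \<phi>_def distrib_right)
          moreover have "((\<lambda>y. P (y + real n) - P (real n + 1 - y)) has_real_derivative q (y + real n) + q (real n + 1 - y)) (at y)"
            using y by (auto intro!: derivative_eq_intros DERIV_chain'[OF _ P])
          ultimately show "((\<lambda>y. P (y + real n) - P (real n + 1 - y)) has_vector_derivative a n y * \<phi> y) (at y within {0..1/2})"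
            by (simp add: has_real_derivative_iff_has_vector_derivative[symmetric] has_field_derivative_at_within)
        qed auto
        thus ?thesis by (simp add: integral_unique add.commute)
      qed
      hence "(\<lambda>n. P (real n + 1) - P (real n)) sums integral {0..1/2} (\<lambda>y. (\<Sum>n. a n y) * \<phi> y)"
        using sums_integral_M_test(2)[OF sM aM ca phi] by simp
      hence 1: "(\<lambda>N. P (real N) - P 0) \<longlonglongrightarrow> integral {0..1/2} (\<lambda>y. (\<Sum>n. a n y) * \<phi> y)"
        unfolding sums_def using sum_lessThan_telescope[of "\<lambda>n. P (real n)"] by (simp add: add.commute)
      have Peq: "P (real N) - P 0 = integral {0..real N} q" for N
        unfolding P_def using Henstock_Kurzweil_Integration.integral_combine[of "-1" 0 "real N" q]
        by (simp add: integrable_continuous_interval qc)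
      have "(\<lambda>N. integral {0..real N} q) \<longlonglongrightarrow> exp (- (2 * pi * real m)\<^sup>2 / (4 * pi * u)) / (2 * sqrt u)"
        unfolding q_def by (rule filterlim_compose[OF gaussian_cos_limit[OF u] filterlim_real_sequentially])
      also have "- (2 * pi * real m)\<^sup>2 / (4 * pi * u) = - pi * real m ^ 2 * v"
        using u by (simp add: v_def power2_eq_square field_simps)
      finally show ?thesis using 1 LIMSEQ_unique unfolding Peq w_def by blast
    qed
    have coscos: "integral {0..1/2} (\<lambda>y. cos (2 * pi * real n * y) * \<phi> y) =
      (if n = m then if m = 0 then 1/2 else 1/4 else 0)" for n
    proof -
      have c: "((\<lambda>y. cos (2 * pi * of_int k * y)) has_integral (if k = 0 then 1/2 else 0)) {0..1/2}" for k :: int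
      proof (cases "k = 0")
        case True
        thus ?thesis using has_integral_const_real[of "1::real" 0 "1/2"] by simp
      next
        case False
        have "((\<lambda>y. cos (2 * pi * of_int k * y)) has_integral
          (sin (2 * pi * of_int k * (1/2)) / (2 * pi * of_int k) - sin (2 * pi * of_int k * 0) / (2 * pi * of_int k))) {0..1/2}"
          by (rule fundamental_theorem_of_calculus)
            (use False in \<open>auto simp: has_real_derivative_iff_has_vector_derivative[symmetric] intro!: derivative_eq_intros\<close>)
        moreover have "sin (2 * pi * of_int k * (1/2)) = 0"
          using sin_times_pi_eq_0[of "of_int k"] by (simp add: mult.commute)
        ultimately show ?thesis using False by simp
      qed
      have "((\<lambda>y. (cos (2 * pi * of_int (int n - int m) * y) + cos (2 * pi * of_int (int n + int m) * y)) / 2) has_integral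
         ((if int n - int m = 0 then 1/2 else 0) + (if int n + int m = 0 then 1/2 else 0)) / 2) {0..1/2}"
        by (intro has_integral_divide has_integral_add c)
      also have "(\<lambda>y. (cos (2 * pi * of_int (int n - int m) * y) + cos (2 * pi * of_int (int n + int m) * y)) / 2)
         = (\<lambda>y. cos (2 * pi * real n * y) * \<phi> y)"
        unfolding \<phi>_def cos_times_cos by (simp add: algebra_simps)
      finally show ?thesis by (subst integral_unique) auto
    qed
    have Ls: "integral {0..1/2} (\<lambda>y. (1 / sqrt u + (\<Sum>n. d n y)) * \<phi> y) = w"
    proof -
      \<comment> \<open>\<open>d n\<close> carries the frequency n + 1, so only n = m - 1 survives,
        and for m = 0 none does; that case is supplied by the constant 1 / sqrt u.\<close>
      have e: "integral {0..1/2} (\<lambda>y. d n y * \<phi> y) = (if Suc n = m then w else 0)" for n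
      proof -
        have "(\<lambda>y. d n y * \<phi> y) = (\<lambda>y. 2 * exp (- pi * real (Suc n) ^ 2 * v) / sqrt u * (cos (2 * pi * real (Suc n) * y) * \<phi> y))"
          by (simp add: d_def mult_ac)
        hence "integral {0..1/2} (\<lambda>y. d n y * \<phi> y) =
          2 * exp (- pi * real (Suc n) ^ 2 * v) / sqrt u * integral {0..1/2} (\<lambda>y. cos (2 * pi * real (Suc n) * y) * \<phi> y)"
          by simp
        also have "\<dots> = (if Suc n = m then w else 0)" unfolding coscos by (auto simp: w_def)
        finally show ?thesis .
      qed
      have "(\<lambda>n. if Suc n = m then w else 0) sums integral {0..1/2} (\<lambda>y. (\<Sum>n. d n y) * \<phi> y)"
        using sums_integral_M_test(2)[OF sdM dM cd phi] by (simp add: e)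
      moreover have "(\<lambda>n. if Suc n = m then w else 0) sums (if m = 0 then 0 else w)"
      proof (cases m)
        case (Suc k)
        thus ?thesis using sums_single[of k "\<lambda>_. w"] by (simp add: eq_commute)
      qed auto
      ultimately have 1: "integral {0..1/2} (\<lambda>y. (\<Sum>n. d n y) * \<phi> y) = (if m = 0 then 0 else w)"
        by (rule sums_unique2)
      have 2: "integral {0..1/2} (\<lambda>y. 1 / sqrt u * \<phi> y) = (if m = 0 then w else 0)"
      proof -
        have "integral {0..1/2} \<phi> = (if m = 0 then 1/2 else 0)" using coscos[of 0] by auto
        thus ?thesis by (auto simp: w_def Henstock_Kurzweil_Integration.integral_mult_right)
      qed
      have "integral {0..1/2} (\<lambda>y. (1 / sqrt u + (\<Sum>n. d n y)) * \<phi> y) =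
        integral {0..1/2} (\<lambda>y. 1 / sqrt u * \<phi> y) + integral {0..1/2} (\<lambda>y. (\<Sum>n. d n y) * \<phi> y)"
        unfolding distrib_right
        by (rule Henstock_Kurzweil_Integration.integral_add)
          (intro integrable_continuous_interval continuous_intros contL phi)+
      thus ?thesis unfolding 1 2 by simp
    qed
    have "integral {0..1/2} (\<lambda>y. D y * \<phi> y) = integral {0..1/2} (\<lambda>y. (\<Sum>n. a n y) * \<phi> y) -
      integral {0..1/2} (\<lambda>y. (1 / sqrt u + (\<Sum>n. d n y)) * \<phi> y)"
      unfolding D_def left_diff_distrib
      by (rule Henstock_Kurzweil_Integration.integral_diff)
        (intro integrable_continuous_interval continuous_intros contK contL phi)+
    thus "integral {0..1/2} (\<lambda>y. D y * cos (2 * pi * real m * y)) = 0"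
      using K Ls by (simp add: \<phi>_def)
  qed auto
  moreover have "(\<Sum>n. a n 0) = 1 + 2 * omega u"
  proof -
    have 0: "g (real 0) = 1" by (simp add: g_def)
    have s1: "summable (\<lambda>n. g (real n))" using summable_gauss[OF u] by (simp add: g_def mult_ac)
    have s2: "summable (\<lambda>n. g (real (Suc n)))" using s1 by (subst summable_Suc_iff)
    have "(\<Sum>n. a n 0) = (\<Sum>n. g (real n) + g (real (Suc n)))" by (simp add: a_def add.commute)
    also have "\<dots> = (\<Sum>n. g (real n)) + (\<Sum>n. g (real (Suc n)))" by (rule suminf_add[symmetric, OF s1 s2])
    also have "(\<Sum>n. g (real n)) = (\<Sum>n. g (real (Suc n))) + 1" using suminf_split_head[OF s1] 0 by simp
    also have "(\<Sum>n. g (real (Suc n))) = omega u" by (simp add: g_def omega_def mult_ac)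
    finally show ?thesis by simp
  qed
  moreover have "(\<Sum>n. d n 0) = 2 * omega (1 / u) / sqrt u"
  proof -
    have "(\<Sum>n. d n 0) = (\<Sum>n. 2 / sqrt u * exp (- pi * real (Suc n) ^ 2 * v))" by (simp add: d_def)
    also have "\<dots> = 2 / sqrt u * (\<Sum>n. exp (- pi * real (Suc n) ^ 2 * v))" by (rule suminf_mult[OF sd])
    finally show ?thesis by (simp add: omega_def v_def)
  qed
  ultimately show ?thesis by (simp add: D_def add_divide_distrib)
qed

section \<open>Decay of omega and its Mellin integral from 1 to infinity\<close>

lemma omega_continuous_on:
  assumes e: "e > 0" shows "continuous_on {e..} omega"
proof -
  have ul: "uniform_limit {e..} (\<lambda>N u. \<Sum>n<N. exp (- pi * real (Suc n) ^ 2 * u)) omega sequentially"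
    unfolding omega_def[abs_def]
  proof (rule Weierstrass_m_test)
    show "summable (\<lambda>n. exp (- pi * real (Suc n) ^ 2 * e))"
      using summable_Suc_iff[of "\<lambda>n. exp (- pi * real n ^ 2 * e)"] summable_gauss[OF e] by simp
    show "norm (exp (- pi * real (Suc n) ^ 2 * u)) \<le> exp (- pi * real (Suc n) ^ 2 * e)" if "u \<in> {e..}" for n u
      using that by (simp del: of_nat_Suc)
  qed
  show ?thesis
    by (rule uniform_limit_theorem[OF _ ul]) (auto intro!: always_eventually continuous_intros)
qed

lemma omega_summable: "u > 0 \<Longrightarrow> summable (\<lambda>n. exp (- pi * real (Suc n) ^ 2 * u))"
  using summable_Suc_iff[of "\<lambda>n. exp (- pi * real n ^ 2 * u)"] summable_gauss[of u] by simp

lemma omega_nonneg: "u > 0 \<Longrightarrow> omega u \<ge> 0"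
  unfolding omega_def by (intro suminf_nonneg omega_summable) auto

text \<open>Comparison with a geometric series of ratio exp (- pi u), which is at most 1/2 for u >=
  1.\<close>

lemma omega_le:
  assumes "u \<ge> 1" shows "omega u \<le> 2 * exp (- pi * u)"
proof -
  define q where "q = exp (- pi * u)"
  have "q \<le> exp (- 1)" using assms pi_gt3 mult_mono[of 1 pi 1 u] by (simp add: q_def)
  also have "exp (- 1) \<le> (1/2 :: real)" using exp_ge_add_one_self[of 1] by (simp add: exp_minus divide_simps)
  finally have q: "0 < q" "q \<le> 1/2" by (auto simp: q_def)
  have "omega u \<le> (\<Sum>n. q ^ Suc n)" unfolding omega_def
  proof (rule suminf_le)
    show "exp (- pi * real (Suc n) ^ 2 * u) \<le> q ^ Suc n" for n
      using omega_term_le[of u "Suc n"] assms unfolding q_def by simp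
    show "summable (\<lambda>n. q ^ Suc n)" using q by (simp only: summable_Suc_iff) (intro summable_geometric, simp)
  qed (use assms omega_summable in auto)
  also have "\<dots> = q * (1 / (1 - q))"
    using q by (subst power_Suc, subst suminf_mult) (auto intro!: summable_geometric simp: suminf_geometric)
  also have "\<dots> \<le> q * 2" using q by (intro mult_left_mono) (auto simp: divide_simps)
  finally show ?thesis by (simp add: q_def)
qed

text \<open>The left side is largest at v = R; the factor exp (- R) of the maximum is
  dropped.\<close>

lemma powr_exp_bound:
  fixes v R :: real
  assumes "v > 0" "R > 0"
  shows "v powr R * exp (- v) \<le> R powr R"
proof -
  have "ln (v / R) \<le> v / R - 1" using assms by (intro ln_le_minus_one) auto
  hence "R * ln v - v \<le> R * ln R - R" using assms by (simp add: ln_div field_simps)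
  hence "R * ln v - v \<le> R * ln R" using assms by simp
  hence "exp (R * ln v - v) \<le> exp (R * ln R)" by simp
  thus ?thesis using assms by (simp add: powr_def exp_diff exp_minus divide_inverse)
qed

text \<open>The Mellin integral over \<open>[1, \<infinity>)\<close> is cut into unit intervals, so that holomorphy follows
  from uniform convergence of a series.\<close>

definition theta_mellin_kernel :: "complex \<Rightarrow> real \<Rightarrow> complex" where
  "theta_mellin_kernel w u = of_real (omega u * u powr (-3/4)) * (exp (of_real (ln u / 2) * w) + exp (- (of_real (ln u / 2) * w)))"

definition theta_mellin_piece :: "nat \<Rightarrow> complex \<Rightarrow> complex" where
  "theta_mellin_piece j w = integral {real j + 1..real j + 2} (theta_mellin_kernel w)"

text \<open>For w = s - 1/2 this is Riemann's integral of omega u * (u powr (s/2 - 1) + u powr (-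
  s/2 - 1/2)) over u >= 1. Centring at 1/2 turns the functional equation into evenness in w.\<close>

definition theta_mellin :: "complex \<Rightarrow> complex" where "theta_mellin w = (\<Sum>j. theta_mellin_piece j w)"

lemma theta_mellin_kernel_continuous: "continuous_on {real j + 1..real j + 2} (theta_mellin_kernel w)"
proof -
  have "continuous_on {real j + 1..real j + 2} omega"
    by (rule continuous_on_subset[OF omega_continuous_on[of 1]]) auto
  thus ?thesis unfolding theta_mellin_kernel_def[abs_def] by (intro continuous_intros) auto
qed

text \<open>On the j-th interval pi > 3 gives \<open>omega\<close> the decay exp (-3 (j + 1)), split
  as exp (-(j + 2)) times exp (-(2j + 1)): the first factor tames (j + 2) powr R, the second leaves
  a geometric series. The bound is uniform over norm w <= 2R.\<close>

lemma theta_mellin_piece_bound: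
  assumes R: "norm w / 2 \<le> R" "R > 0"
  shows "norm (theta_mellin_piece j w) \<le> 4 * R powr R * (1/2) ^ j"
proof -
  define x where "x = real j"
  have x: "x \<ge> 0" by (simp add: x_def)
  have "norm (theta_mellin_kernel w u) \<le> 4 * R powr R * (1/2) ^ j" if u: "u \<in> {x + 1..x + 2}" for u
  proof -
    have u1: "u \<ge> 1" using u x by simp
    have lnu: "0 \<le> ln u" "ln u \<le> ln (x + 2)" using u u1 by auto
    have ex: "norm (exp z) \<le> (x + 2) powr R" if "norm z \<le> ln u / 2 * norm w" for z :: complex
    proof -
      have "Re z \<le> norm z" by (rule complex_Re_le_cmod)
      also have "\<dots> \<le> ln u * (norm w / 2)" using that by simp
      also have "\<dots> \<le> ln (x + 2) * R" using lnu R by (intro mult_mono) auto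
      finally show ?thesis using x by (simp add: powr_def mult.commute)
    qed
    have "norm (exp (of_real (ln u / 2) * w) + exp (- (of_real (ln u / 2) * w))) \<le> 2 * (x + 2) powr R"
      using ex[of "of_real (ln u / 2) * w"] ex[of "- (of_real (ln u / 2) * w)"] lnu
        norm_triangle_ineq[of "exp (of_real (ln u / 2) * w)" "exp (- (of_real (ln u / 2) * w))"]
      by (simp add: norm_mult norm_divide)
    moreover have "norm (complex_of_real (omega u * u powr (-3/4))) \<le> 2 * exp (- 3 * (x + 1))"
    proof -
      have "u powr (-3/4) \<le> u powr 0" using u1 by (intro powr_mono) auto
      hence "omega u * u powr (-3/4) \<le> omega u * 1" using u1 omega_nonneg[of u] by (intro mult_left_mono) auto
      also have "\<dots> \<le> 2 * exp (- pi * u)" using omega_le[OF u1] by simp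
      also have "\<dots> \<le> 2 * exp (- 3 * (x + 1))" using mult_mono[of 3 pi "x + 1" u] u x pi_gt3 by simp
      finally show ?thesis using u1 omega_nonneg[of u] unfolding norm_of_real by simp
    qed
    ultimately have "norm (theta_mellin_kernel w u) \<le> 2 * exp (- 3 * (x + 1)) * (2 * (x + 2) powr R)"
      unfolding theta_mellin_kernel_def norm_mult by (intro mult_mono) auto
    also have "\<dots> = 4 * ((x + 2) powr R * exp (- (x + 2))) * exp (- (2 * x + 1))"
      by (simp add: exp_add[symmetric] mult_ac)
    also have "\<dots> \<le> 4 * R powr R * (1/2) ^ j"
    proof (intro mult_mono)
      show "(x + 2) powr R * exp (- (x + 2)) \<le> R powr R" using x R by (intro powr_exp_bound) auto
      have "exp (- (2 * x + 1)) \<le> exp (- x)" using x by simp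
      also have "\<dots> = exp (- 1) ^ j" by (simp add: x_def exp_of_nat_mult[symmetric])
      also have "\<dots> \<le> (1/2) ^ j"
        using exp_ge_add_one_self[of 1] by (intro power_mono) (auto simp: exp_minus divide_simps)
      finally show "exp (- (2 * x + 1)) \<le> (1/2) ^ j" .
    qed (use x R in auto)
    finally show ?thesis .
  qed
  hence "norm (integral {x + 1..x + 2} (theta_mellin_kernel w)) \<le> 4 * R powr R * (1/2) ^ j * ((x + 2) - (x + 1))"
    using theta_mellin_kernel_continuous[of j w] by (intro integral_bound) (auto simp: x_def)
  thus ?thesis by (simp add: theta_mellin_piece_def x_def)
qed

lemma theta_mellin_piece_holomorphic: "theta_mellin_piece j holomorphic_on UNIV"
proof -
  define I where "I = cbox (real j + 1) (real j + 2)"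
  have om: "continuous_on I omega" unfolding I_def
    by (rule continuous_on_subset[OF omega_continuous_on[of 1]]) auto
  define fx where "fx = (\<lambda>w u. of_real (omega u * u powr (-3/4)) *
    (of_real (ln u / 2) * exp (of_real (ln u / 2) * w) - of_real (ln u / 2) * exp (- (of_real (ln u / 2) * w))) :: complex)"
  have "(\<lambda>w. integral (cbox (real j + 1) (real j + 2)) (theta_mellin_kernel w)) holomorphic_on UNIV"
  proof (rule leibniz_rule_holomorphic[where fx = fx])
    show "((\<lambda>w. theta_mellin_kernel w u) has_field_derivative fx w u) (at w within UNIV)" for w u
      unfolding theta_mellin_kernel_def fx_def by (auto intro!: derivative_eq_intros simp: mult_ac)
    show "theta_mellin_kernel w integrable_on cbox (real j + 1) (real j + 2)" for w
      using theta_mellin_kernel_continuous[of j w] by (auto intro: integrable_continuous_interval)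
    have "continuous_on (UNIV \<times> I) (\<lambda>x. omega (snd x))"
      by (rule continuous_on_compose2[OF om continuous_on_snd[OF continuous_on_id]]) auto
    thus "continuous_on (UNIV \<times> cbox (real j + 1) (real j + 2)) (\<lambda>(x, t). fx x t)"
      unfolding fx_def case_prod_unfold I_def by (intro continuous_intros) auto
  qed auto
  thus ?thesis unfolding theta_mellin_piece_def[abs_def] by simp
qed

lemma theta_mellin_summable: "summable (\<lambda>j. theta_mellin_piece j w)"
proof (rule summable_comparison_test'[of "\<lambda>j. 4 * (norm w + 1) powr (norm w + 1) * (1/2) ^ j" 0])
  show "summable (\<lambda>j. 4 * (norm w + 1) powr (norm w + 1) * (1/2::real) ^ j)"
    by (intro summable_mult summable_geometric) auto
qed (use theta_mellin_piece_bound[of w "norm w + 1"] in \<open>auto simp: add_nonneg_pos\<close>)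

lemma theta_mellin_bound:
  assumes R: "norm w / 2 \<le> R" "R > 0"
  shows "norm (theta_mellin w) \<le> 8 * R powr R"
proof -
  have s: "summable (\<lambda>j. 4 * R powr R * (1/2::real) ^ j)" by (intro summable_mult summable_geometric) auto
  have "norm (theta_mellin w) \<le> (\<Sum>j. 4 * R powr R * (1/2) ^ j)" unfolding theta_mellin_def
    by (rule norm_suminf_le[OF theta_mellin_piece_bound[OF R] s])
  also have "\<dots> = 4 * R powr R * 2" by (subst suminf_mult) (auto intro!: summable_geometric simp: suminf_geometric)
  finally show ?thesis by simp
qed

lemma theta_mellin_holomorphic: "theta_mellin holomorphic_on UNIV"
proof (rule holomorphic_uniform_sequence[where f = "\<lambda>N w. \<Sum>j<N. theta_mellin_piece j w"])
  show "(\<lambda>w. \<Sum>j<N. theta_mellin_piece j w) holomorphic_on UNIV" for N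
    by (intro holomorphic_intros theta_mellin_piece_holomorphic)
  fix x :: complex
  have "uniform_limit (cball x 1) (\<lambda>N w. \<Sum>j<N. theta_mellin_piece j w) theta_mellin sequentially"
    unfolding theta_mellin_def[abs_def]
  proof (rule Weierstrass_m_test)
    define R where "R = norm x + 2"
    have R: "R > 0" by (simp add: R_def add_nonneg_pos)
    show "summable (\<lambda>j. 4 * R powr R * (1/2::real) ^ j)" by (intro summable_mult summable_geometric) auto
    fix j w assume w: "w \<in> cball x 1"
    have "norm w \<le> norm x + 1" using w norm_triangle_ineq2[of w x] by (simp add: dist_norm norm_minus_commute)
    thus "norm (theta_mellin_piece j w) \<le> 4 * R powr R * (1/2) ^ j"
      using R norm_ge_zero[of x] unfolding R_def by (intro theta_mellin_piece_bound) linarith+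
  qed
  thus "\<exists>d. 0 < d \<and> cball x d \<subseteq> UNIV \<and> uniform_limit (cball x d) (\<lambda>N w. \<Sum>j<N. theta_mellin_piece j w) theta_mellin sequentially"
    by (intro exI[of _ 1]) auto
qed auto

lemma theta_mellin_minus: "theta_mellin (- w) = theta_mellin w"
  by (simp add: theta_mellin_def theta_mellin_piece_def theta_mellin_kernel_def[abs_def] add.commute)

lemma theta_mellin_cnj: "theta_mellin (cnj w) = cnj (theta_mellin w)"
proof -
  have "theta_mellin_piece j (cnj w) = cnj (theta_mellin_piece j w)" for j
  proof -
    have "theta_mellin_kernel (cnj w) = (\<lambda>u. cnj (theta_mellin_kernel w u))" by (auto simp: theta_mellin_kernel_def exp_cnj)
    thus ?thesis unfolding theta_mellin_piece_def by (simp add: integral_cnj)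
  qed
  moreover have "(\<lambda>j. cnj (theta_mellin_piece j w)) sums cnj (theta_mellin w)"
    unfolding sums_cnj theta_mellin_def using theta_mellin_summable by (rule summable_sums)
  ultimately show ?thesis unfolding theta_mellin_def[of "cnj w"] by (simp add: sums_iff)
qed

text \<open>Riemann's xi function s (s - 1) / 2 * pi powr (- s/2) * Gamma (s/2) * zeta s, in a form
  that is visibly entire: the pole terms 1 / (s - 1) - 1 / s of the completed zeta function,
  multiplied by s (s - 1), give the summand 1.\<close>

definition xi_fun :: "complex \<Rightarrow> complex" where
  "xi_fun s = (1 + s * (s - 1) * theta_mellin (s - 1/2)) / 2"

lemma xi_holomorphic: "xi_fun holomorphic_on A"
proof -
  have "(theta_mellin \<circ> (\<lambda>s. s - 1/2)) holomorphic_on UNIV"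
    by (rule holomorphic_on_compose[OF _ holomorphic_on_subset[OF theta_mellin_holomorphic]]) (auto intro!: holomorphic_intros)
  hence "xi_fun holomorphic_on UNIV" unfolding xi_fun_def[abs_def] o_def by (intro holomorphic_intros) auto
  thus ?thesis using holomorphic_on_subset by blast
qed

lemma xi_reflect: "xi_fun (1 - s) = xi_fun s"
  using theta_mellin_minus[of "s - 1/2"] by (simp add: xi_fun_def algebra_simps)

lemma xi_cnj: "xi_fun (cnj s) = cnj (xi_fun s)"
  using theta_mellin_cnj[of "s - 1/2"] by (simp add: xi_fun_def)

lemma xi_0: "xi_fun 0 = 1/2" and xi_1: "xi_fun 1 = 1/2" by (simp_all add: xi_fun_def)

text \<open>The Mellin integral grows at most like X powr X, and ln X <= 2 sqrt X turns X ln X into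
  2 X^(3/2). In the constant 10, the polynomial and Mellin factors take 4, and 6 absorbs the
  numerical factors.\<close>

lemma xi_growth: "norm (xi_fun s) \<le> exp (10 * (1 + norm s) powr (3/2))"
proof -
  define X where "X = 1 + norm s"
  define Y where "Y = X powr (3/2)"
  have X: "X \<ge> 1" by (simp add: X_def)
  have XY: "X \<le> Y" using powr_mono[of 1 "3/2" X] X by (simp add: Y_def)
  have "norm (theta_mellin (s - 1/2)) \<le> 8 * X powr X"
  proof (rule theta_mellin_bound)
    have "norm (s - 1/2) \<le> norm s + 1/2" using norm_triangle_ineq4[of s "1/2"] by simp
    thus "norm (s - 1/2) / 2 \<le> X" using X norm_ge_zero[of s] unfolding X_def by linarith
  qed (use X in auto)
  also have "X powr X \<le> exp (2 * Y)"
  proof -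
    have "ln X = 2 * ln (sqrt X)" using X by (simp add: ln_sqrt)
    also have "ln (sqrt X) \<le> sqrt X" using X ln_le_minus_one[of "sqrt X"] by simp
    finally have "X * ln X \<le> X * (2 * sqrt X)" using X by (intro mult_left_mono) auto
    also have "\<dots> = 2 * Y"
    proof -
      have "Y = X powr 1 * X powr (1/2)" unfolding Y_def powr_add[symmetric] by simp
      thus ?thesis using X by (simp add: powr_half_sqrt)
    qed
    finally show ?thesis using X by (simp add: powr_def)
  qed
  finally have A: "norm (theta_mellin (s - 1/2)) \<le> 8 * exp (2 * Y)" by simp
  have "norm (s * (s - 1)) \<le> X * X"
    using norm_triangle_ineq4[of s 1] by (simp add: norm_mult X_def mult_mono)
  also have "\<dots> \<le> exp Y * exp Y"
  proof -
    have "X \<le> exp Y" using exp_ge_add_one_self[of Y] XY by linarith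
    thus ?thesis using X by (intro mult_mono) auto
  qed
  finally have "norm (s * (s - 1) * theta_mellin (s - 1/2)) \<le> exp Y * exp Y * (8 * exp (2 * Y))"
    unfolding norm_mult[of "s * (s - 1)"] by (intro mult_mono A) auto
  also have "\<dots> = 8 * exp (4 * Y)" by (simp add: exp_add[symmetric])
  finally have "norm (xi_fun s) \<le> (1 + 8 * exp (4 * Y)) / 2"
    using norm_triangle_ineq[of 1 "s * (s - 1) * theta_mellin (s - 1/2)"] by (simp add: xi_fun_def norm_divide)
  also have "\<dots> \<le> 5 * exp (4 * Y)"
  proof -
    have *: "(1 + 8 * e) / 2 \<le> 5 * e" if "1 \<le> e" for e :: real using that by (simp add: field_simps)
    show ?thesis by (rule *) (use X XY in simp)
  qed
  also have "\<dots> \<le> exp (6 * Y) * exp (4 * Y)"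
  proof (intro mult_right_mono)
    have "1 + 6 * Y \<le> exp (6 * Y)" by (rule exp_ge_add_one_self)
    thus "5 \<le> exp (6 * Y)" using X XY by linarith
  qed auto
  also have "\<dots> = exp (10 * Y)" by (simp add: exp_add[symmetric])
  finally show ?thesis by (simp add: Y_def X_def)
qed

section \<open>The zeta function and its functional equation\<close>

text \<open>Nonnegative integrals are used so that the series defining \<open>omega\<close> can
  later be integrated term by term without a separate domination argument.\<close>

lemma Gamma_scaled_nn_integral:
  fixes a c :: real
  assumes a: "a > 0" and c: "c > 0"
  shows "(\<integral>\<^sup>+u. ennreal (indicator {0<..} u * (exp (- c * u) * u powr (a - 1))) \<partial>lborel) = ennreal (Gamma a * c powr - a)"
proof -
  define h where "h = (\<lambda>t. indicator {0..} t * t powr (a - 1) / exp t)"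
  define I where "I = (\<integral>\<^sup>+u. ennreal (indicator {0<..} u * (exp (- c * u) * u powr (a - 1))) \<partial>lborel)"
  have eq: "ennreal (h (0 + c * u)) = ennreal (c powr (a - 1)) * ennreal (indicator {0<..} u * (exp (- c * u) * u powr (a - 1)))" for u
  proof -
    have "h (0 + c * u) = c powr (a - 1) * (indicator {0<..} u * (exp (- c * u) * u powr (a - 1)))"
    proof (cases "u > 0")
      case True
      thus ?thesis using c by (simp add: h_def powr_mult exp_minus divide_inverse)
    next
      case False
      thus ?thesis using c by (cases "u = 0") (auto simp: h_def zero_le_mult_iff)
    qed
    thus ?thesis by (simp add: ennreal_mult')
  qed
  have "ennreal (Gamma a) = (\<integral>\<^sup>+t. ennreal (h t) \<partial>lborel)"
    using Gamma_conv_nn_integral_real[OF a] by (simp add: h_def)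
  also have "\<dots> = \<bar>c\<bar> * (\<integral>\<^sup>+u. ennreal (h (0 + c * u)) \<partial>lborel)"
    by (rule nn_integral_real_affine) (use c in \<open>auto simp: h_def\<close>)
  also have "\<dots> = ennreal c * (ennreal (c powr (a - 1)) * I)"
    unfolding eq I_def using c by (subst nn_integral_cmult) auto
  also have "\<dots> = ennreal (c powr a) * I"
  proof -
    have "c * c powr (a - 1) = c powr a" using c by (simp add: powr_diff)
    thus ?thesis using c by (simp add: mult.assoc[symmetric] ennreal_mult[symmetric])
  qed
  finally have G: "ennreal (Gamma a) = ennreal (c powr a) * I" .
  have "ennreal (Gamma a * c powr - a) = ennreal (c powr - a) * ennreal (Gamma a)"
    using Gamma_real_pos[OF a] by (simp add: ennreal_mult mult.commute)
  also have "\<dots> = ennreal (c powr - a * c powr a) * I"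
    unfolding G by (simp add: mult.assoc[symmetric] ennreal_mult[symmetric])
  also have "c powr - a * c powr a = 1" using c by (simp add: powr_minus)
  finally show ?thesis by (simp add: I_def)
qed

section \<open>Mellin transform of omega for real exponents\<close>

lemma omega_measurable [measurable]: "omega \<in> borel_measurable borel"
  unfolding omega_def[abs_def] by measurable

text \<open>Each term of \<open>omega\<close> is a scaled Gamma integral with c = pi n^2. All terms
  are nonnegative, so sum and integral commute, and convergence of the sum of n powr (-2a) for 2a >
  1 yields integrability as well.\<close>

lemma Mellin_omega:
  fixes a :: real
  assumes a: "a > 1/2"
  defines "T \<equiv> Gamma a * pi powr - a * (\<Sum>n. real (Suc n) powr (- 2 * a))"
  shows "has_bochner_integral lborel (\<lambda>u. indicator {0<..} u * (omega u * u powr (a - 1))) T"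
proof (rule has_bochner_integral_nn_integral)
  have sm: "summable (\<lambda>n. real (Suc n) powr (- 2 * a))"
    using a by (subst summable_Suc_iff) (simp add: summable_real_powr_iff)
  have eq: "Gamma a * (pi * real (Suc n) ^ 2) powr - a = Gamma a * pi powr - a * real (Suc n) powr (- 2 * a)" for n
  proof -
    have "real (Suc n) ^ 2 = real (Suc n) powr 2" by (rule powr_numeral[symmetric]) simp
    thus ?thesis by (simp only: powr_mult powr_powr) simp
  qed
  have sm': "summable (\<lambda>n. Gamma a * (pi * real (Suc n) ^ 2) powr - a)"
  proof -
    show ?thesis unfolding eq by (intro summable_mult sm)
  qed
  have Teq: "T = (\<Sum>n. Gamma a * (pi * real (Suc n) ^ 2) powr - a)"
  proof -
    show ?thesis unfolding T_def eq suminf_mult[OF sm] ..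
  qed
  have G: "Gamma a > 0" using a by (intro Gamma_real_pos) auto
  show "T \<ge> 0" unfolding Teq using G by (intro suminf_nonneg sm') auto
  show "AE u in lborel. 0 \<le> indicator {0<..} u * (omega u * u powr (a - 1))"
    by (auto intro!: AE_I2 mult_nonneg_nonneg omega_nonneg split: split_indicator)
  have "(\<integral>\<^sup>+ u. ennreal (indicator {0<..} u * (omega u * u powr (a - 1))) \<partial>lborel)
     = (\<integral>\<^sup>+ u. (\<Sum>n. ennreal (indicator {0<..} u * (exp (- (pi * real (Suc n) ^ 2) * u) * u powr (a - 1)))) \<partial>lborel)"
  proof (rule nn_integral_cong)
    fix u :: real
    show "ennreal (indicator {0<..} u * (omega u * u powr (a - 1))) =
       (\<Sum>n. ennreal (indicator {0<..} u * (exp (- (pi * real (Suc n) ^ 2) * u) * u powr (a - 1))))"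
    proof (cases "u > 0")
      case True
      have s: "summable (\<lambda>n. exp (- (pi * real (Suc n) ^ 2) * u))"
        using omega_summable[OF True] by (simp only: mult_minus_left)
      have "(\<Sum>n. ennreal (exp (- (pi * real (Suc n) ^ 2) * u) * u powr (a - 1))) =
         ennreal (\<Sum>n. exp (- (pi * real (Suc n) ^ 2) * u) * u powr (a - 1))"
        by (rule suminf_ennreal2[OF _ summable_mult2[OF s]]) simp
      also have "(\<Sum>n. exp (- (pi * real (Suc n) ^ 2) * u) * u powr (a - 1)) = omega u * u powr (a - 1)"
        using suminf_mult2[OF s, of "u powr (a - 1)"] by (simp add: omega_def)
      finally show ?thesis using True by simp
    qed auto
  qed
  also have "\<dots> = (\<Sum>n. (\<integral>\<^sup>+ u. ennreal (indicator {0<..} u * (exp (- (pi * real (Suc n) ^ 2) * u) * u powr (a - 1))) \<partial>lborel))"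
    by (rule nn_integral_suminf) auto
  also have "\<dots> = (\<Sum>n. ennreal (Gamma a * (pi * real (Suc n) ^ 2) powr - a))"
    using a by (intro suminf_cong Gamma_scaled_nn_integral) auto
  also have "\<dots> = ennreal T" unfolding Teq using G by (intro suminf_ennreal2 sm') auto
  finally show "(\<integral>\<^sup>+ u. ennreal (indicator {0<..} u * (omega u * u powr (a - 1))) \<partial>lborel) = ennreal T" .
qed measurable

lemma omega_inverse:
  assumes "u > 0"
  shows "omega u = omega (1 / u) / sqrt u + 1 / (2 * sqrt u) - 1 / 2"
  using theta_transformation[OF assms] assms by (simp add: field_simps)

text \<open>The substitution v = 1 / u together with the theta transformation folds the range below
  1 onto the range above 1; the elementary terms of \<open>omega_inverse\<close> integrate to the
  last bracket. The cut at 1/N keeps all integrals proper, and the antiderivative \<open>G\<close>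
  performs the substitution.\<close>

lemma Mellin_lower_half:
  fixes a N :: real
  assumes a: "a > 1/2" and N: "N \<ge> 1"
  shows "integral {1/N..1} (\<lambda>u. omega u * u powr (a - 1)) =
    integral {1..N} (\<lambda>v. omega v * v powr (- a - 1/2)) +
     ((1 - (1/N) powr (a - 1/2)) / (a - 1/2) - (1 - (1/N) powr a) / a) / 2"
proof -
  define q where "q = (\<lambda>v. omega v * v powr (- a - 1/2))"
  \<comment> \<open>Any base point in (0, 1) would serve: it must lie below 1 for two-sided
    differentiability at v = 1, and \<open>omega\<close> must be continuous from there on.\<close>
  define P where "P = (\<lambda>v. integral {1/2..v} q)"
  have qc: "continuous_on {1/2..b} q" for b unfolding q_def
    by (intro continuous_intros continuous_on_subset[OF omega_continuous_on[of "1/2"]]) auto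
  have P: "(P has_real_derivative q z) (at z)" if "z > 1/2" for z
  proof -
    have "((\<lambda>x. integral {1/2..x} q) has_real_derivative q z) (at z within {1/2..z + 1})"
      by (rule integral_has_real_derivative[OF qc]) (use that in auto)
    thus ?thesis unfolding P_def using that by (subst (asm) at_within_interior) auto
  qed
  define G where "G = (\<lambda>u. - P (1 / u) + (u powr (a - 1/2) / (a - 1/2) - u powr a / a) / 2)"
  have "((\<lambda>u. omega u * u powr (a - 1)) has_integral (G 1 - G (1/N))) {1/N..1}"
  proof (rule fundamental_theorem_of_calculus)
    fix u assume u: "u \<in> {1/N..1}"
    have u0: "u > 0" using u N by (auto intro: less_le_trans[of _ "1/N"])
    have inv: "1 / u > 1/2" using u u0 by (simp add: field_simps)
    have "(G has_real_derivative q (1 / u) / u\<^sup>2 + (u powr (a - 1/2 - 1) - u powr (a - 1)) / 2) (at u)"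
      unfolding G_def using u0 a inv
      by (auto intro!: derivative_eq_intros DERIV_chain'[OF _ P] simp: power2_eq_square)
    also have "q (1 / u) / u\<^sup>2 = omega (1 / u) * u powr (a - 3/2)"
    proof -
      have 1: "(1 / u) powr (- a - 1/2) = u powr (a + 1/2)"
      proof -
        have "u powr (a + 1/2) = u powr - (- a - 1/2)" by (simp add: add.commute)
        also have "\<dots> = 1 / u powr (- a - 1/2)" by (rule powr_minus_divide)
        finally show ?thesis using u0 by (simp add: powr_divide)
      qed
      have 2: "u powr (a + 1/2) / u\<^sup>2 = u powr (a - 3/2)"
        using u0 powr_diff[of u "a + 1/2" 2] by (simp add: powr_numeral)
      show ?thesis unfolding q_def 1 times_divide_eq_right[symmetric] 2 ..
    qed
    also have "omega (1 / u) * u powr (a - 3/2) + (u powr (a - 1/2 - 1) - u powr (a - 1)) / 2 = omega u * u powr (a - 1)"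
    proof -
      have e: "u powr (a - 3/2) = u powr (a - 1) / sqrt u"
        using u0 powr_diff[of u "a - 1" "1/2"] by (simp add: powr_half_sqrt)
      have e2: "u powr (a - 1/2 - 1) = u powr (a - 1) / sqrt u" using e by simp
      show ?thesis unfolding omega_inverse[OF u0] e e2 using u0 by (simp add: field_simps)
    qed
    finally show "(G has_vector_derivative omega u * u powr (a - 1)) (at u within {1/N..1})"
      by (simp add: has_real_derivative_iff_has_vector_derivative[symmetric] has_field_derivative_at_within)
  qed (use N in auto)
  hence "integral {1/N..1} (\<lambda>u. omega u * u powr (a - 1)) = G 1 - G (1/N)" by (rule integral_unique)
  also have "\<dots> = (P N - P 1) + ((1 - (1/N) powr (a - 1/2)) / (a - 1/2) - (1 - (1/N) powr a) / a) / 2"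
    by (simp add: G_def diff_divide_distrib)
  also have "P N - P 1 = integral {1..N} q" unfolding P_def
    using Henstock_Kurzweil_Integration.integral_combine[of "1/2" 1 N q] N
    by (simp add: integrable_continuous_interval qc)
  finally show ?thesis by (simp add: q_def)
qed

text \<open>For real s the kernel is real: multiplying u powr (-3/4) by u powr (s/2 - 1/4) and by u
  powr (1/4 - s/2) gives the two exponents of Riemann's integral, and the unit intervals add up to
  {1..n + 1}.\<close>

lemma theta_mellin_of_real_limit:
  fixes s :: real
  shows "(\<lambda>n. complex_of_real (integral {1..real n + 1} (\<lambda>u. omega u * (u powr (s/2 - 1) + u powr (- s/2 - 1/2))))) \<longlonglongrightarrow> theta_mellin (of_real s - 1/2)"
proof -
  define q where "q = (\<lambda>u. omega u * (u powr (s/2 - 1) + u powr (- s/2 - 1/2)))"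
  have qc: "continuous_on {1..b} q" for b unfolding q_def
    by (intro continuous_intros continuous_on_subset[OF omega_continuous_on[of 1]]) auto
  have qi: "q integrable_on {c..b}" if "c \<ge> 1" for b c
    by (rule integrable_continuous_interval[OF continuous_on_subset[OF qc[of b]]]) (use that in auto)
  have kern: "theta_mellin_kernel (of_real s - 1/2) u = of_real (q u)" if "u \<ge> 1" for u
  proof -
    have e: "complex_of_real (ln u / 2) * (of_real s - 1/2) = of_real (ln u * (s - 1/2) / 2)"
      by (simp add: field_simps)
    have "theta_mellin_kernel (of_real s - 1/2) u = of_real (omega u * u powr (-3/4) * (exp (ln u * (s - 1/2) / 2) + exp (- (ln u * (s - 1/2) / 2))))"
      unfolding theta_mellin_kernel_def e
      by (simp only: exp_of_real of_real_minus[symmetric] of_real_add[symmetric] of_real_mult[symmetric])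
    also have "exp (ln u * (s - 1/2) / 2) = u powr (s/2 - 1/4)" using that by (simp add: powr_def field_simps)
    also have "exp (- (ln u * (s - 1/2) / 2)) = u powr (- s/2 + 1/4)" using that by (simp add: powr_def field_simps)
    also have "omega u * u powr (-3/4) * (u powr (s/2 - 1/4) + u powr (- s/2 + 1/4)) = q u"
    proof -
      have "u powr (-3/4) * u powr (s/2 - 1/4) = u powr (s/2 - 1)" "u powr (-3/4) * u powr (- s/2 + 1/4) = u powr (- s/2 - 1/2)"
        by (subst powr_add[symmetric], rule arg_cong[where f = "\<lambda>y. u powr y"], simp)+
      thus ?thesis by (simp add: q_def mult.assoc distrib_left)
    qed
    finally show ?thesis .
  qed
  have theta_mellin_piece: "theta_mellin_piece j (of_real s - 1/2) = of_real (integral {real j + 1..real j + 2} q)" for j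
  proof -
    have "((\<lambda>u. complex_of_real (q u)) has_integral of_real (integral {real j + 1..real j + 2} q)) {real j + 1..real j + 2}"
      by (intro has_integral_of_real integrable_integral qi) auto
    hence "(theta_mellin_kernel (of_real s - 1/2) has_integral of_real (integral {real j + 1..real j + 2} q)) {real j + 1..real j + 2}"
      by (rule has_integral_eq[rotated]) (use kern in auto)
    thus ?thesis unfolding theta_mellin_piece_def by (rule integral_unique)
  qed
  have part: "(\<Sum>j<n. integral {real j + 1..real j + 2} q) = integral {1..real n + 1} q" for n
  proof (induction n)
    case (Suc n)
    have "integral {1..real n + 1} q + integral {real n + 1..real n + 2} q = integral {1..real n + 2} q"
      by (rule Henstock_Kurzweil_Integration.integral_combine) (auto intro: qi)
    thus ?case using Suc by (simp add: algebra_simps)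
  qed auto
  have "(\<lambda>n. \<Sum>j<n. theta_mellin_piece j (of_real s - 1/2)) \<longlonglongrightarrow> theta_mellin (of_real s - 1/2)"
    unfolding theta_mellin_def by (rule summable_LIMSEQ[OF theta_mellin_summable])
  thus ?thesis unfolding theta_mellin_piece of_real_sum[symmetric] part unfolding q_def .
qed

text \<open>The integral \<open>J n\<close> over {1/(n+1)..n+1} is evaluated twice. By dominated
  convergence it tends to the full Mellin transform; with its lower half folded over it tends to the
  integral above 1 plus the pole terms.\<close>

lemma xi_real:
  fixes s :: real
  assumes s: "s > 1"
  shows "Gamma (s/2) * pi powr (- s/2) * (\<Sum>n. real (Suc n) powr - s) = Re (theta_mellin (of_real s - 1/2)) + 1 / (s - 1) - 1 / s"
proof -
  define a where "a = s / 2"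
  have a: "a > 1/2" using s by (simp add: a_def)
  define f where "f = (\<lambda>u. omega u * u powr (a - 1))"
  define T where "T = Gamma a * pi powr - a * (\<Sum>n. real (Suc n) powr (- 2 * a))"
  have M: "has_bochner_integral lborel (\<lambda>u. indicator {0<..} u * f u) T"
    using Mellin_omega[OF a] by (simp add: f_def T_def)
  have fc: "continuous_on {c..b} f" if "c > 0" for b c unfolding f_def
    using that by (intro continuous_intros continuous_on_subset[OF omega_continuous_on[OF that]]) auto
  have fi: "f integrable_on {c..b}" if "c > 0" for b c by (intro integrable_continuous_interval fc that)
  define J where "J = (\<lambda>n::nat. integral {1 / (real n + 1)..real n + 1} f)"
  have J1: "J \<longlonglongrightarrow> T"
  proof -
    have "(\<lambda>n::nat. \<integral>u. indicator {1 / (real n + 1)..real n + 1} u * f u \<partial>lborel) \<longlonglongrightarrow> (\<integral>u. indicator {0<..} u * f u \<partial>lborel)"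
    proof (rule integral_dominated_convergence[where w = "\<lambda>u. indicator {0<..} u * f u"])
      show "integrable lborel (\<lambda>u. indicator {0<..} u * f u)" using M by (auto simp: has_bochner_integral_iff)
      have [measurable]: "f \<in> borel_measurable borel" unfolding f_def by measurable
      show "(\<lambda>u. indicator {0<..} u * f u) \<in> borel_measurable lborel" by measurable
      show "(\<lambda>u. indicator {1 / (real n + 1)..real n + 1} u * f u) \<in> borel_measurable lborel" for n by measurable
      have f0: "f u \<ge> 0" if "u > 0" for u unfolding f_def using omega_nonneg[OF that] by simp
      show "AE u in lborel. norm (indicator {1 / (real n + 1)..real n + 1} u * f u) \<le> indicator {0<..} u * f u" for n
      proof (rule AE_I2)
        fix u :: real
        have "u > 0" if "1 / (real n + 1) \<le> u" using that by (rule less_le_trans[rotated]) simp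
        thus "norm (indicator {1 / (real n + 1)..real n + 1} u * f u) \<le> indicator {0<..} u * f u"
          using f0[of u] by (cases "u > 0") (auto simp: indicator_def)
      qed
      show "AE u in lborel. (\<lambda>n. indicator {1 / (real n + 1)..real n + 1} u * f u) \<longlonglongrightarrow> indicator {0<..} u * f u"
      proof (rule AE_I2)
        fix u :: real
        show "(\<lambda>n. indicator {1 / (real n + 1)..real n + 1} u * f u) \<longlonglongrightarrow> indicator {0<..} u * f u"
        proof (cases "u > 0")
          case True
          have "eventually (\<lambda>n. 1 / u \<le> real n + 1 \<and> u \<le> real n + 1) sequentially"
            using eventually_ge_at_top[of "nat \<lceil>max u (1 / u)\<rceil>"] by eventually_elim linarith
          hence "eventually (\<lambda>n. indicator {1 / (real n + 1)..real n + 1} u * f u = indicator {0<..} u * f u) sequentially"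
            by eventually_elim (use True in \<open>auto simp: indicator_def field_simps\<close>)
          thus ?thesis by (rule tendsto_eventually)
        next
          case False
          have "indicator {1 / (real n + 1)..real n + 1} u = (0::real)" for n
          proof -
            have "1 / (real n + 1) > 0" by simp
            hence "\<not> 1 / (real n + 1) \<le> u" using False by linarith
            thus ?thesis by simp
          qed
          thus ?thesis using False by simp
        qed
      qed
    qed
    moreover have "(\<integral>u. indicator {1 / (real n + 1)..real n + 1} u * f u \<partial>lborel) = J n" for n
    proof -
      have "(\<integral>u. indicator {1 / (real n + 1)..real n + 1} u * f u \<partial>lborel) = (LINT u:{1 / (real n + 1)..real n + 1}|lborel. f u)"
        by (simp add: set_lebesgue_integral_def)
      also have "\<dots> = J n" unfolding J_def
        by (intro set_borel_integral_eq_integral borel_integrable_atLeastAtMost' fc) (auto simp: add_nonneg_pos)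
      finally show ?thesis .
    qed
    ultimately show ?thesis using has_bochner_integral_integral_eq[OF M] by simp
  qed
  define c where "c = (\<lambda>n::nat. ((1 - (1/(real n + 1)) powr (a - 1/2)) / (a - 1/2) - (1 - (1/(real n + 1)) powr a) / a) / 2)"
  have Jn: "J n = integral {1..real n + 1} (\<lambda>u. omega u * (u powr (s/2 - 1) + u powr (- s/2 - 1/2))) + c n" for n
  proof -
    have "J n = integral {1 / (real n + 1)..1} f + integral {1..real n + 1} f" unfolding J_def
      by (rule Henstock_Kurzweil_Integration.integral_combine[symmetric]) (auto intro!: fi simp: add_nonneg_pos)
    also have "integral {1 / (real n + 1)..1} f = integral {1..real n + 1} (\<lambda>v. omega v * v powr (- a - 1/2)) + c n"
      unfolding f_def c_def using a by (intro Mellin_lower_half) auto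
    also have "integral {1..real n + 1} (\<lambda>v. omega v * v powr (- a - 1/2)) + c n + integral {1..real n + 1} f =
      integral {1..real n + 1} (\<lambda>u. f u + omega u * u powr (- a - 1/2)) + c n"
    proof -
      have "(\<lambda>v. omega v * v powr (- a - 1/2)) integrable_on {1..real n + 1}"
        by (intro integrable_continuous_interval continuous_intros continuous_on_subset[OF omega_continuous_on[of 1]]) auto
      moreover have "f integrable_on {1..real n + 1}" by (rule fi) simp
      ultimately show ?thesis by (simp add: Henstock_Kurzweil_Integration.integral_add)
    qed
    also have "(\<lambda>u. f u + omega u * u powr (- a - 1/2)) = (\<lambda>u. omega u * (u powr (s/2 - 1) + u powr (- s/2 - 1/2)))"
      by (simp add: f_def a_def distrib_left)
    finally show ?thesis .
  qed
  have clim: "c \<longlonglongrightarrow> ((1 - 0) / (a - 1/2) - (1 - 0) / a) / 2"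
  proof -
    have z: "(\<lambda>n::nat. (1 / (real n + 1)) powr e) \<longlonglongrightarrow> 0" if "e > 0" for e
    proof -
      have "(\<lambda>n::nat. 1 / (real n + 1)) \<longlonglongrightarrow> 0" by real_asymp
      from tendsto_powr'[OF this tendsto_const[of e]] that show ?thesis by (auto intro: always_eventually)
    qed
    show ?thesis unfolding c_def by (intro tendsto_intros z) (use a in auto)
  qed
  have "(\<lambda>n. Re (complex_of_real (integral {1..real n + 1} (\<lambda>u. omega u * (u powr (s/2 - 1) + u powr (- s/2 - 1/2)))))) \<longlonglongrightarrow> Re (theta_mellin (of_real s - 1/2))"
    by (intro tendsto_Re theta_mellin_of_real_limit)
  hence "J \<longlonglongrightarrow> Re (theta_mellin (of_real s - 1/2)) + ((1 - 0) / (a - 1/2) - (1 - 0) / a) / 2"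
    unfolding Jn[abs_def] by (intro tendsto_add clim) simp
  with J1 have "T = Re (theta_mellin (of_real s - 1/2)) + ((1 - 0) / (a - 1/2) - (1 - 0) / a) / 2" by (rule LIMSEQ_unique)
  moreover have "((1 - 0) / (a - 1/2) - (1 - 0) / a) / 2 = 1 / (s - 1) - 1 / s" using s by (simp add: a_def field_simps)
  ultimately show ?thesis by (simp add: T_def a_def)
qed

section \<open>Dirichlet series\<close>

text \<open>The power n^(-s), taken with the real logarithm of n so that it is entire in s and
  multiplicative in positive n without branch questions.\<close>

definition nat_powr_minus :: "complex \<Rightarrow> nat \<Rightarrow> complex" where
  "nat_powr_minus s n = exp (- (s * of_real (ln (real n))))"

text \<open>The index is shifted: \<open>a n\<close> belongs to n + 1, so \<open>a 0\<close> is the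
  constant term that survives as Re s tends to infinity.\<close>

definition dirichlet_series :: "(nat \<Rightarrow> complex) \<Rightarrow> complex \<Rightarrow> complex" where
  "dirichlet_series a s = (\<Sum>n. a n * nat_powr_minus s (Suc n))"

lemma nat_powr_minus_conv_powr: "1 / of_nat (Suc n) powr s = nat_powr_minus s (Suc n)"
  by (simp add: powr_def Ln_of_nat nat_powr_minus_def exp_minus inverse_eq_divide del: of_nat_Suc)

lemma norm_nat_powr_minus: "n > 0 \<Longrightarrow> norm (nat_powr_minus s n) = real n powr - Re s"
  by (simp add: nat_powr_minus_def powr_def)

lemma nat_powr_minus_mult: "m > 0 \<Longrightarrow> n > 0 \<Longrightarrow> nat_powr_minus s (m * n) = nat_powr_minus s m * nat_powr_minus s n"
  by (simp add: nat_powr_minus_def ln_mult exp_add[symmetric] algebra_simps)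

lemma summable_Suc_powr: "x < -1 \<Longrightarrow> summable (\<lambda>n. real (Suc n) powr x)"
  by (subst summable_Suc_iff) (simp add: summable_real_powr_iff)

lemma ln_le_powr:
  assumes "d > 0"
  shows "ln (real (Suc n)) \<le> real (Suc n) powr d / d"
proof -
  have "d * ln (real (Suc n)) = ln (real (Suc n) powr d)" by (simp add: ln_powr)
  also have "\<dots> \<le> real (Suc n) powr d" using ln_le_minus_one[of "real (Suc n) powr d"] by simp
  finally show ?thesis using assms by (simp add: field_simps)
qed

text \<open>One has ln n <= n^d / d for every d > 0; half the gap between x and -1 keeps x + d below
  -1. The hypothesis covers all exponents below -1 so that the lemma can be applied once for each
  derivative.\<close>

lemma summable_ln_powr:
  assumes "x < -1"
    and H: "\<And>x. x < -1 \<Longrightarrow> summable (\<lambda>n. norm (a n :: complex) * real (Suc n) powr x)"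
  shows "summable (\<lambda>n. norm (- of_real (ln (real (Suc n))) * a n) * real (Suc n) powr x)"
proof -
  define d where "d = (- 1 - x) / 2"
  have d: "d > 0" using assms by (simp add: d_def)
  have "x + d < -1" using assms by (simp add: d_def field_simps)
  hence "summable (\<lambda>n. norm (a n) * real (Suc n) powr (x + d) * (1 / d))" by (intro summable_mult2 H)
  thus ?thesis
  proof (rule summable_comparison_test'[of _ 0])
    fix n
    have "norm (- of_real (ln (real (Suc n))) * a n) = ln (real (Suc n)) * norm (a n)"
      by (simp add: norm_mult del: of_nat_Suc)
    hence "norm (- of_real (ln (real (Suc n))) * a n) * real (Suc n) powr x
      = ln (real (Suc n)) * (norm (a n) * real (Suc n) powr x)" by simp
    also have "\<dots> \<le> real (Suc n) powr d / d * (norm (a n) * real (Suc n) powr x)"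
      by (intro mult_right_mono ln_le_powr d) auto
    also have "\<dots> = norm (a n) * real (Suc n) powr (x + d) * (1 / d)" by (simp add: powr_add)
    finally show "norm (norm (- of_real (ln (real (Suc n))) * a n) * real (Suc n) powr x) \<le> norm (a n) * real (Suc n) powr (x + d) * (1 / d)"
      by simp
  qed
qed

text \<open>To the right of \<open>e\<close>, the midpoint of 1 and Re s, one convergent series
  dominates, which permits differentiation term by term.\<close>

lemma dirichlet_series_properties:
  fixes a :: "nat \<Rightarrow> complex"
  assumes H: "\<And>x. x < -1 \<Longrightarrow> summable (\<lambda>n. norm (a n) * real (Suc n) powr x)"
    and s: "Re s > 1"
  shows "summable (\<lambda>n. norm (a n * nat_powr_minus s (Suc n)))"
    "(\<lambda>n. a n * nat_powr_minus s (Suc n)) sums dirichlet_series a s"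
    "(dirichlet_series a has_field_derivative dirichlet_series (\<lambda>n. - of_real (ln (real (Suc n))) * a n) s) (at s)"
proof -
  define e where "e = (1 + Re s) / 2"
  have e: "e > 1" "e < Re s" using s by (auto simp: e_def)
  define S where "S = {s. e < Re s}"
  have op: "open S" unfolding S_def by (rule open_halfspace_Re_gt)
  have le: "norm (a n * nat_powr_minus z (Suc n)) \<le> norm (a n) * real (Suc n) powr - e" if "z \<in> S" for n z
    using that by (auto simp: norm_mult norm_nat_powr_minus S_def simp del: of_nat_Suc intro!: mult_left_mono powr_mono)
  have sm: "summable (\<lambda>n. norm (a n) * real (Suc n) powr - e)" using e by (intro H) auto
  have sS: "s \<in> S" using e by (simp add: S_def)
  show abs: "summable (\<lambda>n. norm (a n * nat_powr_minus s (Suc n)))"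
    by (rule summable_comparison_test'[OF sm, of 0]) (use le[OF sS] in auto)
  show sums: "(\<lambda>n. a n * nat_powr_minus s (Suc n)) sums dirichlet_series a s"
    unfolding dirichlet_series_def by (rule summable_sums[OF summable_norm_cancel[OF abs]])
  obtain g g' where g: "\<forall>x\<in>S. ((\<lambda>n. a n * nat_powr_minus x (Suc n)) sums g x) \<and>
     ((\<lambda>n. - of_real (ln (real (Suc n))) * a n * nat_powr_minus x (Suc n)) sums g' x) \<and> (g has_field_derivative g' x) (at x)"
  proof (rule series_and_derivative_comparison[OF op sm])
    show "((\<lambda>x. a n * nat_powr_minus x (Suc n)) has_field_derivative - of_real (ln (real (Suc n))) * a n * nat_powr_minus x (Suc n)) (at x)" for n x
      unfolding nat_powr_minus_def by (auto intro!: derivative_eq_intros simp del: of_nat_Suc)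
    show "\<forall>\<^sub>F n in sequentially. \<forall>x\<in>S. norm (a n * nat_powr_minus x (Suc n)) \<le> norm (a n) * real (Suc n) powr - e"
      using le by auto
  qed blast
  have "(g has_field_derivative g' s) (at s)" using g sS by blast
  moreover have "g x = dirichlet_series a x" if "x \<in> S" for x using g that by (auto simp: dirichlet_series_def sums_iff)
  ultimately have "(dirichlet_series a has_field_derivative g' s) (at s)"
    using has_field_derivative_transform_within_open[OF _ op sS] by blast
  moreover have "g' s = dirichlet_series (\<lambda>n. - of_real (ln (real (Suc n))) * a n) s"
    using g sS by (auto simp: dirichlet_series_def sums_iff)
  ultimately show "(dirichlet_series a has_field_derivative dirichlet_series (\<lambda>n. - of_real (ln (real (Suc n))) * a n) s) (at s)" by simp
qed

abbreviation "one_coeff \<equiv> (\<lambda>_::nat. 1 :: complex)"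
abbreviation "mang_coeff \<equiv> (\<lambda>n. mangoldt (Suc n) :: complex)"

lemma one_coeff_summable: "x < -1 \<Longrightarrow> summable (\<lambda>n. norm (one_coeff n) * real (Suc n) powr x)"
  using summable_Suc_powr by simp

lemma mang_coeff_summable: "x < -1 \<Longrightarrow> summable (\<lambda>n. norm (mang_coeff n) * real (Suc n) powr x)"
  using summable_ln_powr[OF _ one_coeff_summable, of x]
proof (rule summable_comparison_test'[of _ 0])
  fix n
  have "norm (mang_coeff n) \<le> norm (- complex_of_real (ln (real (Suc n))) * 1)"
    using mangoldt_le[of "Suc n"] by (simp del: of_nat_Suc)
  thus "norm (norm (mang_coeff n) * real (Suc n) powr x) \<le> norm (- complex_of_real (ln (real (Suc n))) * 1) * real (Suc n) powr x"
    by (simp add: abs_mult mult_right_mono del: of_nat_Suc)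
qed

lemma has_sum_Suc:
  assumes "summable (\<lambda>n. norm (f (Suc n) :: complex))" "(\<lambda>n. f (Suc n)) sums S"
  shows "(f has_sum S) {1..}"
proof -
  have "((\<lambda>n. f (Suc n)) has_sum S) UNIV" by (rule norm_summable_imp_has_sum[OF assms])
  moreover have "bij_betw Suc UNIV {1..}"
    by (rule bij_betwI[of _ _ _ "\<lambda>n. n - 1"]) auto
  ultimately show ?thesis using has_sum_reindex_bij_betw by blast
qed

text \<open>The identity zeta' = - zeta * (sum of mangoldt n / n^s) at the level of series: the
  absolutely summable double series over (d, e) is regrouped by n = d e, and \<open>mangoldt\<close>
  summed over the divisors of n is ln n.\<close>

lemma log_series_factor:
  assumes s: "Re s > 1"
  shows "dirichlet_series (\<lambda>n. - of_real (ln (real (Suc n))) * one_coeff n) s = - dirichlet_series one_coeff s * dirichlet_series mang_coeff s"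
proof -
  define F where "F = (\<lambda>(d, e). (mangoldt d * nat_powr_minus s d) * nat_powr_minus s e)"
  note P1 = dirichlet_series_properties[OF one_coeff_summable s]
  note PM = dirichlet_series_properties[OF mang_coeff_summable s]
  note PL = dirichlet_series_properties[OF summable_ln_powr[OF _ one_coeff_summable] s]
  have one: "(nat_powr_minus s has_sum dirichlet_series one_coeff s) {1..}"
    by (rule has_sum_Suc) (use P1 in simp_all)
  have mang: "((\<lambda>d. mangoldt d * nat_powr_minus s d) has_sum dirichlet_series mang_coeff s) {1..}"
    by (rule has_sum_Suc) (use PM in simp_all)
  have logs: "((\<lambda>n. - of_real (ln (real n)) * nat_powr_minus s n) has_sum dirichlet_series (\<lambda>n. - of_real (ln (real (Suc n))) * one_coeff n) s) {1..}"
    by (rule has_sum_Suc) (use PL in \<open>simp_all del: of_nat_Suc\<close>)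
  have inner: "((\<lambda>e. F (d, e)) has_sum (mangoldt d * nat_powr_minus s d * dirichlet_series one_coeff s)) {1..}" for d
    using has_sum_cmult_right[OF one, of "mangoldt d * nat_powr_minus s d"] by (simp add: F_def)
  have absone: "(\<lambda>e. norm (nat_powr_minus s e)) summable_on {1..}"
    using has_sum_Suc[of "\<lambda>n. of_real (norm (nat_powr_minus s n))"] P1(1)
    by (metis (no_types) one summable_on_def has_sum_imp_summable summable_on_iff_abs_summable_on_complex)
  have absmang: "(\<lambda>d. norm (mangoldt d * nat_powr_minus s d)) summable_on {1..}"
    using mang by (metis (no_types) has_sum_imp_summable summable_on_iff_abs_summable_on_complex)
  have "(\<lambda>p. norm (F p)) summable_on (SIGMA d:{1..}. {1..})"
  proof (rule summable_on_SigmaI[where g = "\<lambda>d. norm (mangoldt d * nat_powr_minus s d :: complex) * (\<Sum>\<^sub>\<infinity>e\<in>{1..}. norm (nat_powr_minus s e))"])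
    show "((\<lambda>e. norm (F (d, e))) has_sum norm (mangoldt d * nat_powr_minus s d :: complex) * (\<Sum>\<^sub>\<infinity>e\<in>{1..}. norm (nat_powr_minus s e))) {1..}" for d
      using has_sum_cmult_right[OF has_sum_infsum[OF absone], of "norm (mangoldt d * nat_powr_minus s d :: complex)"]
      by (simp add: F_def norm_mult)
    show "(\<lambda>d. norm (mangoldt d * nat_powr_minus s d :: complex) * (\<Sum>\<^sub>\<infinity>e\<in>{1..}. norm (nat_powr_minus s e))) summable_on {1..}"
      by (intro summable_on_cmult_left absmang)
  qed auto
  hence "F summable_on (SIGMA d:{1..}. {1..})" by (rule abs_summable_summable)
  hence total: "(F has_sum (dirichlet_series mang_coeff s * dirichlet_series one_coeff s)) ({1..} \<times> {1..})"
    by (intro has_sum_SigmaI[OF inner has_sum_cmult_left[OF mang]])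
  have "((\<lambda>(n, d). F (d, n div d)) has_sum (dirichlet_series mang_coeff s * dirichlet_series one_coeff s)) (SIGMA n:{1..}. {d. d dvd n})"
  proof (rule has_sum_reindex_bij_witness[where i = "\<lambda>(n, d). (d, n div d)" and j = "\<lambda>(d, e). (d * e, d)", THEN iffD1, OF _ _ _ _ _ refl total])
    show "(\<lambda>(n, d). (d, n div d)) ((\<lambda>(d, e). (d * e, d)) p) = p" if pp: "p \<in> {1..} \<times> {1..}" for p :: "nat \<times> nat"
    proof -
      obtain d e where "p = (d, e)" "d \<ge> 1" using pp by (cases p) auto
      moreover from this have "d \<noteq> 0" by linarith
      ultimately show ?thesis by simp
    qed
    show "(\<lambda>(d, e). (d * e, d)) p \<in> (SIGMA n:{1..}. {d. d dvd n})" if "p \<in> {1..} \<times> {1..}" for p :: "nat \<times> nat"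
      using that by auto
    show "(\<lambda>(d, e). (d * e, d)) ((\<lambda>(n, d). (d, n div d)) q) = q" if "q \<in> (SIGMA n:{1..}. {d. d dvd n})" for q :: "nat \<times> nat"
      using that by auto
    show "(\<lambda>(n, d). (d, n div d)) q \<in> {1..} \<times> {1..}" if "q \<in> (SIGMA n:{1..}. {d. d dvd n})" for q :: "nat \<times> nat"
      using that by (auto simp: Suc_le_eq intro!: Nat.gr0I)
    show "(\<lambda>(n, d). F (d, n div d)) ((\<lambda>(d, e). (d * e, d)) p) = F p" if pp: "p \<in> {1..} \<times> {1..}" for p :: "nat \<times> nat"
    proof -
      obtain d e where "p = (d, e)" "d \<ge> 1" using pp by (cases p) auto
      moreover from this have "d \<noteq> 0" by linarith
      ultimately show ?thesis by simp
    qed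
  qed
  hence "((\<lambda>n. \<Sum>d | d dvd n. F (d, n div d)) has_sum (dirichlet_series mang_coeff s * dirichlet_series one_coeff s)) {1..}"
    by (rule has_sum_SigmaD) (auto intro!: has_sum_finite)
  also have "?this \<longleftrightarrow> ((\<lambda>n. of_real (ln (real n)) * nat_powr_minus s n) has_sum (dirichlet_series mang_coeff s * dirichlet_series one_coeff s)) {1..}"
  proof (rule has_sum_cong)
    fix n :: nat assume n: "n \<in> {1..}"
    have "(\<Sum>d | d dvd n. F (d, n div d)) = (\<Sum>d | d dvd n. mangoldt d * nat_powr_minus s n)"
    proof (rule sum.cong)
      fix d assume d: "d \<in> {d. d dvd n}"
      then obtain e where e: "n = d * e" by auto
      hence "d > 0" "e > 0" using n by auto
      thus "F (d, n div d) = mangoldt d * nat_powr_minus s n" by (simp add: F_def e nat_powr_minus_mult)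
    qed auto
    also have "\<dots> = (\<Sum>d | d dvd n. mangoldt d) * nat_powr_minus s n" by (simp add: sum_distrib_right)
    also have "(\<Sum>d | d dvd n. mangoldt d :: complex) = of_real (ln (real n))" using n by (intro mangoldt_sum) auto
    finally show "(\<Sum>d | d dvd n. F (d, n div d)) = of_real (ln (real n)) * nat_powr_minus s n" .
  qed
  finally have "((\<lambda>n. - of_real (ln (real n)) * nat_powr_minus s n) has_sum - (dirichlet_series mang_coeff s * dirichlet_series one_coeff s)) {1..}"
    using has_sum_uminus by fastforce
  from has_sum_unique[OF this logs] show ?thesis by (simp add: mult.commute)
qed

section \<open>Analytic continuation and identification of zeta\<close>

lemma dirichlet_series_xi_real:
  fixes x :: real
  assumes x: "x > 1"
  shows "(of_real x - 1) * dirichlet_series one_coeff (of_real x) =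
    exp (of_real x / 2 * of_real (ln pi)) * rGamma (of_real x / 2 + 1) * xi_fun (of_real x)"
proof -
  define S where "S = (\<Sum>n. real (Suc n) powr - x)"
  define A where "A = Re (theta_mellin (of_real x - 1/2))"
  have s: "(\<lambda>n. real (Suc n) powr - x) sums S"
    unfolding S_def using x by (intro summable_sums summable_Suc_powr) auto
  have "nat_powr_minus (of_real x) (Suc n) = of_real (real (Suc n) powr - x)" for n
    by (simp add: nat_powr_minus_def powr_def exp_of_real[symmetric] del: of_nat_Suc)
  hence D: "dirichlet_series one_coeff (of_real x) = of_real S"
    using sums_of_real[OF s, where ?'a = complex] by (simp add: dirichlet_series_def sums_iff)
  have "cnj (theta_mellin (of_real x - 1/2)) = theta_mellin (of_real x - 1/2)" using theta_mellin_cnj[of "of_real x - 1/2"] by simp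
  hence theta_mellin: "theta_mellin (of_real x - 1/2) = of_real A" unfolding A_def by (metis Reals_cnj_iff of_real_Re)
  have xi: "xi_fun (of_real x) = of_real ((1 + x * (x - 1) * A) / 2)" by (simp add: xi_fun_def theta_mellin)
  have G: "Gamma (x/2) > 0" using x by (intro Gamma_real_pos) auto
  have rG: "rGamma (of_real x / 2 + 1 :: complex) = of_real (1 / (Gamma (x/2) * (x/2)))"
  proof -
    have "rGamma (of_real x / 2 + 1 :: complex) = of_real (rGamma (x/2 + 1))"
      by (simp flip: rGamma_complex_of_real)
    also have "rGamma (x/2 + 1) = 1 / Gamma (x/2 + 1)" by (simp add: rGamma_inverse_Gamma inverse_eq_divide)
    also have "Gamma (x/2 + 1) = x/2 * Gamma (x/2)" using x by (intro Gamma_plus1) (auto elim!: nonpos_Ints_cases')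
    finally show ?thesis by (simp add: mult.commute)
  qed
  have ex: "exp (of_real x / 2 * of_real (ln pi)) = complex_of_real (pi powr (x/2))"
    by (simp add: powr_def exp_of_real[symmetric])
  have pp: "pi powr (- x/2) * pi powr (x/2) = 1" by (simp add: powr_add[symmetric])
  have "Gamma (x/2) * pi powr (- x/2) * S = A + 1 / (x - 1) - 1 / x"
    using xi_real[OF x] by (simp add: S_def A_def)
  hence "x * (x - 1) * (Gamma (x/2) * pi powr (- x/2) * S) = x * (x - 1) * A + 1"
    using x by (simp add: field_simps)
  hence "pi powr (x/2) * (1 / (Gamma (x/2) * (x/2))) * ((1 + x * (x - 1) * A) / 2) =
     pi powr (x/2) * (1 / (Gamma (x/2) * (x/2))) * ((x * (x - 1) * (Gamma (x/2) * pi powr (- x/2) * S)) / 2)" by simp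
  also have "P * (1 / (Gamma (x/2) * (x/2))) * ((x * (x - 1) * (Gamma (x/2) * Q * S)) / 2) = (Q * P) * ((x - 1) * S)" for P Q
    using x less_imp_neq[OF G] by (simp add: divide_simps)
  finally have "(x - 1) * S = pi powr (x/2) * (1 / (Gamma (x/2) * (x/2))) * ((1 + x * (x - 1) * A) / 2)"
    unfolding pp by simp
  thus ?thesis unfolding D xi rG ex by (metis of_real_1 of_real_diff of_real_mult)
qed

text \<open>Both sides are holomorphic on Re s > 1 and agree on the real half line, which
  accumulates at 2.\<close>

lemma dirichlet_series_xi:
  assumes "Re s > 1"
  shows "(s - 1) * dirichlet_series one_coeff s = exp (s / 2 * of_real (ln pi)) * rGamma (s / 2 + 1) * xi_fun s"
proof -
  define h where "h = (\<lambda>s. (s - 1) * dirichlet_series one_coeff s - exp (s / 2 * of_real (ln pi)) * rGamma (s / 2 + 1) * xi_fun s)"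
  define S where "S = {s::complex. Re s > 1}"
  have "dirichlet_series one_coeff holomorphic_on S"
    unfolding S_def holomorphic_on_def field_differentiable_def
    using dirichlet_series_properties(3)[OF one_coeff_summable] has_field_derivative_at_within by blast
  hence hol: "h holomorphic_on S"
    unfolding h_def by (intro holomorphic_intros xi_holomorphic) auto
  have "h s = 0"
  proof (rule analytic_continuation[OF hol])
    show "open S" unfolding S_def by (rule open_halfspace_Re_gt)
    show "connected S" unfolding S_def by (intro convex_connected convex_halfspace_Re_gt)
    show "complex_of_real ` {1<..} \<subseteq> S" by (auto simp: S_def)
    show "(2::complex) \<in> S" by (simp add: S_def)
    show "(2::complex) islimpt complex_of_real ` {1<..}"
      unfolding islimpt_approachable
    proof (intro allI impI)
      fix e :: real assume "e > 0"
      thus "\<exists>x'\<in>complex_of_real ` {1<..}. x' \<noteq> 2 \<and> dist x' 2 < e"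
        by (intro bexI[of _ "of_real (2 + e / 2)"]) (auto simp: dist_norm complex_eq_iff)
    qed
    show "h z = 0" if "z \<in> complex_of_real ` {1<..}" for z
      using that dirichlet_series_xi_real by (auto simp: h_def)
    show "s \<in> S" using assms by (simp add: S_def)
  qed
  thus ?thesis by (simp add: h_def)
qed

text \<open>The factor s / 2 of xi is absorbed by Gamma (s/2 + 1) = s/2 * Gamma (s/2). The
  reciprocal Gamma function being entire, only the division by s - 1 remains.\<close>

definition zeta_fun :: "complex \<Rightarrow> complex" where
  "zeta_fun s = (if s = 1 then 0 else exp (s / 2 * of_real (ln pi)) * rGamma (s / 2 + 1) * xi_fun s / (s - 1))"

lemma zeta_fun_properties:
  "zeta_fun holomorphic_on - {1}" "zeta_fun 1 = 0"
  "Re s > 1 \<Longrightarrow> zeta_fun s = dirichlet_series one_coeff s"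
  "Re s > 1 \<Longrightarrow> (\<lambda>n. 1 / of_nat (Suc n) powr s) sums zeta_fun s"
proof -
  have "(\<lambda>s. exp (s / 2 * of_real (ln pi)) * rGamma (s / 2 + 1) * xi_fun s / (s - 1)) holomorphic_on - {1}"
    by (intro holomorphic_intros xi_holomorphic) auto
  thus "zeta_fun holomorphic_on - {1}"
    by (rule holomorphic_transform) (auto simp: zeta_fun_def)
  show "zeta_fun 1 = 0" by (simp add: zeta_fun_def)
  show *: "zeta_fun s = dirichlet_series one_coeff s" if "Re s > 1"
    using dirichlet_series_xi[OF that] that by (auto simp: zeta_fun_def divide_eq_eq mult.commute)
  show "(\<lambda>n. 1 / of_nat (Suc n) powr s) sums zeta_fun s" if "Re s > 1"
    unfolding nat_powr_minus_conv_powr *[OF that]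
    using dirichlet_series_properties(2)[OF one_coeff_summable that] by simp
qed

text \<open>Uniqueness is the identity theorem on the connected set of all s other than 1, with 2 as
  a limit point of the half plane of convergence; the prescribed value at 1 does the rest.\<close>

lemma zeta_eq: "zeta = zeta_fun"
  unfolding zeta_def
proof (rule the_equality)
  show "zeta_fun holomorphic_on - {1} \<and> (\<forall>s. 1 < Re s \<longrightarrow> (\<lambda>n. 1 / of_nat (Suc n) powr s) sums zeta_fun s) \<and> zeta_fun 1 = 0"
    using zeta_fun_properties by blast
  fix f assume f: "f holomorphic_on - {1} \<and> (\<forall>s. 1 < Re s \<longrightarrow> (\<lambda>n. 1 / of_nat (Suc n) powr s) sums f s) \<and> f 1 = 0"
  have "f s - zeta_fun s = 0" if "s \<noteq> 1" for s
  proof (rule analytic_continuation[of "\<lambda>s. f s - zeta_fun s" "- {1}" "{s. Re s > 1}" 2])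
    show "(\<lambda>s. f s - zeta_fun s) holomorphic_on - {1}" using f zeta_fun_properties(1) by (intro holomorphic_intros) auto
    show "connected (- {1::complex})" by (intro connected_punctured_universe) auto
    have "2 \<in> interior {s::complex. Re s > 1}" using open_halfspace_Re_gt[of 1] by (simp add: interior_open)
    thus "2 islimpt {s::complex. Re s > 1}" by (rule interior_limit_point)
    show "f z - zeta_fun z = 0" if "z \<in> {s. Re s > 1}" for z
      using sums_unique2[of _ "f z" "zeta_fun z"] f zeta_fun_properties(4)[of z] that by auto
  qed (use that in auto)
  thus "f = zeta_fun" using f zeta_fun_properties(2) by (intro ext) (metis eq_iff_diff_eq_0)
qed

lemma zeta_holomorphic: "zeta holomorphic_on - {1}"
  unfolding zeta_eq by (rule zeta_fun_properties(1))

lemma zeta_xi: "s \<noteq> 1 \<Longrightarrow> (s - 1) * zeta s = exp (s / 2 * of_real (ln pi)) * rGamma (s / 2 + 1) * xi_fun s"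
  unfolding zeta_eq by (simp add: zeta_fun_def)

lemma zeta_dirichlet_series: "Re s > 1 \<Longrightarrow> zeta s = dirichlet_series one_coeff s"
  unfolding zeta_eq by (rule zeta_fun_properties(3))

section \<open>Zeros of the xi function\<close>

text \<open>The linear term must be Re w and not norm w: in the product for 1 / Gamma these terms
  add up to Re z times a harmonic number, which n^(-z) nearly cancels. The 3/2 dominates the true
  error |w|^2 for small w and |w| for large w, and is still summable over w = z / k.\<close>

lemma norm_one_plus_le:
  fixes w :: complex
  shows "norm (1 + w) \<le> exp (Re w + 2 * norm w powr (3/2))"
proof (cases "norm w \<le> 1")
  case True
  define P where "P = norm w powr (3/2)"
  have "(norm w)\<^sup>2 \<le> norm w powr (3/2)"
  proof (cases "w = 0")
    case False
    have "norm w powr 2 \<le> norm w powr (3/2)" using True by (intro powr_mono') auto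
    thus ?thesis using False by (simp add: powr_numeral)
  qed auto
  moreover have "q \<le> 4 * P" if "q \<le> P" "0 \<le> P" for q :: real using that by linarith
  ultimately have "(norm w)\<^sup>2 \<le> 4 * P" by (simp add: P_def)
  hence "2 * Re w + (norm w)\<^sup>2 \<le> 2 * (Re w + 2 * P)" by simp
  hence le: "exp (2 * Re w + (norm w)\<^sup>2) \<le> (exp (Re w + 2 * norm w powr (3/2)))\<^sup>2"
    unfolding P_def[symmetric] by (simp add: exp_double[symmetric])
  have "(norm (1 + w))\<^sup>2 = 1 + (2 * Re w + (norm w)\<^sup>2)" by (simp add: cmod_power2) (simp add: power2_eq_square algebra_simps)
  also have "\<dots> \<le> exp (2 * Re w + (norm w)\<^sup>2)" by (rule exp_ge_add_one_self)
  also note le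
  finally show ?thesis by (rule power2_le_imp_le) simp
next
  case False
  have "norm w powr 1 \<le> norm w powr (3/2)" using False by (intro powr_mono) auto
  moreover have "- norm w \<le> Re w" using abs_Re_le_cmod[of w] by linarith
  ultimately have le: "norm w \<le> Re w + 2 * norm w powr (3/2)" using False by (simp add: powr_one)
  have "norm (1 + w) \<le> 1 + norm w" using norm_triangle_ineq[of 1 w] by simp
  also have "\<dots> \<le> exp (norm w)" by (rule exp_ge_add_one_self)
  also have "\<dots> \<le> exp (Re w + 2 * norm w powr (3/2))" using le by simp
  finally show ?thesis .
qed

definition zeta_three_halves :: real where "zeta_three_halves = (\<Sum>n. real (Suc n) powr (-3/2))"

lemma rGamma_series_product:
  "rGamma_series z n = z * (\<Prod>k<n. 1 + z / of_nat (Suc k)) / exp (z * of_real (ln (of_nat n)))" for z :: complex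
proof -
  have "pochhammer z (Suc n) / fact n = z * (\<Prod>k<n. 1 + z / of_nat (Suc k))"
  proof (induction n)
    case (Suc n)
    have "pochhammer z (Suc (Suc n)) / fact (Suc n) = pochhammer z (Suc n) / fact n * ((z + of_nat (Suc n)) / of_nat (Suc n))"
      by (subst pochhammer_Suc) (simp del: of_nat_Suc add: mult_ac)
    also have "(z + of_nat (Suc n)) / of_nat (Suc n) = 1 + z / of_nat (Suc n)"
      by (simp add: add_divide_distrib del: of_nat_Suc)
    finally show ?case using Suc by (simp add: mult.assoc del: of_nat_Suc)
  qed simp
  thus ?thesis unfolding rGamma_series_def by (simp add: divide_divide_eq_left[symmetric])
qed

text \<open>\<open>norm_one_plus_le\<close> is applied to each factor of the Gauss product, and the
  bound passes to the limit. As harm n - ln n lies between 0 and 1, the linear terms leave at most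
  norm z.\<close>

lemma rGamma_growth:
  fixes z :: complex
  shows "norm (rGamma z) \<le> norm z * exp (norm z + 2 * zeta_three_halves * norm z powr (3/2))"
proof (rule LIMSEQ_le_const2)
  show "(\<lambda>n. norm (rGamma_series z n)) \<longlonglongrightarrow> norm (rGamma z)" by (intro tendsto_norm rGamma_series_LIMSEQ)
  have "norm (rGamma_series z n) \<le> norm z * exp (norm z + 2 * zeta_three_halves * norm z powr (3/2))" if n: "n \<ge> 1" for n
  proof -
    have "(\<Prod>k<n. norm (1 + z / of_nat (Suc k))) \<le> (\<Prod>k<n. exp (Re z * (1 / real (Suc k)) + 2 * norm z powr (3/2) * real (Suc k) powr (-3/2)))"
    proof (intro prod_mono conjI)
      fix k
      have "norm (1 + z / of_nat (Suc k)) \<le> exp (Re (z / of_nat (Suc k)) + 2 * norm (z / of_nat (Suc k)) powr (3/2))"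
        by (rule norm_one_plus_le)
      also have "norm (z / of_nat (Suc k)) powr (3/2) = norm z powr (3/2) * real (Suc k) powr (-3/2)"
        by (simp add: norm_divide powr_divide powr_minus_divide del: of_nat_Suc)
      also have "Re (z / of_nat (Suc k)) = Re z * (1 / real (Suc k))"
        by (metis Re_divide_of_nat times_divide_eq_right mult.right_neutral)
      finally show "norm (1 + z / of_nat (Suc k)) \<le> exp (Re z * (1 / real (Suc k)) + 2 * norm z powr (3/2) * real (Suc k) powr (-3/2))"
        by (simp only: mult.assoc)
    qed auto
    also have "\<dots> = exp (Re z * harm n + 2 * norm z powr (3/2) * (\<Sum>k<n. real (Suc k) powr (-3/2)))"
    proof -
      have "harm n = (\<Sum>k<n. 1 / real (Suc k))"
        unfolding harm_def by (rule sum.reindex_bij_witness[of _ Suc "\<lambda>k. k - 1"]) (auto simp: inverse_eq_divide)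
      thus ?thesis by (simp add: exp_sum[symmetric] sum.distrib sum_distrib_left del: of_nat_Suc)
    qed
    finally have P: "norm (\<Prod>k<n. 1 + z / of_nat (Suc k)) \<le> exp (Re z * harm n + 2 * norm z powr (3/2) * (\<Sum>k<n. real (Suc k) powr (-3/2)))"
      by (simp add: prod_norm[symmetric])
    have "norm (rGamma_series z n) = norm z * norm (\<Prod>k<n. 1 + z / of_nat (Suc k)) / exp (Re z * ln (real n))"
      unfolding rGamma_series_product by (simp add: norm_mult norm_divide)
    also have "\<dots> \<le> norm z * exp (Re z * harm n + 2 * norm z powr (3/2) * (\<Sum>k<n. real (Suc k) powr (-3/2))) / exp (Re z * ln (real n))"
      by (intro divide_right_mono mult_left_mono P) auto
    also have "\<dots> = norm z * exp (Re z * (harm n - ln (real n)) + 2 * norm z powr (3/2) * (\<Sum>k<n. real (Suc k) powr (-3/2)))"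
      by (simp add: exp_add exp_diff right_diff_distrib)
    also have "\<dots> \<le> norm z * exp (norm z + 2 * zeta_three_halves * norm z powr (3/2))"
    proof -
      have h: "0 \<le> harm n - ln (real n)" "harm n - ln (real n) \<le> 1"
      proof -
        have "ln (real n) \<le> ln (real n + 1)" using n by simp
        thus "0 \<le> harm n - ln (real n)" using harm_ge_ln[of n] by linarith
        have "harm (Suc (n - 1)) - ln (real (Suc (n - 1))) \<le> harm (Suc 0) - ln (real (Suc 0))"
          using decseq_harm_diff_ln by (rule decseqD) simp
        thus "harm n - ln (real n) \<le> 1" using n by (simp add: harm_def)
      qed
      have "Re z * (harm n - ln (real n)) \<le> norm z * 1"
        using h abs_Re_le_cmod[of z] by (intro mult_mono) auto
      moreover have "(\<Sum>k<n. real (Suc k) powr (-3/2)) \<le> zeta_three_halves"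
        unfolding zeta_three_halves_def by (intro sum_le_suminf summable_Suc_powr) auto
      hence "2 * norm z powr (3/2) * (\<Sum>k<n. real (Suc k) powr (-3/2)) \<le> 2 * norm z powr (3/2) * zeta_three_halves"
        by (intro mult_left_mono) auto
      ultimately show ?thesis by (intro mult_left_mono) (auto simp: mult_ac)
    qed
    finally show ?thesis .
  qed
  thus "\<exists>N. \<forall>n\<ge>N. norm (rGamma_series z n) \<le> norm z * exp (norm z + 2 * zeta_three_halves * norm z powr (3/2))" by blast
qed

text \<open>The function \<open>(s - 1) * zeta s\<close> without its removable singularity at 1.\<close>

definition zeta_reg :: "complex \<Rightarrow> complex" where
  "zeta_reg s = exp (s / 2 * of_real (ln pi)) * rGamma (s / 2 + 1) * xi_fun s"

lemma zeta_reg_eq: "s \<noteq> 1 \<Longrightarrow> zeta_reg s = (s - 1) * zeta s"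
  using zeta_xi by (simp add: zeta_reg_def)

lemma zeta_three_halves_nonneg: "zeta_three_halves \<ge> 0"
  unfolding zeta_three_halves_def by (intro suminf_nonneg summable_Suc_powr) auto

text \<open>The exponential contributes 2 to the constant, since ln pi <= 4; the reciprocal Gamma
  factor 2 + 2 * zeta_three_halves; and xi 10.\<close>

lemma zeta_reg_growth: "norm (zeta_reg s) \<le> exp ((14 + 2 * zeta_three_halves) * (1 + norm s) powr (3/2))"
proof -
  define X where "X = 1 + norm s"
  define Y where "Y = X powr (3/2)"
  have X: "X \<ge> 1" by (simp add: X_def)
  have XY: "X \<le> Y" using powr_mono[of 1 "3/2" X] X by (simp add: Y_def)
  have "Re s / 2 * ln pi \<le> X / 2 * 4"
  proof (rule mult_mono)
    show "Re s / 2 \<le> X / 2" using complex_Re_le_cmod[of s] by (simp add: X_def)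
    show "ln pi \<le> 4" using ln_le_minus_one[of pi] pi_less_4 by simp
  qed (use X pi_gt3 in auto)
  hence 1: "norm (exp (s / 2 * of_real (ln pi))) \<le> exp (2 * Y)" using XY by simp
  have "norm (s / 2 + 1) \<le> norm s / 2 + 1" using norm_triangle_ineq[of "s/2" 1] by (simp add: norm_divide)
  hence z: "norm (s / 2 + 1) \<le> X" using norm_ge_zero[of s] unfolding X_def by linarith
  have "norm (rGamma (s / 2 + 1)) \<le> norm (s / 2 + 1) * exp (norm (s / 2 + 1) + 2 * zeta_three_halves * norm (s / 2 + 1) powr (3/2))"
    by (rule rGamma_growth)
  also have "\<dots> \<le> X * exp (X + 2 * zeta_three_halves * X powr (3/2))"
    using z X zeta_three_halves_nonneg by (intro mult_mono) (auto intro!: add_mono mult_left_mono powr_mono2)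
  also have "\<dots> \<le> exp Y * exp (Y + 2 * zeta_three_halves * Y)"
  proof (intro mult_mono)
    have "1 + Y \<le> exp Y" by (rule exp_ge_add_one_self)
    thus "X \<le> exp Y" using XY by linarith
  qed (use XY in \<open>auto simp: Y_def\<close>)
  finally have 2: "norm (rGamma (s / 2 + 1)) \<le> exp Y * exp (Y + 2 * zeta_three_halves * Y)" .
  have "norm (zeta_reg s) \<le> exp (2 * Y) * (exp Y * exp (Y + 2 * zeta_three_halves * Y)) * exp (10 * Y)"
    unfolding zeta_reg_def norm_mult using xi_growth[of s]
    by (intro mult_mono 1 2) (auto simp: X_def Y_def)
  also have "\<dots> = exp ((14 + 2 * zeta_three_halves) * Y)" by (simp add: exp_add[symmetric] algebra_simps)
  finally show ?thesis by (simp add: X_def Y_def)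
qed

lemma zeta_reg_holomorphic: "zeta_reg holomorphic_on A"
proof -
  have "(rGamma \<circ> (\<lambda>s. s / 2 + 1)) holomorphic_on A"
    by (intro holomorphic_on_compose holomorphic_intros) auto
  thus ?thesis unfolding zeta_reg_def[abs_def] o_def by (intro holomorphic_intros xi_holomorphic) auto
qed

section \<open>Zeros and multiplicities of xi and of (s - 1) zeta(s)\<close>

interpretation Xi: entire_three_halves xi_fun 10
  by unfold_locales (auto simp: xi_holomorphic xi_0 xi_growth)

interpretation Zf: entire_three_halves zeta_reg "14 + 2 * zeta_three_halves"
  by unfold_locales (auto simp: zeta_reg_holomorphic zeta_reg_growth, simp add: zeta_reg_def xi_0)

lemma rGamma_half_eq_0_iff: "rGamma (s / 2 + 1 :: complex) = 0 \<longleftrightarrow> s \<in> {- 2 * of_nat k | k. k \<ge> 1}"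
proof
  assume "rGamma (s / 2 + 1) = 0"
  then obtain n where "s / 2 + 1 = - of_nat n" by (auto simp: rGamma_eq_zero_iff elim!: nonpos_Ints_cases')
  moreover have "s = 2 * (s / 2 + 1) - 2" by simp
  ultimately have "s = - 2 * of_nat (Suc n)" by simp
  thus "s \<in> {- 2 * of_nat k | k. k \<ge> 1}" by force
next
  assume "s \<in> {- 2 * of_nat k | k. k \<ge> 1}"
  then obtain k where k: "k \<ge> 1" "s = - 2 * of_nat k" by auto
  hence "s / 2 + 1 = - of_nat (k - 1)" by (simp add: of_nat_diff)
  thus "rGamma (s / 2 + 1) = 0" by (auto simp: rGamma_eq_zero_iff)
qed

definition trivial_zeros :: "complex set" where
  "trivial_zeros = {- 2 * of_nat k | k. k \<ge> 1}"

text \<open>The derivative of 1 / Gamma at the integer -n is a factorial up to sign, hence not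
  0.\<close>

lemma rGamma_simple:
  assumes "p \<in> trivial_zeros"
  shows "zorder (\<lambda>s::complex. rGamma (s / 2 + 1)) p = 1"
proof -
  obtain k where k: "k \<ge> 1" "p = - 2 * of_nat k" using assms by (auto simp: trivial_zeros_def)
  have p: "p / 2 + 1 = - of_nat (k - 1)" using k by (simp add: of_nat_diff)
  have "((\<lambda>s::complex. rGamma (s / 2 + 1)) has_field_derivative ((-1) ^ (k - 1) * fact (k - 1)) * (1/2)) (at p)"
  proof (rule DERIV_chain2[where f = rGamma and g = "\<lambda>s. s / 2 + 1"])
    show "(rGamma has_field_derivative ((-1) ^ (k - 1) * fact (k - 1))) (at (p / 2 + 1))"
      unfolding p by (rule has_field_derivative_rGamma_nonpos_int)
    show "((\<lambda>s. s / 2 + 1) has_field_derivative 1 / 2) (at p)" by (auto intro!: derivative_eq_intros)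
  qed
  hence d: "deriv (\<lambda>s::complex. rGamma (s / 2 + 1)) p \<noteq> 0" by (subst DERIV_imp_deriv) auto
  show ?thesis
  proof (rule zorder_zero_eqI[of _ UNIV])
    have "(rGamma \<circ> (\<lambda>s. s / 2 + 1 :: complex)) holomorphic_on UNIV"
      by (intro holomorphic_on_compose holomorphic_intros) auto
    thus "(\<lambda>s::complex. rGamma (s / 2 + 1)) holomorphic_on UNIV" by (simp add: o_def)
    show "(deriv ^^ nat 1) (\<lambda>s::complex. rGamma (s / 2 + 1)) p \<noteq> 0" using d by simp
    show "(deriv ^^ i) (\<lambda>s::complex. rGamma (s / 2 + 1)) p = 0" if "i < nat 1" for i
      using that assms rGamma_half_eq_0_iff[of p] by (simp add: trivial_zeros_def)
  qed auto
qed

context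
  assumes RH: "Riemann_Hypothesis"
begin

lemma zeta_zero_cases:
  assumes "zeta s = 0" "s \<noteq> 1"
  shows "Re s = 1/2 \<or> s \<in> trivial_zeros"
  using RH assms unfolding Riemann_Hypothesis_def nontrivial_zeta_zeros_def zeta_zeros_def trivial_zeros_def by blast

text \<open>A zero of xi is a zero of zeta. If it were -2k with k >= 1, reflection would make 1 + 2k
  a zero too, and that point is neither on the critical line nor a negative even integer.\<close>

lemma xi_zero:
  assumes "p \<in> Xi.Z"
  shows "Re p = 1/2" "p \<in> zeta_zeros"
proof -
  have p0: "xi_fun p = 0" using assms by (simp add: Xi.Z_def)
  hence p1: "p \<noteq> 1" using xi_1 by auto
  hence z: "zeta p = 0" using zeta_xi[OF p1] p0 by simp
  thus "p \<in> zeta_zeros" using p1 by (simp add: zeta_zeros_def)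
  have "p \<notin> trivial_zeros"
  proof
    assume "p \<in> trivial_zeros"
    then obtain k where k: "k \<ge> 1" "p = - 2 * of_nat k" by (auto simp: trivial_zeros_def)
    have "xi_fun (1 - p) = 0" using p0 xi_reflect[of p] by simp
    moreover have ne: "1 - p \<noteq> 1" using k by simp
    ultimately have "zeta (1 - p) = 0" using zeta_xi[OF ne] by simp
    from zeta_zero_cases[OF this ne] show False
    proof
      assume "1 - p \<in> trivial_zeros"
      then obtain j where "j \<ge> 1" "1 - p = - 2 * of_nat j" by (auto simp: trivial_zeros_def)
      hence "Re (1 - p) = - 2 * real j" by simp
      thus False using k by simp
    qed (use k in simp)
  qed
  thus "Re p = 1/2" using zeta_zero_cases[OF z p1] by simp
qed

lemma zeta_reg_zeros: "Zf.Z = Xi.Z \<union> trivial_zeros" "Xi.Z \<inter> trivial_zeros = {}"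
proof -
  show "Zf.Z = Xi.Z \<union> trivial_zeros"
    using rGamma_half_eq_0_iff by (auto simp: Zf.Z_def Xi.Z_def zeta_reg_def trivial_zeros_def)
  show "Xi.Z \<inter> trivial_zeros = {}"
    using xi_zero(1) by (fastforce simp: trivial_zeros_def)
qed

text \<open>The two families of zeros are disjoint, so the exponential and reciprocal Gamma factors
  do not vanish at a zero of xi and leave its order unchanged.\<close>

lemma mult_zeta_reg_xi:
  assumes "p \<in> Xi.Z" shows "Zf.mult p = Xi.mult p"
proof -
  obtain g where g: "g holomorphic_on UNIV" "g p \<noteq> 0" "\<And>z. xi_fun z = g z * (z - p) ^ nat (zorder xi_fun p)"
    using entire_factor_at[of xi_fun 0 p] xi_holomorphic xi_0 by auto
  have "zorder zeta_reg p = zorder xi_fun p"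
  proof (rule zorder_eqI[of UNIV])
    have "(rGamma \<circ> (\<lambda>s. s / 2 + 1 :: complex)) holomorphic_on UNIV"
      by (intro holomorphic_on_compose holomorphic_intros) auto
    thus "(\<lambda>s. exp (s / 2 * of_real (ln pi)) * rGamma (s / 2 + 1) * g s) holomorphic_on UNIV"
      unfolding o_def by (intro holomorphic_intros g) auto
    have "p \<notin> trivial_zeros" using zeta_reg_zeros(2) assms by auto
    thus "exp (p / 2 * of_real (ln pi)) * rGamma (p / 2 + 1) * g p \<noteq> 0"
      using g(2) rGamma_half_eq_0_iff[of p] by (simp add: trivial_zeros_def)
    show "zeta_reg w = exp (w / 2 * of_real (ln pi)) * rGamma (w / 2 + 1) * g w * (w - p) powi zorder xi_fun p" for w
      using g(3)[of w] zorder_nonneg_entire(1)[of xi_fun 0 p] xi_holomorphic[of UNIV] xi_0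
      by (simp add: zeta_reg_def power_int_def)
  qed auto
  thus ?thesis by (simp add: Zf.mult_def Xi.mult_def)
qed

lemma mult_zeta_reg_trivial:
  assumes "p \<in> trivial_zeros" shows "Zf.mult p = 1"
proof -
  define G where "G = (\<lambda>s::complex. rGamma (s / 2 + 1))"
  have "(rGamma \<circ> (\<lambda>s. s / 2 + 1 :: complex)) holomorphic_on UNIV"
    by (intro holomorphic_on_compose holomorphic_intros) auto
  hence G: "G holomorphic_on UNIV" "G 0 \<noteq> 0" by (simp_all add: o_def G_def)
  obtain g where g: "g holomorphic_on UNIV" "g p \<noteq> 0" "\<And>z. G z = g z * (z - p) ^ nat (zorder G p)"
    using entire_factor_at[OF G] by blast
  have zo: "zorder G p = 1" using rGamma_simple[OF assms] by (simp add: G_def)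
  have "zorder zeta_reg p = 1"
  proof (rule zorder_eqI[of UNIV])
    show "(\<lambda>s. exp (s / 2 * of_real (ln pi)) * g s * xi_fun s) holomorphic_on UNIV"
      by (intro holomorphic_intros g xi_holomorphic) auto
    have "p \<notin> Xi.Z" using zeta_reg_zeros(2) assms by auto
    thus "exp (p / 2 * of_real (ln pi)) * g p * xi_fun p \<noteq> 0"
      using g(2) by (simp add: Xi.Z_def)
    show "zeta_reg w = exp (w / 2 * of_real (ln pi)) * g w * xi_fun w * (w - p) powi 1" for w
      using g(3)[of w, unfolded zo] by (simp add: zeta_reg_def G_def)
  qed auto
  thus ?thesis by (simp add: Zf.mult_def)
qed

end

section \<open>Bounds along a horizontal line\<close>

text \<open>Dividing \<open>f\<close> by its value c at the point moves the value to 1, away from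
  the branch cut of \<open>Ln\<close>; the real part of \<open>Ln\<close> is the logarithm of the
  modulus, and ln |c| is added back.\<close>

lemma ln_cmod_line_derivative:
  assumes f: "(f has_field_derivative D) (at (Complex x t))" and ne: "f (Complex x t) \<noteq> 0"
  shows "((\<lambda>x. ln (norm (f (Complex x t)))) has_real_derivative Re (D / f (Complex x t))) (at x)"
proof -
  define c where "c = f (Complex x t)"
  have c: "c \<noteq> 0" using ne by (simp add: c_def)
  have line: "((\<lambda>x. Complex x t) has_vector_derivative 1) (at x)"
  proof -
    have "((\<lambda>x::real. complex_of_real x) has_vector_derivative of_real 1) (at x)"
      by (rule bounded_linear.has_vector_derivative[OF bounded_linear_of_real has_vector_derivative_id])
    from has_vector_derivative_add[OF this has_vector_derivative_const[of "\<i> * of_real t"]]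
    have "((\<lambda>x. of_real x + \<i> * of_real t) has_vector_derivative 1) (at x)" by simp
    moreover have "(\<lambda>x. Complex x t) = (\<lambda>x. of_real x + \<i> * of_real t)" by (rule ext) (rule Complex_eq)
    ultimately show ?thesis by simp
  qed
  have one: "f (Complex x t) / c = 1" using c by (simp add: c_def)
  have "(Ln has_field_derivative inverse (f (Complex x t) / c)) (at (f (Complex x t) / c))"
    by (rule has_field_derivative_Ln) (simp add: one)
  from DERIV_chain2[OF this DERIV_cdivide[OF f]]
  have "((\<lambda>z. Ln (f z / c)) has_field_derivative D / c) (at (Complex x t))" by (simp add: one)
  from field_vector_diff_chain_at[OF line this]
  have "((\<lambda>x. Ln (f (Complex x t) / c)) has_vector_derivative D / c) (at x)" by (simp add: o_def)
  hence "((\<lambda>x. Re (Ln (f (Complex x t) / c))) has_vector_derivative Re (D / c)) (at x)"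
    by (rule bounded_linear.has_vector_derivative[OF bounded_linear_Re])
  hence "((\<lambda>x. Re (Ln (f (Complex x t) / c))) has_real_derivative Re (D / c)) (at x)"
    by (simp only: has_real_derivative_iff_has_vector_derivative)
  from DERIV_add[OF this DERIV_const[of "ln (norm c)"]]
  have 1: "((\<lambda>x. Re (Ln (f (Complex x t) / c)) + ln (norm c)) has_real_derivative Re (D / c)) (at x)" by simp
  have "((\<lambda>x. f (Complex x t)) has_vector_derivative D) (at x)"
    using field_vector_diff_chain_at[OF line f] by (simp add: o_def)
  hence "isCont (\<lambda>x. f (Complex x t)) x" by (rule has_vector_derivative_continuous)
  hence "eventually (\<lambda>x. f (Complex x t) \<noteq> 0) (at x)"
    using ne by (intro tendsto_imp_eventually_ne) (auto simp: isCont_def)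
  hence "eventually (\<lambda>x. f (Complex x t) \<noteq> 0) (nhds x)" using ne by (simp add: eventually_nhds_conv_at)
  hence "eventually (\<lambda>x. Re (Ln (f (Complex x t) / c)) + ln (norm c) = ln (norm (f (Complex x t)))) (nhds x)"
    by eventually_elim (use c in \<open>simp add: norm_divide ln_div\<close>)
  with 1 show ?thesis unfolding c_def[symmetric] by (subst DERIV_cong_ev[OF refl _ refl, symmetric])
qed

text \<open>Digamma z is the limit of ln m minus the sum of 1 / (z + n) over n < m. All summands
  have nonnegative real part, and for n >= b the real part is at least 1 / (a + b + n) because b^2
  <= (a + n) b. Comparison with logarithms leaves ln (a + b + N), where N is b rounded up.\<close>

lemma Re_Digamma_le:
  fixes z :: complex
  assumes a: "Re z \<ge> 1"
  shows "Re (Digamma z) \<le> ln (Re z + 2 * \<bar>Im z\<bar> + 1)"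
proof -
  define a b N where "a = Re z" and "b = \<bar>Im z\<bar>" and "N = nat \<lceil>b\<rceil>"
  have ab: "a \<ge> 1" "b \<ge> 0" "b \<le> real N" "real N \<le> b + 1" using a by (auto simp: a_def b_def N_def)
  have z0: "z \<noteq> 0" using a by auto
  have lim: "(\<lambda>m. Re (of_real (ln (real m)) - (\<Sum>n<m. inverse (z + of_nat n)))) \<longlonglongrightarrow> Re (Digamma z)"
    by (intro tendsto_Re Digamma_LIMSEQ z0)
  have term_nonneg: "Re (inverse (z + of_nat n)) \<ge> 0" for n using ab by (simp add: a_def)
  have term_ge: "1 / (a + b + real n) \<le> Re (inverse (z + of_nat n))" if "n \<ge> N" for n
  proof -
    have "real n \<ge> b" using that ab by linarith
    hence "b * b \<le> (a + real n) * b" using ab by (intro mult_right_mono) auto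
    moreover have "(Im z)\<^sup>2 = b * b" by (simp add: b_def power2_eq_square abs_mult_self_eq)
    ultimately have "(a + real n)\<^sup>2 + (Im z)\<^sup>2 \<le> (a + real n) * (a + b + real n)"
      by (simp add: power2_eq_square algebra_simps)
    moreover have pos: "(a + real n)\<^sup>2 + (Im z)\<^sup>2 > 0" "a + b + real n > 0" using ab by (simp_all add: add_pos_nonneg)
    ultimately have "1 / (a + b + real n) \<le> (a + real n) / ((a + real n)\<^sup>2 + (Im z)\<^sup>2)"
      by (simp only: pos_le_divide_eq[OF pos(1)] pos_divide_le_eq[OF pos(2)] times_divide_eq_left mult_1 times_divide_eq_right)
    thus ?thesis by (simp add: a_def)
  qed
  have sumlog: "ln (a + b + real m) - ln (a + b + real N) \<le> (\<Sum>n\<in>{N..<m}. 1 / (a + b + real n))" if "m \<ge> N" for m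
    using that
  proof (induction m rule: dec_induct)
    case (step m)
    define y where "y = a + b + real m"
    have y: "y > 0" using ab by (simp add: y_def)
    have "1 + 1 / y = (y + 1) / y" using y by (simp add: field_simps)
    hence "ln (y + 1) - ln y = ln (1 + 1 / y)" using y by (simp add: ln_div)
    also have "\<dots> \<le> 1 / y" using y by (intro ln_add_one_self_le_self) auto
    finally show ?case using step by (simp add: y_def algebra_simps)
  qed auto
  show ?thesis
  proof (rule LIMSEQ_le_const2[OF lim])
    have "Re (of_real (ln (real m)) - (\<Sum>n<m. inverse (z + of_nat n))) \<le> ln (a + 2 * b + 1)" if m: "m \<ge> N + 1" for m
    proof -
      have "(\<Sum>n\<in>{N..<m}. 1 / (a + b + real n)) \<le> (\<Sum>n\<in>{N..<m}. Re (inverse (z + of_nat n)))"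
        by (intro sum_mono term_ge) auto
      also have "\<dots> \<le> (\<Sum>n<m. Re (inverse (z + of_nat n)))"
        by (rule sum_mono2) (simp, force, rule term_nonneg)
      finally have "ln (a + b + real m) - ln (a + b + real N) \<le> (\<Sum>n<m. Re (inverse (z + of_nat n)))"
        using sumlog[of m] m by simp
      moreover have "ln (real m) \<le> ln (a + b + real m)" using m ab by (intro ln_mono) auto
      moreover have "ln (a + b + real N) \<le> ln (a + 2 * b + 1)" using ab by (intro ln_mono) auto
      ultimately show ?thesis by (simp only: minus_complex.simps Re_complex_of_real Re_sum)
    qed
    thus "\<exists>M. \<forall>m\<ge>M. Re (of_real (ln (real m)) - (\<Sum>n<m. inverse (z + of_nat n))) \<le> ln (Re z + 2 * \<bar>Im z\<bar> + 1)"
      unfolding a_def[symmetric] b_def[symmetric] by blast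
  qed
qed

lemma xi_deriv: "(xi_fun has_field_derivative deriv xi_fun s) (at s)"
  using holomorphic_derivI[OF xi_holomorphic[of UNIV]] by auto

lemma zeta_deriv: "s \<noteq> 1 \<Longrightarrow> (zeta has_field_derivative deriv zeta s) (at s)"
  using holomorphic_derivI[OF zeta_holomorphic] by auto

lemma trivial_zero_Re: "p \<in> trivial_zeros \<Longrightarrow> Re p \<le> - 2"
  by (auto simp: trivial_zeros_def)

lemma zeta_nonzero_right:
  assumes RH: "Riemann_Hypothesis" and s: "Re s > 1"
  shows "zeta s \<noteq> 0"
proof
  assume "zeta s = 0"
  moreover have "s \<noteq> 1" using s by auto
  ultimately have "Re s = 1/2 \<or> s \<in> trivial_zeros" by (rule zeta_zero_cases[OF RH])
  thus False using s trivial_zero_Re[of s] by auto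
qed

context
  fixes t :: real
  assumes RH: "Riemann_Hypothesis" and t: "t \<ge> 10"
    and ord: "\<not> (\<exists>\<rho> \<in> zeta_zeros. Im \<rho> = t)"
begin

lemma line_notin_Z: "Complex \<sigma> t \<notin> Xi.Z"
proof
  assume "Complex \<sigma> t \<in> Xi.Z"
  hence "Complex \<sigma> t \<in> zeta_zeros" by (rule xi_zero(2)[OF RH])
  moreover have "Im (Complex \<sigma> t) = t" by simp
  ultimately show False using ord by blast
qed

lemma line_ne_1: "Complex \<sigma> t \<noteq> 1"
  using t by (auto simp: complex_eq_iff)

lemma zeta_line_nonzero: "zeta (Complex \<sigma> t) \<noteq> 0"
proof
  assume "zeta (Complex \<sigma> t) = 0"
  hence "Complex \<sigma> t \<in> zeta_zeros" using line_ne_1[of \<sigma>] by (simp add: zeta_zeros_def)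
  moreover have "Im (Complex \<sigma> t) = t" by simp
  ultimately show False using ord by blast
qed

lemma xi_line_nonzero: "xi_fun (Complex \<sigma> t) \<noteq> 0"
  using line_notin_Z[of \<sigma>] by (simp add: Xi.Z_def)

definition line_zero_sum :: "real \<Rightarrow> real" where
  "line_zero_sum \<sigma> = (\<Sum>\<^sub>\<infinity>p\<in>Xi.Z. real (Xi.mult p) / (norm (Complex \<sigma> t - p))\<^sup>2)"

text \<open>Reflection followed by conjugation preserves the line and exchanges x with 1 - x, so ln
  |xi| is symmetric about x = 1/2 and its derivative vanishes there. This supplies the real part of
  the unknown constant in the expansion of xi'/xi.\<close>

lemma Re_xi_half: "Re (deriv xi_fun (Complex (1/2) t) / xi_fun (Complex (1/2) t)) = 0"
proof -
  define \<phi> where "\<phi> = (\<lambda>x. ln (norm (xi_fun (Complex x t))))"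
  define D where "D = Re (deriv xi_fun (Complex (1/2) t) / xi_fun (Complex (1/2) t))"
  have sym: "\<phi> (1 - x) = \<phi> x" for x
  proof -
    have "Complex (1 - x) t = 1 - cnj (Complex x t)" by (simp add: complex_eq_iff)
    hence "xi_fun (Complex (1 - x) t) = cnj (xi_fun (Complex x t))" by (simp only: xi_reflect xi_cnj)
    thus ?thesis by (simp add: \<phi>_def)
  qed
  have 1: "(\<phi> has_real_derivative D) (at (1/2))"
    unfolding \<phi>_def D_def by (rule ln_cmod_line_derivative[OF xi_deriv xi_line_nonzero])
  have "((\<lambda>x::real. 1 - x) has_real_derivative - 1) (at (1/2))" by (auto intro!: derivative_eq_intros)
  moreover have "(\<phi> has_real_derivative D) (at (1 - 1/2))" using 1 by simp
  ultimately have "((\<lambda>x. \<phi> (1 - x)) has_real_derivative D * (- 1)) (at (1/2))"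
    by (rule DERIV_chain2[rotated])
  moreover have "(\<lambda>x. \<phi> (1 - x)) = \<phi>" by (rule ext) (rule sym)
  ultimately have "(\<phi> has_real_derivative - D) (at (1/2))" by simp
  with 1 have "D = - D" by (rule DERIV_unique)
  thus ?thesis by (simp add: D_def)
qed

lemma summable_line_zero_sum: "(\<lambda>p. real (Xi.mult p) / (norm (Complex \<sigma> t - p))\<^sup>2) summable_on Xi.Z"
proof -
  obtain \<delta> where d: "\<delta> > 0" "\<And>p. p \<in> Xi.Z \<Longrightarrow> \<delta> \<le> norm (Complex \<sigma> t - p)"
    using Xi.dist_Z[OF line_notin_Z[of \<sigma>]] by blast
  show ?thesis by (rule Xi.summable_inverse_square(1)[OF d])
qed

text \<open>The reference point w lies on the critical line, where w - p is purely imaginary for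
  every zero p; its terms have real part 0, and by \<open>Re_xi_half\<close> so does the value of
  xi'/xi at w.\<close>

lemma Re_xi_logderiv: "Re (deriv xi_fun (Complex \<sigma> t) / xi_fun (Complex \<sigma> t)) = (\<sigma> - 1/2) * line_zero_sum \<sigma>"
proof -
  define z w where "z = Complex \<sigma> t" and "w = Complex (1/2) t"
  have "((\<lambda>p. Re (of_nat (Xi.mult p) / (z - p) - of_nat (Xi.mult p) / (w - p))) has_sum
     Re (deriv xi_fun z / xi_fun z - deriv xi_fun w / xi_fun w)) Xi.Z"
    unfolding z_def w_def by (intro has_sum_Re Xi.has_sum_logderiv_diff line_notin_Z)
  also have "?this \<longleftrightarrow> ((\<lambda>p. (\<sigma> - 1/2) * (real (Xi.mult p) / (norm (z - p))\<^sup>2)) has_sum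
     Re (deriv xi_fun z / xi_fun z - deriv xi_fun w / xi_fun w)) Xi.Z"
  proof (rule has_sum_cong)
    fix p assume "p \<in> Xi.Z"
    hence p: "Re p = 1/2" by (rule xi_zero(1)[OF RH])
    have "Re (of_nat (Xi.mult p) / (z - p)) = real (Xi.mult p) * Re (z - p) / (norm (z - p))\<^sup>2"
      by (simp add: Re_divide cmod_power2)
    moreover have "Re (of_nat (Xi.mult p) / (w - p)) = 0"
      by (simp add: Re_divide w_def p)
    ultimately show "Re (of_nat (Xi.mult p) / (z - p) - of_nat (Xi.mult p) / (w - p)) =
      (\<sigma> - 1/2) * (real (Xi.mult p) / (norm (z - p))\<^sup>2)"
      by (simp add: p z_def)
  qed
  finally have "(\<Sum>\<^sub>\<infinity>p\<in>Xi.Z. (\<sigma> - 1/2) * (real (Xi.mult p) / (norm (z - p))\<^sup>2)) =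
    Re (deriv xi_fun z / xi_fun z - deriv xi_fun w / xi_fun w)" by (rule infsumI)
  hence "(\<sigma> - 1/2) * line_zero_sum \<sigma> = Re (deriv xi_fun z / xi_fun z - deriv xi_fun w / xi_fun w)"
    unfolding line_zero_sum_def z_def[symmetric] infsum_cmult_right' .
  thus ?thesis using Re_xi_half by (simp add: z_def w_def)
qed

lemma line_zero_sum_nonneg: "line_zero_sum \<sigma> \<ge> 0"
  unfolding line_zero_sum_def by (intro infsum_nonneg) auto

text \<open>All zeros have real part 1/2, so moving right from there increases the distance to each
  of them.\<close>

lemma line_zero_sum_antimono:
  assumes "1/2 \<le> \<sigma>" "\<sigma> \<le> \<sigma>'"
  shows "line_zero_sum \<sigma>' \<le> line_zero_sum \<sigma>"
  unfolding line_zero_sum_def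
proof (rule infsum_mono[OF summable_line_zero_sum summable_line_zero_sum])
  fix p assume p: "p \<in> Xi.Z"
  have "(norm (Complex \<sigma> t - p))\<^sup>2 \<le> (norm (Complex \<sigma>' t - p))\<^sup>2"
    using assms xi_zero(1)[OF RH p] unfolding cmod_power2 by (auto intro!: power_mono)
  moreover have pos: "(norm (Complex \<sigma>'' t - p))\<^sup>2 > 0" for \<sigma>'' using line_notin_Z[of \<sigma>''] p by auto
  ultimately show "real (Xi.mult p) / (norm (Complex \<sigma>' t - p))\<^sup>2 \<le> real (Xi.mult p) / (norm (Complex \<sigma> t - p))\<^sup>2"
    by (intro divide_left_mono mult_pos_pos pos) auto
qed

lemma zeta_logderiv:
  assumes "\<sigma> > 0"
  shows "deriv zeta (Complex \<sigma> t) / zeta (Complex \<sigma> t) = of_real (ln pi) / 2 - Digamma (Complex \<sigma> t / 2 + 1) / 2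
    + deriv xi_fun (Complex \<sigma> t) / xi_fun (Complex \<sigma> t) - 1 / (Complex \<sigma> t - 1)"
proof -
  define s where "s = Complex \<sigma> t"
  have s1: "s \<noteq> 1" and zn: "zeta s \<noteq> 0" and xn: "xi_fun s \<noteq> 0"
    unfolding s_def by (fact line_ne_1 zeta_line_nonzero xi_line_nonzero)+
  have nn: "s / 2 + 1 \<notin> \<int>\<^sub>\<le>\<^sub>0"
  proof
    assume "s / 2 + 1 \<in> \<int>\<^sub>\<le>\<^sub>0"
    then obtain n where "s / 2 + 1 = - of_nat n" by (auto elim!: nonpos_Ints_cases')
    hence "Re (s / 2 + 1) = - real n" by simp
    thus False using assms by (simp add: s_def)
  qed
  have rn: "rGamma (s / 2 + 1) \<noteq> 0" using nn by (simp add: rGamma_eq_zero_iff)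
  have zs: "zeta_reg s \<noteq> 0" using zeta_reg_eq[OF s1] zn s1 by simp
  have d1: "(zeta_reg has_field_derivative (zeta s + (s - 1) * deriv zeta s)) (at s)"
  proof -
    have "((\<lambda>s. (s - 1) * zeta s) has_field_derivative (zeta s + (s - 1) * deriv zeta s)) (at s)"
      using zeta_deriv[OF s1] by (auto intro!: derivative_eq_intros)
    moreover have "eventually (\<lambda>w. w \<in> - {1}) (nhds s)" using s1 by (intro eventually_nhds_in_open) auto
    hence "eventually (\<lambda>w. zeta_reg w = (w - 1) * zeta w) (nhds s)" by eventually_elim (simp add: zeta_reg_eq)
    ultimately show ?thesis by (subst DERIV_cong_ev[OF refl _ refl])
  qed
  have d2: "(zeta_reg has_field_derivative (exp (s / 2 * of_real (ln pi)) * rGamma (s / 2 + 1) * xi_fun s) *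
     (of_real (ln pi) / 2 - Digamma (s / 2 + 1) / 2 + deriv xi_fun s / xi_fun s)) (at s)"
  proof -
    have e: "((\<lambda>s. exp (s / 2 * of_real (ln pi))) has_field_derivative exp (s / 2 * of_real (ln pi)) * (of_real (ln pi) / 2)) (at s)"
      by (auto intro!: derivative_eq_intros)
    have r: "((\<lambda>s. rGamma (s / 2 + 1)) has_field_derivative (- rGamma (s / 2 + 1) * Digamma (s / 2 + 1)) * (1/2)) (at s)"
      by (rule DERIV_chain2[where f = rGamma and g = "\<lambda>s. s / 2 + 1" and x = s, OF has_field_derivative_rGamma_no_nonpos_int[OF nn]])
        (auto intro!: derivative_eq_intros)
    show ?thesis unfolding zeta_reg_def[abs_def]
      by (rule DERIV_cong[OF DERIV_mult[OF DERIV_mult[OF e r] xi_deriv]]) (use xn in \<open>simp add: field_simps\<close>)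
  qed
  have "zeta s + (s - 1) * deriv zeta s = (s - 1) * zeta s *
     (of_real (ln pi) / 2 - Digamma (s / 2 + 1) / 2 + deriv xi_fun s / xi_fun s)"
    using DERIV_unique[OF d1 d2] zeta_reg_eq[OF s1] by (simp add: zeta_reg_def)
  hence "(zeta s + (s - 1) * deriv zeta s) / ((s - 1) * zeta s) =
     of_real (ln pi) / 2 - Digamma (s / 2 + 1) / 2 + deriv xi_fun s / xi_fun s"
    using zn s1 by simp
  moreover have "(zeta s + (s - 1) * deriv zeta s) / ((s - 1) * zeta s) = 1 / (s - 1) + deriv zeta s / zeta s"
    using zn s1 by (simp add: field_simps)
  ultimately show ?thesis unfolding s_def[symmetric] by (simp add: algebra_simps)
qed

text \<open>For \<sigma> <= 3 and t >= 10 the argument of the logarithm in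
  \<open>Re_Digamma_le\<close> is at most t + 7/2 <= 2t. The Digamma term then costs (ln t + 1) / 2
  and the pole term 1, which fits under ln t / 2 + 3; the term with ln pi has the favourable
  sign.\<close>

lemma neg_logderiv_bound:
  assumes \<sigma>: "1/2 \<le> \<sigma>" "\<sigma> \<le> 3"
  shows "- Re (deriv zeta (Complex \<sigma> t) / zeta (Complex \<sigma> t)) \<le> ln t / 2 + 3 - (\<sigma> - 1/2) * line_zero_sum \<sigma>"
proof -
  define s where "s = Complex \<sigma> t"
  have "Re (Digamma (s / 2 + 1)) \<le> ln (Re (s / 2 + 1) + 2 * \<bar>Im (s / 2 + 1)\<bar> + 1)"
    using \<sigma> by (intro Re_Digamma_le) (simp add: s_def)
  also have "\<dots> \<le> ln (2 * t)"
    using \<sigma> t by (intro ln_mono) (auto simp: s_def)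
  also have "\<dots> \<le> ln t + 1" using t ln2_le_25_over_36 by (simp add: ln_mult)
  finally have 1: "Re (Digamma (s / 2 + 1)) \<le> ln t + 1" .
  have "Re (1 / (s - 1)) \<le> norm (1 / (s - 1))" by (rule complex_Re_le_cmod)
  also have "\<dots> \<le> 1"
  proof -
    have "1 \<le> norm (s - 1)" using abs_Im_le_cmod[of "s - 1"] t by (simp add: s_def)
    thus ?thesis by (simp add: norm_divide divide_le_eq)
  qed
  finally have 2: "Re (1 / (s - 1)) \<le> 1" .
  have "ln pi \<ge> 0" using pi_gt3 by simp
  moreover have "Re (deriv zeta s / zeta s) = ln pi / 2 - Re (Digamma (s / 2 + 1)) / 2 + (\<sigma> - 1/2) * line_zero_sum \<sigma> - Re (1 / (s - 1))"
    using zeta_logderiv[of \<sigma>] Re_xi_logderiv[of \<sigma>] \<sigma> by (simp add: s_def)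
  ultimately show ?thesis using 1 2 unfolding s_def[symmetric] by linarith
qed

text \<open>The auxiliary function \<phi> is nondecreasing on [1/2, \<sigma>]; the quadratic term
  comes from freezing the zero sum at \<sigma>, where it is smallest.\<close>

lemma zeta_half_line_bound:
  assumes \<sigma>: "1/2 \<le> \<sigma>" "\<sigma> \<le> 3"
  shows "ln (norm (zeta (Complex (1/2) t))) \<le> ln (norm (zeta (Complex \<sigma> t))) + (\<sigma> - 1/2) * (ln t / 2 + 3) - (\<sigma> - 1/2)\<^sup>2 / 2 * line_zero_sum \<sigma>"
proof -
  define A where "A = ln t / 2 + 3"
  define \<phi> where "\<phi> = (\<lambda>x. ln (norm (zeta (Complex x t))) + (x - 1/2) * A - (x - 1/2)\<^sup>2 / 2 * line_zero_sum \<sigma>)"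
  have "\<phi> (1/2) \<le> \<phi> \<sigma>"
  proof (rule DERIV_nonneg_imp_nondecreasing[OF \<sigma>(1)])
    fix x assume x: "1/2 \<le> x" "x \<le> \<sigma>"
    have "(\<phi> has_real_derivative Re (deriv zeta (Complex x t) / zeta (Complex x t)) + A - (x - 1/2) * line_zero_sum \<sigma>) (at x)"
    proof -
      note 1 = ln_cmod_line_derivative[OF zeta_deriv[OF line_ne_1] zeta_line_nonzero, of x]
      have 2: "((\<lambda>x. (x - 1/2) * A) has_real_derivative A) (at x)"
        by (auto intro!: derivative_eq_intros)
      have 3: "((\<lambda>x. (x - 1/2)\<^sup>2 / 2 * line_zero_sum \<sigma>) has_real_derivative (x - 1/2) * line_zero_sum \<sigma>) (at x)"
        by (auto intro!: derivative_eq_intros simp: field_simps)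
      show ?thesis unfolding \<phi>_def by (rule DERIV_diff[OF DERIV_add[OF 1 2] 3])
    qed
    moreover have "(x - 1/2) * line_zero_sum \<sigma> \<le> (x - 1/2) * line_zero_sum x"
      using x by (intro mult_left_mono line_zero_sum_antimono) auto
    hence "0 \<le> Re (deriv zeta (Complex x t) / zeta (Complex x t)) + A - (x - 1/2) * line_zero_sum \<sigma>"
      using neg_logderiv_bound[of x] x \<sigma> unfolding A_def by linarith
    ultimately show "\<exists>y. (\<phi> has_real_derivative y) (at x) \<and> 0 \<le> y" by blast
  qed
  thus ?thesis by (simp add: \<phi>_def A_def)
qed

end

section \<open>The explicit formula\<close>

text \<open>For n >= 2 and \<sigma> >= 3 one has n^(-\<sigma>) <= 2^(3 - \<sigma>) n^(-3), which
  extracts a common decaying factor from all terms after the first.\<close>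

lemma dirichlet_series_limit:
  fixes a :: "nat \<Rightarrow> complex"
  assumes H: "\<And>x. x < -1 \<Longrightarrow> summable (\<lambda>n. norm (a n) * real (Suc n) powr x)"
  shows "((\<lambda>\<sigma>. dirichlet_series a (Complex \<sigma> t)) \<longlongrightarrow> a 0) at_top"
proof -
  define C where "C = (\<Sum>n. norm (a (Suc n)) * real (Suc (Suc n)) powr - 3)"
  have sC: "summable (\<lambda>n. norm (a (Suc n)) * real (Suc (Suc n)) powr - 3)"
    using H[of "-3"] by (subst summable_Suc_iff[of "\<lambda>n. norm (a n) * real (Suc n) powr - 3"]) auto
  have bd: "norm (dirichlet_series a (Complex \<sigma> t) - a 0) \<le> 2 powr (3 - \<sigma>) * C" if \<sigma>: "\<sigma> \<ge> 3" for \<sigma>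
  proof -
    define s where "s = Complex \<sigma> t"
    have abs: "summable (\<lambda>n. norm (a n * nat_powr_minus s (Suc n)))" and sums: "(\<lambda>n. a n * nat_powr_minus s (Suc n)) sums dirichlet_series a s"
      using dirichlet_series_properties[OF H, of s] \<sigma> by (auto simp: s_def)
    have le: "norm (a (Suc n) * nat_powr_minus s (Suc (Suc n))) \<le> 2 powr (3 - \<sigma>) * (norm (a (Suc n)) * real (Suc (Suc n)) powr - 3)" for n
    proof -
      have "real (Suc (Suc n)) powr (3 - \<sigma>) \<le> 2 powr (3 - \<sigma>)"
        using \<sigma> by (intro powr_mono2') auto
      have "real (Suc (Suc n)) powr - \<sigma> = real (Suc (Suc n)) powr (3 - \<sigma>) * real (Suc (Suc n)) powr - 3"
        by (simp add: powr_add[symmetric] del: of_nat_Suc)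
      also have "\<dots> \<le> 2 powr (3 - \<sigma>) * real (Suc (Suc n)) powr - 3"
        using \<sigma> by (intro mult_right_mono powr_mono2') auto
      finally have "norm (a (Suc n)) * real (Suc (Suc n)) powr - \<sigma> \<le> norm (a (Suc n)) * (2 powr (3 - \<sigma>) * real (Suc (Suc n)) powr - 3)"
        by (intro mult_left_mono) auto
      thus ?thesis by (simp add: norm_mult norm_nat_powr_minus s_def mult_ac del: of_nat_Suc)
    qed
    have "dirichlet_series a s = a 0 * nat_powr_minus s (Suc 0) + (\<Sum>n. a (Suc n) * nat_powr_minus s (Suc (Suc n)))"
      unfolding dirichlet_series_def using suminf_split_head[OF sums_summable[OF sums]] by simp
    hence "dirichlet_series a s - a 0 = (\<Sum>n. a (Suc n) * nat_powr_minus s (Suc (Suc n)))" by (simp add: nat_powr_minus_def)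
    also have "norm \<dots> \<le> (\<Sum>n. 2 powr (3 - \<sigma>) * (norm (a (Suc n)) * real (Suc (Suc n)) powr - 3))"
      by (rule norm_suminf_le[OF le]) (intro summable_mult sC)
    also have "\<dots> = 2 powr (3 - \<sigma>) * C" unfolding C_def by (rule suminf_mult[OF sC])
    finally show ?thesis by (simp add: s_def)
  qed
  have "((\<lambda>\<sigma>::real. 2 powr (3 - \<sigma>)) \<longlongrightarrow> 0) at_top" by real_asymp
  from tendsto_mult_left_zero[OF this, of C]
  have "((\<lambda>\<sigma>. 2 powr (3 - \<sigma>) * C) \<longlongrightarrow> 0) at_top" .
  hence "((\<lambda>\<sigma>. dirichlet_series a (Complex \<sigma> t) - a 0) \<longlongrightarrow> 0) at_top"
    by (rule Lim_null_comparison[rotated]) (rule eventually_mono[OF eventually_ge_at_top[of 3]], rule bd)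
  thus ?thesis by (rule Lim_null[THEN iffD2])
qed

lemma zeta_logderiv_dirichlet_series:
  assumes RH: "Riemann_Hypothesis" and s: "Re s > 1"
  shows "deriv zeta s / zeta s = - dirichlet_series mang_coeff s"
    "deriv (\<lambda>s. deriv zeta s / zeta s) s = - dirichlet_series (\<lambda>n. - of_real (ln (real (Suc n))) * mang_coeff n) s"
proof -
  have op: "open {s. Re s > 1}" by (rule open_halfspace_Re_gt)
  have eq: "deriv zeta s / zeta s = - dirichlet_series mang_coeff s" if s: "Re s > 1" for s
  proof -
    have "eventually (\<lambda>w. w \<in> {s. Re s > 1}) (nhds s)" using s op by (intro eventually_nhds_in_open) auto
    hence "eventually (\<lambda>w. zeta w = dirichlet_series one_coeff w) (nhds s)" by eventually_elim (simp add: zeta_dirichlet_series)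
    hence "deriv zeta s = deriv (dirichlet_series one_coeff) s" by (intro deriv_cong_ev) auto
    also have "\<dots> = - dirichlet_series one_coeff s * dirichlet_series mang_coeff s"
      using DERIV_imp_deriv[OF dirichlet_series_properties(3)[OF one_coeff_summable s]] log_series_factor[OF s] by simp
    finally have "deriv zeta s = - zeta s * dirichlet_series mang_coeff s" using zeta_dirichlet_series[OF s] by simp
    moreover have "zeta s \<noteq> 0" by (rule zeta_nonzero_right[OF RH s])
    ultimately show ?thesis by simp
  qed
  show "deriv zeta s / zeta s = - dirichlet_series mang_coeff s" by (rule eq[OF s])
  have "eventually (\<lambda>w. w \<in> {s. Re s > 1}) (nhds s)" using s op by (intro eventually_nhds_in_open) auto
  hence "eventually (\<lambda>w. deriv zeta w / zeta w = - dirichlet_series mang_coeff w) (nhds s)" by eventually_elim (simp add: eq)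
  hence "deriv (\<lambda>s. deriv zeta s / zeta s) s = deriv (\<lambda>s. - dirichlet_series mang_coeff s) s" by (intro deriv_cong_ev) auto
  also have "\<dots> = - dirichlet_series (\<lambda>n. - of_real (ln (real (Suc n))) * mang_coeff n) s"
    by (rule DERIV_imp_deriv[OF DERIV_minus[OF dirichlet_series_properties(3)[OF mang_coeff_summable s]]])
  finally show "deriv (\<lambda>s. deriv zeta s / zeta s) s = - dirichlet_series (\<lambda>n. - of_real (ln (real (Suc n))) * mang_coeff n) s" .
qed

section \<open>The smoothed sum up to x, its tail, and the explicit formula\<close>

context
  fixes x :: real
  assumes RH: "Riemann_Hypothesis" and x: "x \<ge> 2"
begin

definition sum_range :: "nat set" where "sum_range = {n. 2 \<le> n \<and> real n \<le> x}"

text \<open>Up to the factor - x^s, these are the terms n <= x in the Dirichlet expansion of the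
  derivative of x^s zeta'(s) / zeta(s); differentiating the weight produces ln x - ln n.\<close>

definition smoothed_sum :: "complex \<Rightarrow> complex" where
  "smoothed_sum s = (\<Sum>n\<in>sum_range. mangoldt n * of_real (ln x - ln (real n)) * nat_powr_minus s n)"

lemma finite_sum_range: "finite sum_range"
proof -
  have "sum_range \<subseteq> {..nat \<lfloor>x\<rfloor>}" unfolding sum_range_def by (auto simp: le_nat_floor)
  thus ?thesis using finite_subset by blast
qed

lemma ln_x_pos: "ln x > 0" using x by simp

lemma zeta_reg_zero_Re: "p \<in> Zf.Z \<Longrightarrow> Re p \<le> 1"
  unfolding zeta_reg_zeros(1)[OF RH] using xi_zero(1)[OF RH, of p] trivial_zero_Re[of p] by auto

definition tail_coeff :: "nat \<Rightarrow> complex" where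
  "tail_coeff n = (if real (Suc n) \<le> x then 0 else mangoldt (Suc n) * of_real (ln (real (Suc n)) - ln x))"

lemma tail_coeff_summable:
  assumes "y < -1" shows "summable (\<lambda>n. norm (tail_coeff n) * real (Suc n) powr y)"
proof (rule summable_comparison_test'[of _ 0])
  show "summable (\<lambda>n. norm (- of_real (ln (real (Suc n))) * mang_coeff n) * real (Suc n) powr y)"
    by (rule summable_ln_powr[OF assms mang_coeff_summable])
  fix n
  have "norm (tail_coeff n) \<le> norm (- of_real (ln (real (Suc n))) * mang_coeff n)"
  proof (cases "real (Suc n) \<le> x")
    case False
    hence "ln x \<le> ln (real (Suc n))" using x by (intro ln_mono) auto
    hence "\<bar>ln (real (Suc n)) - ln x\<bar> \<le> \<bar>ln (real (Suc n))\<bar>" using ln_x_pos by linarith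
    hence "mangoldt (Suc n) * \<bar>ln (real (Suc n)) - ln x\<bar> \<le> mangoldt (Suc n) * \<bar>ln (real (Suc n))\<bar>"
      by (intro mult_left_mono mangoldt_nonneg)
    moreover have "norm (tail_coeff n) = mangoldt (Suc n) * \<bar>ln (real (Suc n)) - ln x\<bar>"
      using False by (simp add: tail_coeff_def norm_mult del: of_nat_Suc of_real_diff)
    ultimately show ?thesis by (simp add: norm_mult mult.commute del: of_nat_Suc)
  qed (simp add: tail_coeff_def)
  thus "norm (norm (tail_coeff n) * real (Suc n) powr y) \<le> norm (- of_real (ln (real (Suc n))) * mang_coeff n) * real (Suc n) powr y"
    by (simp add: abs_mult mult_right_mono del: of_nat_Suc)
qed

text \<open>The first two terms together have the coefficients mangoldt n * (ln n - ln x), and the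
  smoothed sum removes exactly those with n <= x.\<close>

lemma smoothed_sum_identity:
  assumes s: "Re s > 1"
  shows "of_real (ln x) * (deriv zeta s / zeta s) + deriv (\<lambda>s. deriv zeta s / zeta s) s + smoothed_sum s = dirichlet_series tail_coeff s"
proof -
  define L where "L = ln x"
  note M = dirichlet_series_properties[OF mang_coeff_summable s]
  note M' = dirichlet_series_properties[OF summable_ln_powr[OF _ mang_coeff_summable] s]
  have 1: "(\<lambda>n. - of_real L * (mang_coeff n * nat_powr_minus s (Suc n)) - (- of_real (ln (real (Suc n))) * mang_coeff n * nat_powr_minus s (Suc n))) sums
     (- of_real L * dirichlet_series mang_coeff s - dirichlet_series (\<lambda>n. - of_real (ln (real (Suc n))) * mang_coeff n) s)"
    by (intro sums_diff sums_mult M(2) M'(2))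
  define A where "A = {n. real (Suc n) \<le> x}"
  have fA: "finite A"
  proof -
    have "A \<subseteq> {..nat \<lfloor>x\<rfloor>}" unfolding A_def by (auto simp: le_nat_floor)
    thus ?thesis using finite_subset by blast
  qed
  define G where "G = (\<lambda>n. mangoldt n * of_real (ln x - ln (real n)) * nat_powr_minus s n)"
  have 2: "(\<lambda>n. if n \<in> A then G (Suc n) else 0) sums (\<Sum>n\<in>A. G (Suc n))"
    by (rule sums_If_finite_set[OF fA])
  have "(\<Sum>n\<in>A. G (Suc n)) = (\<Sum>n\<in>Suc ` A. G n)" by (simp add: sum.reindex)
  also have "\<dots> = smoothed_sum s" unfolding smoothed_sum_def G_def
  proof (rule sum.mono_neutral_right)
    show "finite (Suc ` A)" using fA by simp
    show "sum_range \<subseteq> Suc ` A"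
    proof
      fix n assume n: "n \<in> sum_range"
      hence "n = Suc (n - 1)" "n - 1 \<in> A" by (auto simp: sum_range_def A_def)
      thus "n \<in> Suc ` A" by blast
    qed
    show "\<forall>i\<in>Suc ` A - sum_range. mangoldt i * of_real (ln x - ln (real i)) * nat_powr_minus s i = 0"
    proof
      fix i assume i: "i \<in> Suc ` A - sum_range"
      hence "i = Suc 0" by (auto simp: A_def sum_range_def)
      thus "mangoldt i * of_real (ln x - ln (real i)) * nat_powr_minus s i = 0" by simp
    qed
  qed
  finally have 3: "(\<Sum>n\<in>A. G (Suc n)) = smoothed_sum s" .
  have "(\<lambda>n. tail_coeff n * nat_powr_minus s (Suc n)) sums
     (- of_real L * dirichlet_series mang_coeff s - dirichlet_series (\<lambda>n. - of_real (ln (real (Suc n))) * mang_coeff n) s + smoothed_sum s)"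
    using sums_add[OF 1 2] unfolding 3
    by (rule sums_cong[THEN iffD1, rotated]) (auto simp: tail_coeff_def A_def G_def L_def algebra_simps simp del: of_nat_Suc)
  moreover have "(\<lambda>n. tail_coeff n * nat_powr_minus s (Suc n)) sums dirichlet_series tail_coeff s"
    by (rule dirichlet_series_properties(2)[OF tail_coeff_summable s])
  ultimately have "- of_real L * dirichlet_series mang_coeff s - dirichlet_series (\<lambda>n. - of_real (ln (real (Suc n))) * mang_coeff n) s + smoothed_sum s = dirichlet_series tail_coeff s"
    by (rule sums_unique2)
  thus ?thesis unfolding zeta_logderiv_dirichlet_series[OF RH s] L_def by simp
qed

text \<open>\<open>N\<close> is the first integer beyond x, so (x / n)^(Re s - 2) <= exp (- \<delta>
  (Re s - 2)) for every n in the tail, where \<delta> = ln N - ln x > 0. Hence the tail decays to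
  the right even after multiplication by x^s.\<close>

lemma tail_bound:
  obtains C \<delta> where "C \<ge> 0" "\<delta> > 0"
    "\<And>s. Re s \<ge> 2 \<Longrightarrow> norm (exp (of_real (ln x) * s) * dirichlet_series tail_coeff s) \<le> C * exp (- \<delta> * (Re s - 2))"
proof -
  define L where "L = ln x"
  define N where "N = Suc (nat \<lfloor>x\<rfloor>)"
  have N: "x < real N" "\<And>n. x < real n \<Longrightarrow> N \<le> n"
    unfolding N_def using x real_of_int_floor_add_one_gt[of x]
    by (auto simp: Suc_le_eq nat_less_iff floor_less_iff add.commute simp del: real_of_int_floor_add_one_gt)
  define \<delta> where "\<delta> = ln (real N) - L"
  have \<delta>: "\<delta> > 0" using N(1) x by (simp add: \<delta>_def L_def)
  have sm: "summable (\<lambda>n. norm (tail_coeff n) * real (Suc n) powr - 2)" by (rule tail_coeff_summable) simp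
  define C where "C = exp (2 * L) * (\<Sum>n. norm (tail_coeff n) * real (Suc n) powr - 2)"
  have C: "C \<ge> 0" unfolding C_def by (intro mult_nonneg_nonneg suminf_nonneg sm) auto
  have "norm (exp (of_real L * s) * dirichlet_series tail_coeff s) \<le> C * exp (- \<delta> * (Re s - 2))" if s: "Re s \<ge> 2" for s
  proof -
    have le: "norm (tail_coeff n * nat_powr_minus s (Suc n)) \<le>
      exp (- L * (Re s - 2)) * exp (- \<delta> * (Re s - 2)) * (norm (tail_coeff n) * real (Suc n) powr - 2)" for n
    proof (cases "real (Suc n) \<le> x")
      case False
      hence "N \<le> Suc n" using N(2)[of "Suc n"] by simp
      hence "ln (real N) \<le> ln (real (Suc n))" unfolding N_def by (intro ln_mono) auto
      hence "ln (real N) * (Re s - 2) \<le> ln (real (Suc n)) * (Re s - 2)" using s by (intro mult_right_mono) auto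
      hence "ln (real (Suc n)) * - Re s \<le> - L * (Re s - 2) + - \<delta> * (Re s - 2) + ln (real (Suc n)) * - 2"
        unfolding \<delta>_def by (simp add: algebra_simps)
      hence "exp (ln (real (Suc n)) * - Re s) \<le> exp (- L * (Re s - 2) + - \<delta> * (Re s - 2) + ln (real (Suc n)) * - 2)"
        by (simp only: exp_le_cancel_iff)
      moreover have "real (Suc n) powr y = exp (ln (real (Suc n)) * y)" for y
        by (simp add: powr_def mult.commute del: of_nat_Suc)
      ultimately have "real (Suc n) powr - Re s \<le> exp (- L * (Re s - 2)) * exp (- \<delta> * (Re s - 2)) * real (Suc n) powr - 2"
        by (simp only: exp_add)
      from mult_left_mono[OF this, of "norm (tail_coeff n)"] show ?thesis
        by (simp add: norm_mult norm_nat_powr_minus mult_ac del: of_nat_Suc)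
    qed (simp add: tail_coeff_def)
    have "norm (dirichlet_series tail_coeff s) \<le> (\<Sum>n. exp (- L * (Re s - 2)) * exp (- \<delta> * (Re s - 2)) * (norm (tail_coeff n) * real (Suc n) powr - 2))"
      unfolding dirichlet_series_def by (rule norm_suminf_le[OF le]) (intro summable_mult sm)
    also have "\<dots> = exp (- L * (Re s - 2)) * exp (- \<delta> * (Re s - 2)) * (\<Sum>n. norm (tail_coeff n) * real (Suc n) powr - 2)"
      by (rule suminf_mult[OF sm])
    finally have "norm (exp (of_real L * s) * dirichlet_series tail_coeff s) \<le>
      exp (L * Re s) * (exp (- L * (Re s - 2)) * exp (- \<delta> * (Re s - 2)) * (\<Sum>n. norm (tail_coeff n) * real (Suc n) powr - 2))"
      unfolding norm_mult by (intro mult_mono) auto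
    also have "\<dots> = (exp (L * Re s) * exp (- L * (Re s - 2))) * exp (- \<delta> * (Re s - 2)) * (\<Sum>n. norm (tail_coeff n) * real (Suc n) powr - 2)"
      by (simp only: mult.assoc)
    also have "exp (L * Re s) * exp (- L * (Re s - 2)) = exp (2 * L)"
      unfolding exp_add[symmetric] by (simp add: algebra_simps)
    finally show ?thesis by (simp add: C_def mult_ac)
  qed
  thus ?thesis using that[OF C \<delta>] by (simp add: L_def)
qed

lemma deriv_exp_quotient:
  fixes L :: real and s :: complex
  assumes "s \<noteq> 1"
  shows "deriv (\<lambda>s. exp (of_real L * s) / (s - 1)) s = exp (of_real L * s) * (of_real L / (s - 1) - 1 / (s - 1)\<^sup>2)"
proof (rule DERIV_imp_deriv)
  have "((\<lambda>s. exp (of_real L * s) / (s - 1)) has_field_derivative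
      (exp (of_real L * s) * of_real L * (s - 1) - exp (of_real L * s) * 1) / ((s - 1) * (s - 1))) (at s)"
    using assms by (intro DERIV_divide) (auto intro!: derivative_eq_intros)
  thus "((\<lambda>s. exp (of_real L * s) / (s - 1)) has_field_derivative exp (of_real L * s) * (of_real L / (s - 1) - 1 / (s - 1)\<^sup>2)) (at s)"
  proof (rule DERIV_cong)
    have "(e * l * d - e * 1) / (d * d) = e * (l / d - 1 / d\<^sup>2)" if "d \<noteq> 0" for e l d :: complex
      using that by (simp add: field_simps power2_eq_square)
    thus "(exp (of_real L * s) * of_real L * (s - 1) - exp (of_real L * s) * 1) / ((s - 1) * (s - 1)) =
      exp (of_real L * s) * (of_real L / (s - 1) - 1 / (s - 1)\<^sup>2)" using assms by simp
  qed
qed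

lemma zeta_reg_logderiv_zeta:
  assumes s1: "s \<noteq> 1" and zs: "zeta s \<noteq> 0"
  shows "s \<notin> Zf.Z" "deriv zeta_reg s / zeta_reg s = 1 / (s - 1) + deriv zeta s / zeta s"
proof -
  show "s \<notin> Zf.Z" using zeta_reg_eq[OF s1] s1 zs by (simp add: Zf.Z_def)
  have "((\<lambda>s. (s - 1) * zeta s) has_field_derivative (zeta s + (s - 1) * deriv zeta s)) (at s)"
    using zeta_deriv[OF s1] by (auto intro!: derivative_eq_intros)
  moreover have "eventually (\<lambda>w. w \<in> - {1}) (nhds s)" using s1 by (intro eventually_nhds_in_open) auto
  hence "eventually (\<lambda>w. zeta_reg w = (w - 1) * zeta w) (nhds s)" by eventually_elim (simp add: zeta_reg_eq)
  ultimately have "(zeta_reg has_field_derivative (zeta s + (s - 1) * deriv zeta s)) (at s)" by (subst DERIV_cong_ev[OF refl _ refl])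
  hence "deriv zeta_reg s = zeta s + (s - 1) * deriv zeta s" by (rule DERIV_imp_deriv)
  thus "deriv zeta_reg s / zeta_reg s = 1 / (s - 1) + deriv zeta s / zeta s"
  proof -
    assume d: "deriv zeta_reg s = zeta s + (s - 1) * deriv zeta s"
    have "(z + d * z') / (d * z) = 1 / d + z' / z" if "d \<noteq> 0" "z \<noteq> 0" for d z z' :: complex
      using that by (simp add: field_simps)
    thus "deriv zeta_reg s / zeta_reg s = 1 / (s - 1) + deriv zeta s / zeta s" unfolding d zeta_reg_eq[OF s1] using s1 zs by simp
  qed
qed

lemma weighted_logderiv_deriv_zeta:
  assumes s1: "s \<noteq> 1" and zs: "zeta s \<noteq> 0"
  shows "Zf.weighted_logderiv_deriv (ln x) s = exp (of_real (ln x) * s) * (of_real (ln x) / (s - 1) - 1 / (s - 1)\<^sup>2) +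
     exp (of_real (ln x) * s) * (of_real (ln x) * (deriv zeta s / zeta s) + deriv (\<lambda>s. deriv zeta s / zeta s) s)"
proof -
  define U where "U = {w. w \<noteq> 1 \<and> zeta w \<noteq> 0}"
  have "open U"
  proof -
    have "continuous_on (- {1}) zeta" by (rule holomorphic_on_imp_continuous_on[OF zeta_holomorphic])
    hence "open ((- {1}) \<inter> zeta -` (- {0}))" by (intro continuous_open_preimage) auto
    also have "(- {1}) \<inter> zeta -` (- {0}) = U" by (auto simp: U_def)
    finally show ?thesis .
  qed
  have sU: "s \<in> U" using assms by (simp add: U_def)
  have "eventually (\<lambda>w. w \<in> U) (nhds s)" using \<open>open U\<close> sU by (rule eventually_nhds_in_open)
  hence ev: "eventually (\<lambda>w. deriv zeta_reg w / zeta_reg w = 1 / (w - 1) + deriv zeta w / zeta w) (nhds s)"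
    by eventually_elim (rule zeta_reg_logderiv_zeta(2), auto simp: U_def)
  have "(\<lambda>w. deriv zeta w / zeta w) holomorphic_on U"
    using \<open>open U\<close> by (intro holomorphic_intros holomorphic_deriv holomorphic_on_subset[OF zeta_holomorphic]) (auto simp: U_def)
  hence 1: "((\<lambda>w. deriv zeta w / zeta w) has_field_derivative deriv (\<lambda>s. deriv zeta s / zeta s) s) (at s)"
    using holomorphic_derivI \<open>open U\<close> sU by blast
  have 2: "((\<lambda>w. 1 / (w - 1)) has_field_derivative - 1 / (s - 1)\<^sup>2) (at s)"
    using s1 by (auto intro!: derivative_eq_intros simp: power2_eq_square)
  have "deriv (\<lambda>w. deriv zeta_reg w / zeta_reg w) s = deriv (\<lambda>w. 1 / (w - 1) + deriv zeta w / zeta w) s"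
    by (rule deriv_cong_ev[OF ev refl])
  also have "\<dots> = - 1 / (s - 1)\<^sup>2 + deriv (\<lambda>s. deriv zeta s / zeta s) s"
    by (rule DERIV_imp_deriv[OF DERIV_add[OF 2 1]])
  finally have d: "deriv (\<lambda>w. deriv zeta_reg w / zeta_reg w) s = - 1 / (s - 1)\<^sup>2 + deriv (\<lambda>s. deriv zeta s / zeta s) s" .
  have alg: "e * (l * (1 / d + q) + (- 1 / d\<^sup>2 + q')) = e * (l / d - 1 / d\<^sup>2) + e * (l * q + q')" for e l d q q' :: complex
    by (simp add: algebra_simps)
  have "Zf.weighted_logderiv_deriv (ln x) s = exp (of_real (ln x) * s) *
     (of_real (ln x) * (deriv zeta_reg s / zeta_reg s) + deriv (\<lambda>s. deriv zeta_reg s / zeta_reg s) s)"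
    by (rule Zf.weighted_logderiv_deriv_eq[OF ln_x_pos zeta_reg_zero_Re zeta_reg_logderiv_zeta(1)[OF assms]])
  also have "\<dots> = exp (of_real (ln x) * s) * (of_real (ln x) * (1 / (s - 1) + deriv zeta s / zeta s) +
     (- 1 / (s - 1)\<^sup>2 + deriv (\<lambda>s. deriv zeta s / zeta s) s))"
    by (simp only: zeta_reg_logderiv_zeta(2)[OF assms] d)
  finally show ?thesis by (simp only: alg)
qed

text \<open>Passing from zeta to (s - 1) zeta(s) adds the derivative of x^s / (s - 1); subtracting
  the entire function \<open>h\<close> turns this into - x / (s - 1)^2. So \<open>B\<close>, the
  weighted smoothed sum minus \<open>h\<close>, is entire, and to the right the weighted derivative
  plus \<open>B\<close> is a decaying Dirichlet tail minus x / (s - 1)^2.\<close>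

theorem explicit_formula:
  assumes s1: "s \<noteq> 1" and zs: "zeta s \<noteq> 0"
  shows "exp (of_real (ln x) * s) * (of_real (ln x) * (deriv zeta s / zeta s) + deriv (\<lambda>s. deriv zeta s / zeta s) s + smoothed_sum s)
    = of_real x / (s - 1)\<^sup>2 - Zf.zero_sum (ln x) s"
proof -
  define L where "L = ln x"
  have L: "L > 0" using ln_x_pos by (simp add: L_def)
  have eL: "exp (of_real L) = complex_of_real x" using x by (simp add: L_def exp_of_real)
  obtain h where h: "h holomorphic_on UNIV"
    "\<And>s. s \<noteq> 1 \<Longrightarrow> deriv (\<lambda>s. exp (of_real L * s) / (s - 1)) s + exp (of_real L * 1) / (s - 1)\<^sup>2 = h s"
    using remove_exp_pole[of 1 "of_real L"] by blast
  have h': "h s = exp (of_real L * s) * (of_real L / (s - 1) - 1 / (s - 1)\<^sup>2) + of_real x / (s - 1)\<^sup>2" if "s \<noteq> 1" for s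
    using h(2)[OF that] deriv_exp_quotient[OF that, of L] eL by simp
  define B where "B = (\<lambda>s. exp (of_real L * s) * smoothed_sum s - h s)"
  have GB: "Zf.weighted_logderiv_deriv L s + B s = exp (of_real L * s) * (of_real L * (deriv zeta s / zeta s) + deriv (\<lambda>s. deriv zeta s / zeta s) s + smoothed_sum s) - of_real x / (s - 1)\<^sup>2"
    if "s \<noteq> 1" "zeta s \<noteq> 0" for s
    unfolding L_def weighted_logderiv_deriv_zeta[OF that] B_def h'[OF that(1), unfolded L_def] by (simp add: algebra_simps)
  obtain C \<delta> where C: "C \<ge> 0" "\<delta> > 0"
    "\<And>s. Re s \<ge> 2 \<Longrightarrow> norm (exp (of_real L * s) * dirichlet_series tail_coeff s) \<le> C * exp (- \<delta> * (Re s - 2))"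
    unfolding L_def using tail_bound by blast
  have GB2: "Zf.weighted_logderiv_deriv L s + B s = exp (of_real L * s) * dirichlet_series tail_coeff s - of_real x / (s - 1)\<^sup>2" if s: "Re s \<ge> 2" for s
  proof -
    have "s \<noteq> 1" using s by auto
    moreover have "zeta s \<noteq> 0" using s by (intro zeta_nonzero_right[OF RH]) auto
    ultimately show ?thesis using GB[of s] smoothed_sum_identity[of s] s by (simp add: L_def)
  qed
  define C1 where "C1 = (\<Sum>n\<in>sum_range. norm (mangoldt n * of_real (ln x - ln (real n)) :: complex) * exp (2 * L))"
  define CB where "CB = C1 + (exp (2 * L) * (L + 1) + x) + C"
  have C10: "C1 \<ge> 0" unfolding C1_def by (intro sum_nonneg) auto
  have "Zf.weighted_logderiv_deriv L s + Zf.zero_sum L s + B s = 0"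
  proof (rule Zf.explicit_formula_abstract[OF L zeta_reg_zero_Re])
    have "smoothed_sum holomorphic_on UNIV" unfolding smoothed_sum_def[abs_def] nat_powr_minus_def by (intro holomorphic_intros)
    thus "B holomorphic_on UNIV" unfolding B_def by (intro holomorphic_intros h(1))
    show "s \<notin> Zf.Z" by (rule zeta_reg_logderiv_zeta(1)[OF assms])
    show "norm (B s) \<le> CB" if s: "Re s \<le> 2" "norm s \<ge> 2" for s
    proof -
      \<comment> \<open>The closed form of \<open>h\<close> is available only away from 1; norm s >=
        2 keeps the distance at least 1.\<close>
      have n1: "norm (s - 1) \<ge> 1" using s norm_triangle_ineq2[of s 1] by simp
      hence ne: "s \<noteq> 1" by auto
      have i1: "norm (1 / (s - 1)) \<le> 1" using n1 by (simp add: norm_divide divide_le_eq)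
      have i2: "norm (1 / (s - 1)\<^sup>2) \<le> 1" using power_mono[OF i1, of 2] by (simp add: norm_divide norm_power power_one_over)
      have e2: "norm (exp (of_real L * s)) \<le> exp (2 * L)" using s L by simp
      \<comment> \<open>The factors x^s and n^(-s) must be combined before estimating: x / n >= 1
        keeps (x / n)^s bounded as Re s tends to minus infinity, while n^(-s) alone grows.\<close>
      have "norm (exp (of_real L * s) * smoothed_sum s) \<le> C1"
      proof -
        have "exp (of_real L * s) * smoothed_sum s = (\<Sum>n\<in>sum_range. mangoldt n * of_real (ln x - ln (real n)) * (exp (of_real L * s) * nat_powr_minus s n))"
          unfolding smoothed_sum_def sum_distrib_left by (intro sum.cong refl) (simp only: mult_ac)
        also have "norm \<dots> \<le> C1" unfolding C1_def
        proof (rule sum_norm_le)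
          fix n assume n: "n \<in> sum_range"
          hence n': "1 \<le> real n" "real n \<le> x" by (auto simp: sum_range_def)
          have ln: "0 \<le> ln (real n)" "ln (real n) \<le> L" using n' unfolding L_def by (auto intro!: ln_mono)
          have "(L - ln (real n)) * Re s \<le> (L - ln (real n)) * 2" using ln s by (intro mult_left_mono) auto
          also have "\<dots> \<le> 2 * L" using ln by simp
          finally have "norm (exp (of_real L * s) * nat_powr_minus s n) \<le> exp (2 * L)"
            unfolding nat_powr_minus_def norm_mult norm_exp_eq_Re exp_add[symmetric] by (simp add: algebra_simps)
          thus "norm (mangoldt n * of_real (ln x - ln (real n)) * (exp (of_real L * s) * nat_powr_minus s n)) \<le>
             norm (mangoldt n * of_real (ln x - ln (real n)) :: complex) * exp (2 * L)"
            unfolding norm_mult[of "mangoldt n * of_real (ln x - ln (real n))"] by (intro mult_left_mono) auto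
        qed
        finally show ?thesis .
      qed
      moreover have "norm (h s) \<le> exp (2 * L) * (L + 1) + x"
      proof -
        have "norm (of_real L / (s - 1) - 1 / (s - 1)\<^sup>2) \<le> L * norm (1 / (s - 1)) + norm (1 / (s - 1)\<^sup>2)"
          using norm_triangle_ineq4[of "of_real L / (s - 1)" "1 / (s - 1)\<^sup>2"] L by (simp add: norm_divide)
        also have "\<dots> \<le> L * 1 + 1" using i1 i2 L by (intro add_mono mult_left_mono) auto
        finally have "norm (exp (of_real L * s) * (of_real L / (s - 1) - 1 / (s - 1)\<^sup>2)) \<le> exp (2 * L) * (L + 1)"
          unfolding norm_mult using e2 by (intro mult_mono) auto
        moreover have "norm (of_real x / (s - 1)\<^sup>2) \<le> x"
          using mult_left_mono[OF i2, of x] x by (simp add: norm_divide)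
        ultimately show ?thesis unfolding h'[OF ne] using norm_triangle_mono by blast
      qed
      ultimately have "norm (B s) \<le> C1 + (exp (2 * L) * (L + 1) + x)"
        unfolding B_def by (intro norm_triangle_le_diff) linarith
      thus ?thesis using C(1) by (simp add: CB_def)
    qed
    have i2: "norm (of_real x / (s - 1)\<^sup>2) \<le> x / (Re s - 1)\<^sup>2" if s: "Re s \<ge> 2" for s
    proof -
      have "Re s - 1 \<le> norm (s - 1)" using complex_Re_le_cmod[of "s - 1"] by simp
      hence "(Re s - 1)\<^sup>2 \<le> (norm (s - 1))\<^sup>2" using s by (intro power_mono) auto
      moreover have "(Re s - 1)\<^sup>2 > 0" using s by simp
      ultimately show ?thesis using x unfolding norm_divide norm_power by (simp add: frac_le)
    qed
    have both: "norm (Zf.weighted_logderiv_deriv L s + B s) \<le> C * exp (- \<delta> * (Re s - 2)) + x / (Re s - 1)\<^sup>2" if s: "Re s \<ge> 2" for s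
      unfolding GB2[OF s] using C(3)[OF s] i2[OF s] by (intro norm_triangle_le_diff) linarith
    show "norm (Zf.weighted_logderiv_deriv L s + B s) \<le> CB" if s: "Re s \<ge> 2" for s
    proof -
      have "C * exp (- \<delta> * (Re s - 2)) \<le> C * 1" using s C by (intro mult_left_mono) auto
      moreover have "x / (Re s - 1)\<^sup>2 \<le> x / 1" using x s power_mono[of 1 "Re s - 1" 2] by (intro divide_left_mono) auto
      moreover have "0 \<le> exp (2 * L) * (L + 1)" using L by simp
      ultimately show ?thesis using both[OF s] C10 unfolding CB_def by linarith
    qed
    show "((\<lambda>\<sigma>::real. Zf.weighted_logderiv_deriv L (of_real \<sigma>) + B (of_real \<sigma>)) \<longlongrightarrow> 0) at_top"
    proof (rule Lim_null_comparison)
      show "\<forall>\<^sub>F \<sigma> in at_top. norm (Zf.weighted_logderiv_deriv L (of_real \<sigma>) + B (of_real \<sigma>)) \<le> C * exp (- \<delta> * (\<sigma> - 2)) + x / (\<sigma> - 1)\<^sup>2"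
        by (rule eventually_mono[OF eventually_ge_at_top[of 2]]) (use both[of "of_real _"] in simp)
      have "((\<lambda>\<sigma>. exp (- \<delta> * (\<sigma> - 2))) \<longlongrightarrow> 0) at_top" using C(2) by real_asymp
      moreover have "((\<lambda>\<sigma>. x / (\<sigma> - 1)\<^sup>2) \<longlongrightarrow> 0) at_top" using x by real_asymp
      ultimately have "((\<lambda>\<sigma>. C * exp (- \<delta> * (\<sigma> - 2)) + x / (\<sigma> - 1)\<^sup>2) \<longlongrightarrow> C * 0 + 0) at_top"
        by (intro tendsto_add tendsto_mult tendsto_const)
      thus "((\<lambda>\<sigma>. C * exp (- \<delta> * (\<sigma> - 2)) + x / (\<sigma> - 1)\<^sup>2) \<longlongrightarrow> 0) at_top" by simp
    qed
  qed
  moreover have "e = X - T" if "G + T + b = 0" "G + b = e - X" for e X T G b :: complex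
  proof -
    have "e = (G + b) + X" using that(2) by simp
    also have "G + b = - T" using that(1) by (metis add.assoc add.commute eq_neg_iff_add_eq_0)
    finally show ?thesis by simp
  qed
  ultimately show ?thesis using GB[OF assms] unfolding L_def by blast
qed

end

section \<open>Optimisation\<close>

lemma Re_line_derivative:
  assumes g: "(g has_field_derivative D) (at (Complex x t))"
  shows "((\<lambda>x. Re (g (Complex x t))) has_real_derivative Re D) (at x)"
proof -
  have "((\<lambda>x::real. complex_of_real x) has_vector_derivative of_real 1) (at x)"
    by (rule bounded_linear.has_vector_derivative[OF bounded_linear_of_real has_vector_derivative_id])
  from has_vector_derivative_add[OF this has_vector_derivative_const[of "\<i> * of_real t"]]
  have "((\<lambda>x. of_real x + \<i> * of_real t) has_vector_derivative 1) (at x)" by simp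
  moreover have "(\<lambda>x. Complex x t) = (\<lambda>x. of_real x + \<i> * of_real t)" by (rule ext) (rule Complex_eq)
  ultimately have line: "((\<lambda>x. Complex x t) has_vector_derivative 1) (at x)" by simp
  from field_vector_diff_chain_at[OF line g]
  have "((\<lambda>x. g (Complex x t)) has_vector_derivative D) (at x)" by (simp add: o_def)
  hence "((\<lambda>x. Re (g (Complex x t))) has_vector_derivative Re D) (at x)"
    by (rule bounded_linear.has_vector_derivative[OF bounded_linear_Re])
  thus ?thesis by (simp only: has_real_derivative_iff_has_vector_derivative)
qed

text \<open>The Basel sum without its first term; pi < 4 gives 16/6 - 1.\<close>

lemma inverse_squares_sum_le:
  assumes "finite B" "\<And>n. n \<in> B \<Longrightarrow> n \<ge> 2"
  shows "(\<Sum>n\<in>B. 1 / (real n)\<^sup>2) \<le> 5/3"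
proof -
  have "(\<Sum>n\<in>insert 1 B. 1 / (real n)\<^sup>2) = (\<Sum>m\<in>(\<lambda>n. n - 1) ` insert 1 B. 1 / (real m + 1)\<^sup>2)"
  proof (rule sum.reindex_bij_witness[of _ Suc "\<lambda>n. n - 1"])
    fix a assume "a \<in> insert 1 B"
    hence "a \<ge> 1" using assms(2)[of a] by auto
    thus "Suc (a - 1) = a" "1 / (real (a - 1) + 1)\<^sup>2 = 1 / (real a)\<^sup>2" by (simp_all add: of_nat_diff)
  next
    fix b assume "b \<in> (\<lambda>n. n - 1) ` insert 1 B"
    then obtain a where a: "a \<in> insert 1 B" "b = a - 1" by blast
    hence "a \<ge> 1" using assms(2)[of a] by auto
    with a show "Suc b \<in> insert 1 B" by simp
  qed auto
  also have "\<dots> \<le> (\<Sum>m. 1 / (real m + 1)\<^sup>2)"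
    using inverse_squares_sums assms(1) by (intro sum_le_suminf) (auto simp: sums_iff add.commute)
  also have "\<dots> = pi\<^sup>2 / 6" using inverse_squares_sums by (simp add: sums_iff add.commute)
  also have "\<dots> \<le> 4\<^sup>2 / 6" using pi_less_4 pi_gt3 by (intro divide_right_mono power_mono) auto
  finally have "(\<Sum>n\<in>insert 1 B. 1 / (real n)\<^sup>2) \<le> 8/3" by simp
  moreover have "1 \<notin> B" using assms(2)[of 1] by auto
  ultimately show ?thesis using assms(1) by simp
qed

text \<open>The positive root of exp (- \<alpha>) = \<alpha> + \<alpha>^2 / 2 is about 0.491225; the
  threshold is that root rounded up to five decimals. One side decreases and the other increases, so
  the threshold is the only value to check.\<close>

lemma exp_minus_le_quadratic:
  fixes \<alpha> :: real
  assumes "\<alpha> \<ge> 0.49123"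
  shows "exp (- \<alpha>) \<le> \<alpha> + \<alpha>\<^sup>2 / 2"
proof -
  define b where "b = (0.49123 :: real)"
  \<comment> \<open>The margin at \<open>b\<close> is of order 10^(-5), which six Taylor terms
    preserve and five would not.\<close>
  have "(\<Sum>n<6. b ^ n / fact n) \<le> exp b"
    unfolding exp_def using summable_exp_generic[of b]
    by (simp add: scaleR_conv_of_real divide_inverse mult.commute)
      (intro sum_le_suminf, auto simp: b_def field_simps)
  moreover have "1 \<le> (\<Sum>n<6. b ^ n / fact n) * (b + b\<^sup>2 / 2)"
    unfolding b_def by (simp add: eval_nat_numeral fact_numeral)
  moreover have "0 \<le> b + b\<^sup>2 / 2" by (simp add: b_def)
  ultimately have "1 \<le> exp b * (b + b\<^sup>2 / 2)" using mult_right_mono order_trans by blast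
  hence "exp (- b) \<le> b + b\<^sup>2 / 2" by (simp add: exp_minus field_simps)
  moreover have "exp (- \<alpha>) \<le> exp (- b)" using assms by (simp add: b_def)
  moreover have "b\<^sup>2 \<le> \<alpha>\<^sup>2" using assms by (intro power_mono) (auto simp: b_def)
  ultimately show ?thesis using assms unfolding b_def by linarith
qed

section \<open>The explicit formula along the line Im s = t\<close>

context
  fixes t x :: real
  assumes RH: "Riemann_Hypothesis" and t: "t \<ge> 10"
    and ord: "\<not> (\<exists>\<rho> \<in> zeta_zeros. Im \<rho> = t)" and x: "x \<ge> 2"
begin

text \<open>A zero on the critical line has |x^p| = sqrt x. For p = -2k one has |x^p| = x^(-2k) and
  |s - p| >= t, so the trivial zeros contribute at most a geometric series.\<close>

lemma zero_sum_line_bound: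
  "norm (Zf.zero_sum (ln x) (Complex \<sigma> t)) \<le> sqrt x * line_zero_sum t \<sigma> + 1 / (t\<^sup>2 * (x\<^sup>2 - 1))"
proof -
  define s L where "s = Complex \<sigma> t" and "L = ln x"
  have L: "L > 0" using x by (simp add: L_def)
  note ZRe = zeta_reg_zero_Re[OF RH x]
  have sZ: "s \<notin> Zf.Z" unfolding s_def
    by (rule zeta_reg_logderiv_zeta(1)[OF RH x line_ne_1[OF RH t ord] zeta_line_nonzero[OF RH t ord]])
  obtain \<delta> where d: "\<delta> > 0" "\<And>p. p \<in> Zf.Z \<Longrightarrow> \<delta> \<le> norm (s - p)" using Zf.dist_Z[OF sZ] by blast
  define F where "F = (\<lambda>p. of_nat (Zf.mult p) * exp (of_real L * p) / (s - p)\<^sup>2)"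
  have sub: "Xi.Z \<subseteq> Zf.Z" "trivial_zeros \<subseteq> Zf.Z" using zeta_reg_zeros(1)[OF RH] by auto
  have sm1: "F summable_on Xi.Z" unfolding F_def
    by (rule Zf.summable_zero_sum[OF L ZRe d(1) _ sub(1)]) (use d(2) sub in auto)
  have sm2: "F summable_on trivial_zeros" unfolding F_def
    by (rule Zf.summable_zero_sum[OF L ZRe d(1) _ sub(2)]) (use d(2) sub in auto)
  have T: "Zf.zero_sum L s = infsum F Xi.Z + infsum F trivial_zeros"
  proof -
    have "Zf.zero_sum L s = infsum F Zf.Z" unfolding F_def by (rule Zf.zero_sum_def[OF L ZRe])
    also have "\<dots> = infsum F Xi.Z + infsum F trivial_zeros"
      unfolding zeta_reg_zeros(1)[OF RH] by (rule infsum_Un_disjoint[OF sm1 sm2 zeta_reg_zeros(2)[OF RH]])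
    finally show ?thesis .
  qed
  have "norm (infsum F Xi.Z) \<le> (\<Sum>\<^sub>\<infinity>p\<in>Xi.Z. sqrt x * (real (Xi.mult p) / (norm (s - p))\<^sup>2))"
  proof (rule norm_has_sum_le[OF has_sum_infsum[OF sm1]])
    show "(\<lambda>p. sqrt x * (real (Xi.mult p) / (norm (s - p))\<^sup>2)) summable_on Xi.Z"
      unfolding s_def by (intro summable_on_cmult_right summable_line_zero_sum[OF RH t ord])
    fix p assume p: "p \<in> Xi.Z"
    have "norm (exp (of_real L * p)) = sqrt x"
      using xi_zero(1)[OF RH p] x by (simp add: L_def powr_half_sqrt[symmetric] powr_def)
    hence "norm (F p) = real (Xi.mult p) * sqrt x / (norm (s - p))\<^sup>2"
      by (simp add: F_def norm_mult norm_divide norm_power mult_zeta_reg_xi[OF RH p])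
    thus "norm (F p) \<le> sqrt x * (real (Xi.mult p) / (norm (s - p))\<^sup>2)" by (simp add: mult.commute[of "sqrt x"])
  qed
  also have "\<dots> = sqrt x * line_zero_sum t \<sigma>"
    unfolding infsum_cmult_right' line_zero_sum_def[OF RH t ord] s_def ..
  finally have 1: "norm (infsum F Xi.Z) \<le> sqrt x * line_zero_sum t \<sigma>" .
  define h where "h = (\<lambda>k::nat. - 2 * of_nat k :: complex)"
  have inj: "inj_on h {1..}" by (auto simp: inj_on_def h_def)
  have img: "trivial_zeros = h ` {1..}" by (auto simp: trivial_zeros_def h_def)
  have sm3: "(\<lambda>k. F (h k)) summable_on {1..}"
    using sm2 summable_on_reindex[OF inj, of F] unfolding img o_def by blast
  define q where "q = 1 / x\<^sup>2"
  have x2: "x\<^sup>2 > 1" using x by (simp add: one_less_power)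
  have q: "norm q < 1" "0 < q" using x2 x by (auto simp: q_def)
  have hs: "((\<lambda>k. q ^ k * (1 / t\<^sup>2)) has_sum (q / (1 - q) * (1 / t\<^sup>2))) {1..}"
    by (intro has_sum_cmult_left has_sum_geometric_from_1 q)
  have "norm (infsum F trivial_zeros) = norm (\<Sum>\<^sub>\<infinity>k\<in>{1..}. F (h k))"
    unfolding img infsum_reindex[OF inj] o_def ..
  also have "\<dots> \<le> (\<Sum>\<^sub>\<infinity>k\<in>{1..}. q ^ k * (1 / t\<^sup>2))"
  proof (rule norm_has_sum_le[OF has_sum_infsum[OF sm3]])
    show "(\<lambda>k. q ^ k * (1 / t\<^sup>2)) summable_on {1..}" using hs by (auto simp: summable_on_def)
    fix k :: nat assume k: "k \<in> {1..}"
    have m: "Zf.mult (h k) = 1" using k img by (intro mult_zeta_reg_trivial[OF RH]) auto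
    have "norm (exp (of_real L * h k)) = exp (- 2 * L) ^ k"
      by (simp add: h_def exp_of_nat_mult[symmetric] mult_ac)
    also have "exp (- 2 * L) = q"
    proof -
      have "exp (- 2 * L) = 1 / (exp L)\<^sup>2" by (simp add: exp_minus exp_double inverse_eq_divide)
      thus ?thesis using x by (simp add: q_def L_def)
    qed
    finally have e: "norm (exp (of_real L * h k)) = q ^ k" .
    have "t \<le> norm (s - h k)" using abs_Im_le_cmod[of "s - h k"] t by (simp add: s_def h_def)
    hence "t\<^sup>2 \<le> (norm (s - h k))\<^sup>2" using t by (intro power_mono) auto
    hence "1 / (norm (s - h k))\<^sup>2 \<le> 1 / t\<^sup>2" using t by (intro divide_left_mono mult_pos_pos) auto
    hence "q ^ k * (1 / (norm (s - h k))\<^sup>2) \<le> q ^ k * (1 / t\<^sup>2)" using q by (intro mult_left_mono) auto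
    thus "norm (F (h k)) \<le> q ^ k * (1 / t\<^sup>2)"
      unfolding F_def norm_divide norm_mult norm_power e m by simp
  qed
  also have "\<dots> = q / (1 - q) * (1 / t\<^sup>2)" by (rule infsumI[OF hs])
  also have "q / (1 - q) = 1 / (x\<^sup>2 - 1)"
  proof -
    have "1 / y / (1 - 1 / y) = 1 / (y - 1)" if "y > 1" for y :: real using that by (simp add: divide_simps)
    from this[OF x2] show ?thesis unfolding q_def .
  qed
  finally have 2: "norm (infsum F trivial_zeros) \<le> 1 / (t\<^sup>2 * (x\<^sup>2 - 1))" by (simp add: mult.commute)
  show ?thesis using 1 2 norm_triangle_ineq[of "infsum F Xi.Z" "infsum F trivial_zeros"]
    unfolding T[unfolded L_def s_def] by linarith
qed

text \<open>Minus the primitive of \<open>smoothed_sum\<close> that vanishes as Re s tends to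
  infinity. Its real part divided by ln x is the sum over n in the final bound.\<close>

definition smoothed_log_sum :: "complex \<Rightarrow> complex" where
  "smoothed_log_sum s = (\<Sum>n\<in>sum_range x. of_real (mangoldt n * (ln x - ln (real n)) / ln (real n)) * nat_powr_minus s n)"

lemma smoothed_log_sum_deriv: "(smoothed_log_sum has_field_derivative - smoothed_sum x s) (at s)"
proof -
  have "((\<lambda>s. nat_powr_minus s n) has_field_derivative - of_real (ln (real n)) * nat_powr_minus s n) (at s)" for n
    unfolding nat_powr_minus_def by (auto intro!: derivative_eq_intros)
  hence "(smoothed_log_sum has_field_derivative (\<Sum>n\<in>sum_range x. of_real (mangoldt n * (ln x - ln (real n)) / ln (real n)) *
     (- of_real (ln (real n)) * nat_powr_minus s n))) (at s)"
    unfolding smoothed_log_sum_def[abs_def] by (intro DERIV_sum DERIV_cmult)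
  also have "(\<Sum>n\<in>sum_range x. of_real (mangoldt n * (ln x - ln (real n)) / ln (real n)) * (- of_real (ln (real n)) * nat_powr_minus s n)) = - smoothed_sum x s"
    unfolding smoothed_sum_def[OF RH x] sum_negf[symmetric]
  proof (rule sum.cong)
    fix n assume n: "n \<in> sum_range x"
    hence "ln (real n) \<noteq> 0" by (auto simp: sum_range_def[OF RH x])
    thus "of_real (mangoldt n * (ln x - ln (real n)) / ln (real n)) * (- of_real (ln (real n)) * nat_powr_minus s n) =
       - (mangoldt n * of_real (ln x - ln (real n)) * nat_powr_minus s n)"
      by (simp add: field_simps)
  qed auto
  finally show ?thesis .
qed

text \<open>As a function \<Psi> of the abscissa, the left side has as derivative the real part of
  the bracket in the explicit formula, at most K0 exp (- L \<sigma>) in modulus. So \<Psi> minus K0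
  / L * exp (- L \<sigma>) is nondecreasing; it tends to 0 at infinity, hence is at most 0 at
  \<sigma>0. In \<open>K0\<close> the zero sum is frozen at \<sigma>0, where it is largest.\<close>

lemma log_zeta_bound:
  assumes \<sigma>0: "\<sigma>0 \<ge> 1/2"
  defines "K0 \<equiv> x / t\<^sup>2 + sqrt x * line_zero_sum t \<sigma>0 + 1 / (t\<^sup>2 * (x\<^sup>2 - 1))"
  shows "ln x * ln (norm (zeta (Complex \<sigma>0 t))) + Re (deriv zeta (Complex \<sigma>0 t) / zeta (Complex \<sigma>0 t))
    - Re (smoothed_log_sum (Complex \<sigma>0 t)) \<le> K0 / ln x * exp (- ln x * \<sigma>0)"
proof -
  define L where "L = ln x"
  have L: "L > 0" using x by (simp add: L_def)
  define z where "z = (\<lambda>\<sigma>. Complex \<sigma> t)"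
  note ne1 = line_ne_1[OF RH t ord] and znz = zeta_line_nonzero[OF RH t ord]
  define q where "q = (\<lambda>s. deriv zeta s / zeta s)"
  define \<Psi> where "\<Psi> = (\<lambda>\<sigma>. L * ln (norm (zeta (z \<sigma>))) + Re (q (z \<sigma>)) - Re (smoothed_log_sum (z \<sigma>)))"
  define W where "W = (\<lambda>s. of_real L * q s + deriv q s + smoothed_sum x s)"
  have dq: "(q has_field_derivative deriv q (z \<sigma>)) (at (z \<sigma>))" for \<sigma>
  proof -
    have "continuous_on (- {1}) zeta" by (rule holomorphic_on_imp_continuous_on[OF zeta_holomorphic])
    hence op: "open ((- {1}) \<inter> zeta -` (- {0}))" by (intro continuous_open_preimage) auto
    hence "q holomorphic_on ((- {1}) \<inter> zeta -` (- {0}))" unfolding q_def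
      by (intro holomorphic_intros holomorphic_deriv holomorphic_on_subset[OF zeta_holomorphic]) auto
    from holomorphic_derivI[OF this op, of "z \<sigma>"] show ?thesis using ne1[of \<sigma>] znz[of \<sigma>] by (simp add: z_def)
  qed
  have d\<Psi>: "(\<Psi> has_real_derivative Re (W (z \<sigma>))) (at \<sigma>)" for \<sigma>
  proof -
    have 1: "((\<lambda>\<sigma>. ln (norm (zeta (Complex \<sigma> t)))) has_real_derivative Re (q (z \<sigma>))) (at \<sigma>)"
      unfolding q_def z_def by (rule ln_cmod_line_derivative[OF zeta_deriv[OF ne1] znz])
    have 2: "((\<lambda>\<sigma>. Re (q (Complex \<sigma> t))) has_real_derivative Re (deriv q (z \<sigma>))) (at \<sigma>)"
      using dq[of \<sigma>] unfolding z_def by (rule Re_line_derivative)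
    have 3: "((\<lambda>\<sigma>. Re (smoothed_log_sum (Complex \<sigma> t))) has_real_derivative Re (- smoothed_sum x (z \<sigma>))) (at \<sigma>)"
      using smoothed_log_sum_deriv[of "z \<sigma>"] unfolding z_def by (rule Re_line_derivative)
    from DERIV_diff[OF DERIV_add[OF DERIV_cmult[OF 1, of L] 2] 3]
    show ?thesis unfolding \<Psi>_def W_def by (simp add: z_def)
  qed
  have Wb: "norm (W (z \<sigma>)) \<le> K0 * exp (- L * \<sigma>)" if \<sigma>: "\<sigma> \<ge> \<sigma>0" for \<sigma>
  proof -
    have "exp (L * \<sigma>) * norm (W (z \<sigma>)) = norm (exp (of_real L * z \<sigma>) * W (z \<sigma>))"
      by (simp add: norm_mult z_def)
    also have "exp (of_real L * z \<sigma>) * W (z \<sigma>) = of_real x / (z \<sigma> - 1)\<^sup>2 - Zf.zero_sum L (z \<sigma>)"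
      unfolding W_def q_def L_def z_def by (rule explicit_formula[OF RH x ne1 znz])
    also have "norm \<dots> \<le> x / t\<^sup>2 + (sqrt x * line_zero_sum t \<sigma>0 + 1 / (t\<^sup>2 * (x\<^sup>2 - 1)))"
    proof (rule norm_triangle_le_diff, rule add_mono)
      have "t \<le> norm (z \<sigma> - 1)" using abs_Im_le_cmod[of "z \<sigma> - 1"] t by (simp add: z_def)
      hence "t\<^sup>2 \<le> (norm (z \<sigma> - 1))\<^sup>2" using t by (intro power_mono) auto
      thus "norm (of_real x / (z \<sigma> - 1)\<^sup>2) \<le> x / t\<^sup>2"
        using t x unfolding norm_divide norm_power by (simp add: frac_le)
      have "sqrt x * line_zero_sum t \<sigma> \<le> sqrt x * line_zero_sum t \<sigma>0"
        using \<sigma> \<sigma>0 x by (intro mult_left_mono line_zero_sum_antimono[OF RH t ord]) auto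
      thus "norm (Zf.zero_sum L (z \<sigma>)) \<le> sqrt x * line_zero_sum t \<sigma>0 + 1 / (t\<^sup>2 * (x\<^sup>2 - 1))"
        using zero_sum_line_bound[of \<sigma>] unfolding L_def z_def by linarith
    qed
    finally have "exp (L * \<sigma>) * norm (W (z \<sigma>)) \<le> K0" by (simp add: K0_def)
    thus ?thesis by (simp add: exp_minus field_simps)
  qed
  define \<Theta> where "\<Theta> = (\<lambda>\<sigma>. \<Psi> \<sigma> - K0 / L * exp (- L * \<sigma>))"
  have mono: "\<Theta> \<sigma>0 \<le> \<Theta> \<sigma>" if "\<sigma> \<ge> \<sigma>0" for \<sigma>
  proof (rule DERIV_nonneg_imp_nondecreasing[OF that])
    fix y assume y: "\<sigma>0 \<le> y" "y \<le> \<sigma>"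
    have e: "((\<lambda>\<sigma>. K0 / L * exp (- L * \<sigma>)) has_real_derivative - (K0 * exp (- L * y))) (at y)"
      using L by (auto intro!: derivative_eq_intros)
    have "(\<Theta> has_real_derivative Re (W (z y)) - - (K0 * exp (- L * y))) (at y)"
      unfolding \<Theta>_def by (rule DERIV_diff[OF d\<Psi> e])
    moreover have "0 \<le> Re (W (z y)) - - (K0 * exp (- L * y))"
      using Wb[OF y(1)] abs_Re_le_cmod[of "W (z y)"] by linarith
    ultimately show "\<exists>d. (\<Theta> has_real_derivative d) (at y) \<and> 0 \<le> d" by blast
  qed
  have lim: "(\<Theta> \<longlongrightarrow> 0) at_top"
  proof -
    have ev: "eventually (\<lambda>\<sigma>::real. 1 < \<sigma>) at_top" by (rule eventually_gt_at_top)
    have "((\<lambda>\<sigma>. ln (norm (dirichlet_series one_coeff (Complex \<sigma> t)))) \<longlongrightarrow> ln (norm (1::complex))) at_top"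
      by (intro tendsto_ln tendsto_norm dirichlet_series_limit one_coeff_summable) auto
    moreover have "eventually (\<lambda>\<sigma>. ln (norm (dirichlet_series one_coeff (Complex \<sigma> t))) = ln (norm (zeta (z \<sigma>)))) at_top"
      using ev by eventually_elim (simp add: zeta_dirichlet_series z_def)
    ultimately have 1: "((\<lambda>\<sigma>. ln (norm (zeta (z \<sigma>)))) \<longlongrightarrow> 0) at_top"
      using tendsto_cong by force
    have "((\<lambda>\<sigma>. Re (- dirichlet_series mang_coeff (Complex \<sigma> t))) \<longlongrightarrow> Re (- mang_coeff 0)) at_top"
      by (intro tendsto_Re tendsto_minus dirichlet_series_limit mang_coeff_summable) auto
    moreover have "eventually (\<lambda>\<sigma>. Re (- dirichlet_series mang_coeff (Complex \<sigma> t)) = Re (q (z \<sigma>))) at_top"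
      using ev by eventually_elim (simp add: zeta_logderiv_dirichlet_series[OF RH] z_def q_def)
    ultimately have 2: "((\<lambda>\<sigma>. Re (q (z \<sigma>))) \<longlongrightarrow> 0) at_top"
      using tendsto_cong by force
    have "((\<lambda>\<sigma>. smoothed_log_sum (z \<sigma>)) \<longlongrightarrow> 0) at_top"
      unfolding smoothed_log_sum_def
    proof (intro tendsto_null_sum tendsto_mult_right_zero)
      fix n assume n: "n \<in> sum_range x"
      hence n2: "real n \<ge> 2" by (simp add: sum_range_def[OF RH x])
      have "((\<lambda>\<sigma>. real n powr - \<sigma>) \<longlongrightarrow> 0) at_top" using n2 by real_asymp
      hence "((\<lambda>\<sigma>. norm (nat_powr_minus (z \<sigma>) n)) \<longlongrightarrow> 0) at_top" using n2 by (simp add: norm_nat_powr_minus z_def)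
      thus "((\<lambda>\<sigma>. nat_powr_minus (z \<sigma>) n) \<longlongrightarrow> 0) at_top" by (rule tendsto_norm_zero_cancel)
    qed
    hence 3: "((\<lambda>\<sigma>. Re (smoothed_log_sum (z \<sigma>))) \<longlongrightarrow> 0) at_top" using tendsto_Re by fastforce
    have 4: "((\<lambda>\<sigma>. exp (- L * \<sigma>)) \<longlongrightarrow> 0) at_top" using L by real_asymp
    have "(\<Theta> \<longlongrightarrow> L * 0 + 0 - 0 - K0 / L * 0) at_top"
      unfolding \<Theta>_def \<Psi>_def by (intro tendsto_intros 1 2 3 4)
    thus ?thesis by simp
  qed
  have "\<Theta> \<sigma>0 \<le> 0"
    by (rule tendsto_lowerbound[OF lim eventually_mono[OF eventually_ge_at_top[of \<sigma>0] mono]]) auto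
  thus ?thesis by (simp add: \<Theta>_def \<Psi>_def z_def q_def L_def)
qed

lemma Re_smoothed_log_sum:
  "Re (smoothed_log_sum (Complex \<sigma> t)) / ln x = (\<Sum>n | 2 \<le> n \<and> real n \<le> x.
          mangoldt n * ln (x / real n) * cos (t * ln (real n))
          / (real n powr \<sigma> * ln (real n) * ln x))"
  unfolding smoothed_log_sum_def Re_sum sum_divide_distrib sum_range_def[OF RH x]
proof (rule sum.cong)
  fix n assume "n \<in> {n. 2 \<le> n \<and> real n \<le> x}"
  hence n: "real n \<ge> 2" by auto
  have "Re (nat_powr_minus (Complex \<sigma> t) n) = cos (t * ln (real n)) / real n powr \<sigma>"
  proof -
    have "- (Complex \<sigma> t * of_real (ln (real n))) = Complex (- (\<sigma> * ln (real n))) (- (t * ln (real n)))"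
      by (simp add: complex_eq_iff)
    hence "Re (nat_powr_minus (Complex \<sigma> t) n) = exp (- (\<sigma> * ln (real n))) * cos (t * ln (real n))"
      unfolding nat_powr_minus_def by (simp only: Re_exp complex.sel cos_minus)
    also have "exp (- (\<sigma> * ln (real n))) = 1 / real n powr \<sigma>"
      using n by (simp add: powr_def exp_minus inverse_eq_divide)
    finally show ?thesis by simp
  qed
  moreover have "ln (x / real n) = ln x - ln (real n)" using n x by (simp add: ln_div)
  ultimately show "Re (of_real (mangoldt n * (ln x - ln (real n)) / ln (real n)) * nat_powr_minus (Complex \<sigma> t) n) / ln x =
     mangoldt n * ln (x / real n) * cos (t * ln (real n)) / (real n powr \<sigma> * ln (real n) * ln x)"
    by (simp add: mult_ac)
qed auto

end

theorem theorem4: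
  fixes \<alpha> t x :: real
  assumes "Riemann_Hypothesis"
    and "\<alpha> \<ge> 0.49123"
    and "t \<ge> 10"
    and "2 \<le> x" and "x \<le> t\<^sup>2"
    and "\<not> (\<exists>\<rho> \<in> zeta_zeros. Im \<rho> = t)"
  shows "ln (cmod (zeta (1 / 2 + \<i> * of_real t)))
    \<le> (\<Sum>n | 2 \<le> n \<and> real n \<le> x.
          mangoldt n * ln (x / real n) * cos (t * ln (real n))
          / (real n powr sigma_line x \<alpha> * ln (real n) * ln x))
      + (1 + \<alpha>) / 2 * (ln t / ln x)
      + 3 * (1 + \<alpha>) / ln x
      + exp (- \<alpha>) / (sqrt x * (ln x)\<^sup>2) * (1 + 1 / (x * (x\<^sup>2 - 1)))"
proof -
  note RH = assms(1) and t = assms(3) and ord = assms(6) and x = assms(4)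
  define L where "L = ln x"
  define u where "u = \<alpha> / L"
  define \<sigma> where "\<sigma> = 1/2 + u"
  define A where "A = ln t / 2 + 3"
  define P where "P = (\<Sum>n | 2 \<le> n \<and> real n \<le> x.
          mangoldt n * ln (x / real n) * cos (t * ln (real n))
          / (real n powr \<sigma> * ln (real n) * ln x))"
  define E where "E = exp (- \<alpha>) / (sqrt x * L\<^sup>2) * (1 + 1 / (x * (x\<^sup>2 - 1)))"
  have L: "L > 0" using x by (simp add: L_def)
  have \<alpha>: "\<alpha> > 0" using assms(2) by simp
  have u: "u > 0" "u * L = \<alpha>" using L \<alpha> by (auto simp: u_def)
  have x2: "x\<^sup>2 > 1" using x by (simp add: one_less_power)
  have E0: "E \<ge> 0" unfolding E_def using x x2 by (intro mult_nonneg_nonneg add_nonneg_nonneg divide_nonneg_nonneg) auto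
  have sig: "sigma_line x \<alpha> = \<sigma>" by (simp add: sigma_line_def \<sigma>_def u_def L_def)
  have half: "1 / 2 + \<i> * of_real t = Complex (1/2) t" by (simp add: complex_eq_iff)
  have lnt: "ln t \<ge> 1"
  proof -
    have "exp 1 \<le> t" using exp_le t by linarith
    thus ?thesis using t by (simp add: ln_ge_iff)
  qed
  \<comment> \<open>Origin of the two middle terms: A / L comes from zeta'/zeta at abscissa
    \<sigma>, and u * A from the segment between 1/2 and \<sigma>.\<close>
  have main: "(1 + \<alpha>) / 2 * (ln t / L) + 3 * (1 + \<alpha>) / L = A / L + u * A"
    using L by (simp add: A_def u_def field_simps)
  have "ln (norm (zeta (Complex (1/2) t))) \<le> P + (A / L + u * A) + E"
  \<comment> \<open>The bounds for zeta'/zeta on the line are established up to \<sigma> = 3; beyond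
    that the slack in u * A suffices.\<close>
  proof (cases "\<sigma> \<le> 3")
    case True
    define S where "S = line_zero_sum t \<sigma>"
    define lz where "lz = ln (norm (zeta (Complex \<sigma> t)))"
    define R where "R = Re (deriv zeta (Complex \<sigma> t) / zeta (Complex \<sigma> t))"
    have S: "S \<ge> 0" unfolding S_def by (rule line_zero_sum_nonneg[OF RH t ord])
    have 1: "ln (norm (zeta (Complex (1/2) t))) \<le> lz + u * A - u\<^sup>2 / 2 * S"
      using zeta_half_line_bound[OF RH t ord _ True] u unfolding lz_def A_def S_def by (simp add: \<sigma>_def)
    have 2: "- R \<le> A - u * S"
      using neg_logderiv_bound[OF RH t ord _ True] u unfolding R_def A_def S_def by (simp add: \<sigma>_def)
    define K0 where "K0 = x / t\<^sup>2 + sqrt x * S + 1 / (t\<^sup>2 * (x\<^sup>2 - 1))"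
    have 3: "L * lz + R - Re (smoothed_log_sum x (Complex \<sigma> t)) \<le> K0 / L * exp (- L * \<sigma>)"
      using log_zeta_bound[OF RH t ord x, of \<sigma>] u unfolding K0_def L_def lz_def R_def S_def by (simp add: \<sigma>_def)
    have "K0 / L * exp (- L * \<sigma>) \<le> exp (- \<alpha>) / L * S + E * L"
    proof -
      have ex: "exp (- L * \<sigma>) = exp (- \<alpha>) / sqrt x"
      proof -
        have "- L * \<sigma> = - \<alpha> + - (L / 2)" using u(2) by (simp add: \<sigma>_def algebra_simps)
        hence "exp (- L * \<sigma>) = exp (- \<alpha>) * exp (- (L / 2))" by (simp only: exp_add)
        moreover have "exp (L / 2) = sqrt x"
        proof -
          have "sqrt x = x powr (1 / 2)" using x by (simp add: powr_half_sqrt)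
          also have "\<dots> = exp (L / 2)" using x by (simp add: powr_def L_def)
          finally show ?thesis by simp
        qed
        ultimately show ?thesis by (simp only: exp_minus divide_inverse)
      qed
      have t2: "t\<^sup>2 > 0" using t by simp
      \<comment> \<open>The assumption that x is at most t^2 enters here: it removes t from both
        elementary terms of \<open>K0\<close>.\<close>
      have "x / t\<^sup>2 \<le> 1" using assms(5) t2 by (simp add: divide_le_eq)
      moreover have "1 / (t\<^sup>2 * (x\<^sup>2 - 1)) \<le> 1 / (x * (x\<^sup>2 - 1))"
      proof (rule divide_left_mono)
        show "x * (x\<^sup>2 - 1) \<le> t\<^sup>2 * (x\<^sup>2 - 1)" using assms(5) x2 by (intro mult_right_mono) auto
        show "0 < t\<^sup>2 * (x\<^sup>2 - 1) * (x * (x\<^sup>2 - 1))" using t2 x2 x by simp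
      qed simp
      ultimately have "K0 \<le> sqrt x * S + (1 + 1 / (x * (x\<^sup>2 - 1)))" unfolding K0_def by linarith
      hence "K0 * (exp (- \<alpha>) / sqrt x / L) \<le> (sqrt x * S + (1 + 1 / (x * (x\<^sup>2 - 1)))) * (exp (- \<alpha>) / sqrt x / L)"
        using L x by (intro mult_right_mono) auto
      also have "\<dots> = exp (- \<alpha>) / L * S + E * L"
      proof -
        have g: "(r * S + w) * (e / r / l) = e / l * S + e / (r * l\<^sup>2) * w * l" if "r \<noteq> 0" "l \<noteq> 0" for w e r l :: real
          using that by (simp add: divide_simps) (simp add: algebra_simps power2_eq_square)
        have "sqrt x \<noteq> 0" "L \<noteq> 0" using L x by auto
        from g[OF this, of "1 + 1 / (x * (x\<^sup>2 - 1))" "exp (- \<alpha>)"] show ?thesis unfolding E_def .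
      qed
      finally have "K0 * (exp (- \<alpha>) / sqrt x / L) \<le> exp (- \<alpha>) / L * S + E * L" .
      moreover have "K0 / L * (exp (- \<alpha>) / sqrt x) = K0 * (exp (- \<alpha>) / sqrt x / L)" by simp
      ultimately show ?thesis unfolding ex by (simp only:)
    qed
    with 2 3 have "L * lz \<le> Re (smoothed_log_sum x (Complex \<sigma> t)) + (A - u * S) + exp (- \<alpha>) / L * S + E * L" by linarith
    hence "lz \<le> (Re (smoothed_log_sum x (Complex \<sigma> t)) + (A - u * S) + exp (- \<alpha>) / L * S + E * L) / L"
      using L by (simp add: pos_le_divide_eq mult.commute)
    also have "\<dots> = P + A / L + E + S * (exp (- \<alpha>) / L\<^sup>2 - u / L)"
    proof -
      have g: "(Q + (A - u * S) + e / l * S + E * l) / l = Q / l + A / l + E + S * (e / l\<^sup>2 - u / l)" if "l \<noteq> 0" for Q e l :: real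
        using that by (simp add: divide_simps) (simp add: algebra_simps power2_eq_square)
      have h: "Re (smoothed_log_sum x (Complex \<sigma> t)) / L = P"
        unfolding P_def L_def by (rule Re_smoothed_log_sum[OF RH t ord x])
      have "L \<noteq> 0" using L by simp
      from g[OF this, of "Re (smoothed_log_sum x (Complex \<sigma> t))" "exp (- \<alpha>)"] show ?thesis unfolding h .
    qed
    finally have lz: "lz \<le> P + A / L + E + S * (exp (- \<alpha>) / L\<^sup>2 - u / L)" .
    have "S * (c - u\<^sup>2 / 2) = S * c - u\<^sup>2 / 2 * S" for c by (simp add: algebra_simps)
    from this[of "exp (- \<alpha>) / L\<^sup>2 - u / L"] lz 1
    have "ln (norm (zeta (Complex (1/2) t))) \<le> P + (A / L + u * A) + E + S * (exp (- \<alpha>) / L\<^sup>2 - u / L - u\<^sup>2 / 2)"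
      by linarith
    \<comment> \<open>The positive part is due to the zeros in the explicit formula, u / L to
      zeta'/zeta at \<sigma>, and u^2 / 2 to the segment. Since S itself is not estimated, this sign
      decides which \<alpha> are admissible.\<close>
    moreover have "S * (exp (- \<alpha>) / L\<^sup>2 - u / L - u\<^sup>2 / 2) \<le> 0"
    proof -
      have "exp (- \<alpha>) / L\<^sup>2 - u / L - u\<^sup>2 / 2 = (exp (- \<alpha>) - (\<alpha> + \<alpha>\<^sup>2 / 2)) / L\<^sup>2"
      proof -
        have "e - a / l / l - (a / l)\<^sup>2 / 2 = (e * l\<^sup>2 - (a + a\<^sup>2 / 2)) / l\<^sup>2" if "l \<noteq> 0" for e a l :: real
          using that by (simp add: divide_simps) (simp add: algebra_simps power2_eq_square)
        from this[of L "exp (- \<alpha>) / L\<^sup>2" \<alpha>] show ?thesis using L by (simp add: u_def)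
      qed
      also have "\<dots> \<le> 0" using exp_minus_le_quadratic[OF assms(2)] by (intro divide_nonpos_nonneg) auto
      finally show ?thesis using S by (intro mult_nonneg_nonpos)
    qed
    ultimately show ?thesis by linarith
  next
    case False
    have u3: "u \<ge> 5/2" using False by (simp add: \<sigma>_def)
    have A: "A \<ge> 7/2" using lnt by (simp add: A_def)
    have "ln (norm (zeta (Complex (1/2) t))) \<le> ln (norm (zeta (Complex 2 t))) + 3/2 * A"
      using zeta_half_line_bound[OF RH t ord, of 2] line_zero_sum_nonneg[OF RH t ord, of 2] unfolding A_def by (simp add: power2_eq_square)
    also have "ln (norm (zeta (Complex 2 t))) \<le> 5/3"
    proof -
      have "norm (zeta (Complex 2 t)) \<le> (\<Sum>m. 1 / (real m + 1)\<^sup>2)"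
        unfolding zeta_dirichlet_series[of "Complex 2 t", simplified] dirichlet_series_def
      proof (rule norm_suminf_le)
        show "norm (1 * nat_powr_minus (Complex 2 t) (Suc n)) \<le> 1 / (real n + 1)\<^sup>2" for n
          by (simp add: norm_nat_powr_minus powr_minus_divide powr_numeral add.commute)
        show "summable (\<lambda>m. 1 / (real m + 1)\<^sup>2)" using inverse_squares_sums by (simp add: sums_iff add.commute)
      qed
      also have "\<dots> = pi\<^sup>2 / 6" using inverse_squares_sums by (simp add: sums_iff add.commute)
      also have "\<dots> \<le> 4\<^sup>2 / 6" using pi_less_4 pi_gt3 by (intro divide_right_mono power_mono) auto
      finally have "norm (zeta (Complex 2 t)) \<le> 8/3" by simp
      moreover have "norm (zeta (Complex 2 t)) > 0" using zeta_line_nonzero[OF RH t ord] by simp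
      ultimately show ?thesis using ln_le_minus_one[of "norm (zeta (Complex 2 t))"] by linarith
    qed
    finally have 1: "ln (norm (zeta (Complex (1/2) t))) \<le> 5/3 + 3/2 * A" by simp
    \<comment> \<open>The two logarithms in the denominator cancel the bounds ln n for
      \<open>mangoldt\<close> and ln x for the weight, and \<sigma> > 3 leaves more than
      n^2.\<close>
    have "\<bar>P\<bar> \<le> (\<Sum>n | 2 \<le> n \<and> real n \<le> x. 1 / (real n)\<^sup>2)"
      unfolding P_def
    proof (rule sum_abs[THEN order_trans], rule sum_mono)
      fix n assume "n \<in> {n. 2 \<le> n \<and> real n \<le> x}"
      hence n: "real n \<ge> 2" "real n \<le> x" by auto
      have ln: "ln (real n) > 0" "ln (real n) \<le> ln x" using n by auto
      have l: "0 \<le> ln (x / real n)" "ln (x / real n) \<le> ln x" using n ln by (auto simp: ln_div)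
      have m: "0 \<le> (mangoldt n :: real)" "mangoldt n \<le> ln (real n)" using mangoldt_le[of n] mangoldt_nonneg[of n] n by auto
      have p: "real n powr \<sigma> \<ge> (real n)\<^sup>2"
      proof -
        have "real n powr 2 \<le> real n powr \<sigma>" using n False by (intro powr_mono) auto
        thus ?thesis using n by (simp add: powr_numeral)
      qed
      have "\<bar>mangoldt n * ln (x / real n) * cos (t * ln (real n))\<bar> \<le> ln (real n) * ln x * 1"
        unfolding abs_mult using m l ln by (intro mult_mono) auto
      note b = this
      have "\<bar>mangoldt n * ln (x / real n) * cos (t * ln (real n)) / (real n powr \<sigma> * ln (real n) * ln x)\<bar>
        \<le> ln (real n) * ln x / (real n powr \<sigma> * ln (real n) * ln x)"
      proof -
        have d: "0 < real n powr \<sigma> * ln (real n) * ln x" using ln n by (intro mult_pos_pos) auto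
        thus ?thesis using b unfolding abs_divide abs_of_pos[OF d]
          by (intro divide_right_mono) auto
      qed
      also have "\<dots> = 1 / real n powr \<sigma>" using ln by (simp add: field_simps)
      also have "\<dots> \<le> 1 / (real n)\<^sup>2" using p n by (intro divide_left_mono mult_pos_pos) auto
      finally show "\<bar>mangoldt n * ln (x / real n) * cos (t * ln (real n)) / (real n powr \<sigma> * ln (real n) * ln x)\<bar> \<le> 1 / (real n)\<^sup>2" .
    qed
    also have "\<dots> \<le> 5/3"
      using finite_sum_range[OF RH x] unfolding sum_range_def[OF RH x] by (intro inverse_squares_sum_le) auto
    finally have 2: "- (5/3) \<le> P" by linarith
    have "5/2 * A \<le> u * A" using u3 A by (intro mult_right_mono) auto
    moreover have "0 \<le> A / L" using A L by simp
    \<comment> \<open>It remains that 5/3 + 3/2 A <= -5/3 + 5/2 A, that is A >= 10/3, which A >= 7/2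
      gives.\<close>
    ultimately show ?thesis using 1 2 E0 A by linarith
  qed
  thus ?thesis unfolding half sig using main by (simp add: P_def E_def L_def)
qed

end
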